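(* Let $G$ be a countable discrete sofic group with sofic approximation $\Sigma$. Let $\cdots\to(X_3,\mu_3,T_3)\to(X_2,\mu_2,T_2)\to(X_1,\mu_1,T_1)$ be an inverse sequence of $G$-systems and factor maps. If every $(X_i,\mu_i,T_i)$ has connected model spaces rel $\Sigma$, then the inverse limit of the sequence also has connected model spaces rel $\Sigma$.
   Context: Sofic approximations and systems. A sofic approximation to $G$ is a sequence $\Sigma=(\sigma_n)_{n\ge 1}$ of maps $\sigma_n:G\to\mathrm{Sym}(V_n)$, $g\mapsto\sigma_n^g$, where $V_n$ are finite sets with $|V_n|\to\infty$, such that for all $g,h\in G$ the proportion of $v\in V_n$ with $\sigma_n^g(\sigma_n^h(v))=\sigma_n^{gh}(v)$ tends to $1$, and for all $g\neq h$ the proportion of $v\in V_n$ with $\sigma_n^g(v)\ne\sigma_n^h(v)$ tends to $1$. A $G$-system $(X,\mu,T)$ is a standard probability space $(X,\mu)$ with a measurable $\mu$-preserving action $T$ of $G$. A factor map between $G$-systems is a measurable map, equivariant a.e., pushing the first measure to the second; it is an isomorphism if it is invertible modulo null sets. Metric $G$-processes. A metric $G$-process $(\mathcal{X}^G,\mu,S,d)$ consists of a standard measurable space $\mathcal{X}$, a compact metric $d$ on $\mathcal{X}$ whose Borel $\sigma$-algebra is that of $\mathcal{X}$, the right-shift action $(S^h x)_g=x_{gh}$ of $G$ on $\mathcal{X}^G$, and an $S$-invariant probability measure $\mu$ on $\mathcal{X}^G$. The weak$^\ast$ topology on $\mathrm{Prob}(\mathcal{X}^G)$ (Borel probability measures)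 refers to the product topology on $\mathcal{X}^G$ arising from $d$. For finite $V$, $d^{(V)}(\mathbf{x},\mathbf{x}')=\frac1{|V|}\sum_{v\in V}d(x_v,x'_v)$ on $\mathcal{X}^V$. Models. For $\sigma:G\to\mathrm{Sym}(V)$, $v\in V$, $\mathbf{x}\in\mathcal{X}^V$, put $\Pi^\sigma_v(\mathbf{x})=(x_{\sigma^g(v)})_{g\in G}\in\mathcal{X}^G$ and $P^\sigma_{\mathbf{x}}=\frac1{|V|}\sum_{v\in V}\delta_{\Pi^\sigma_v(\mathbf{x})}$ (empirical distribution). For a weak$^\ast$-neighbourhood $\mathcal{O}$ of $\mu$, $\Omega(\mathcal{O},\sigma_n)=\{\mathbf{x}\in\mathcal{X}^{V_n}:P^{\sigma_n}_{\mathbf{x}}\in\mathcal{O}\}$. Connected model spaces. A $\delta$-path from $x$ to $y$ in a metric space $(Y,d_Y)$ is a finite sequence $x=x_0,\dots,x_\ell=y$ with $d_Y(x_i,x_{i+1})<\delta$ for all $0\le i<\ell$. A metric $G$-process $(\mathcal{X}^G,\mu,S,d)$ has connected model spaces rel $\Sigma$ if: whenever $n_1<n_2<\cdots$ and $\mathbf{x}_i,\mathbf{y}_i\in\mathcal{X}^{V_{n_i}}$ satisfy $P^{\sigma_{n_i}}_{\mathbf{x}_i}\to\mu$ and $P^{\sigma_{n_i}}_{\mathbf{y}_i}\to\mu$ weak$^\ast$, there are $\delta_i\downarrow0$ and $\delta_i$-paths $\mathbf{x}_i=\mathbf{x}_{i,0},\dots,\mathbf{x}_{i,\ell_i}=\mathbf{y}_i$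 in $(\mathcal{X}^{V_{n_i}},d^{(V_{n_i})})$ such that for every weak$^\ast$-neighbourhood $\mathcal{O}$ of $\mu$ we have $\{\mathbf{x}_{i,j}:0\le j\le\ell_i\}\subseteq\Omega(\mathcal{O},\sigma_{n_i})$ for all sufficiently large $i$. Extension to general systems. Having connected model spaces rel $\Sigma$ is known to be independent of the choice of $d$ and invariant under isomorphism of the systems $(\mathcal{X}^G,\mu,S)$. Every $G$-system is isomorphic to some $(\mathcal{X}^G,\mu,S)$ underlying a metric $G$-process; a $G$-system has connected model spaces rel $\Sigma$ if one (equivalently, every) metric $G$-process to which it is isomorphic does. *)

theory Defs
  imports "HOL-Probability.Probability" "HOL-Algebra.Group" "HOL-Combinatorics.Permutations"
begin

section \<open>Sofic approximations\<close>

definition sofic_approximation ::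
  "('g, 'z) monoid_scheme \<Rightarrow> (nat \<Rightarrow> 'v set) \<Rightarrow> (nat \<Rightarrow> 'g \<Rightarrow> 'v \<Rightarrow> 'v) \<Rightarrow> bool" where
  "sofic_approximation G V \<sigma> \<longleftrightarrow>
     (\<forall>n. finite (V n)) \<and>
     filterlim (\<lambda>n. card (V n)) at_top sequentially \<and>
     (\<forall>n. \<forall>g\<in>carrier G. \<sigma> n g permutes V n) \<and>
     (\<forall>g\<in>carrier G. \<forall>h\<in>carrier G.
        (\<lambda>n. real (card {v \<in> V n. \<sigma> n g (\<sigma> n h v) = \<sigma> n (g \<otimes>\<^bsub>G\<^esub> h) v}) / real (card (V n)))
          \<longlonglongrightarrow> 1) \<and>
     (\<forall>g\<in>carrier G. \<forall>h\<in>carrier G. g \<noteq> h \<longrightarrow>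
        (\<lambda>n. real (card {v \<in> V n. \<sigma> n g v \<noteq> \<sigma> n h v}) / real (card (V n))) \<longlonglongrightarrow> 1)"


section \<open>Systems, factor maps and inverse limits\<close>

definition borel_on :: "'a topology \<Rightarrow> 'a measure" where
  "borel_on X = sigma (topspace X) {U. openin X U}"

text \<open>Only the underlying measurable space of the argument matters here. Second countable and
  completely metrizable topologies are exactly the Polish ones.\<close>

definition standard_borel :: "'a measure \<Rightarrow> bool" where
  "standard_borel M \<longleftrightarrow>
     (\<exists>X. completely_metrizable_space X \<and> second_countable X \<and> sets M = sets (borel_on X))"

definition G_system :: "('g, 'z) monoid_scheme \<Rightarrow> 'a measure \<Rightarrow> ('g \<Rightarrow> 'a \<Rightarrow> 'a) \<Rightarrow> bool" where
  "G_system G M T \<longleftrightarrow>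
     prob_space M \<and> standard_borel M \<and>
     (\<forall>g\<in>carrier G. T g \<in> measurable M M) \<and>
     (\<forall>x\<in>space M. T \<one>\<^bsub>G\<^esub> x = x) \<and>
     (\<forall>g\<in>carrier G. \<forall>h\<in>carrier G. \<forall>x\<in>space M. T (g \<otimes>\<^bsub>G\<^esub> h) x = T g (T h x)) \<and>
     (\<forall>g\<in>carrier G. distr M M (T g) = M)"

definition factor_map :: "('g, 'z) monoid_scheme \<Rightarrow> 'a measure \<Rightarrow> ('g \<Rightarrow> 'a \<Rightarrow> 'a) \<Rightarrow>
    'b measure \<Rightarrow> ('g \<Rightarrow> 'b \<Rightarrow> 'b) \<Rightarrow> ('a \<Rightarrow> 'b) \<Rightarrow> bool" where
  "factor_map G M T N S \<phi> \<longleftrightarrow>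
     \<phi> \<in> measurable M N \<and>
     (\<forall>g\<in>carrier G. AE x in M. \<phi> (T g x) = S g (\<phi> x)) \<and>
     distr M N \<phi> = N"

definition isomorphic_systems :: "('g, 'z) monoid_scheme \<Rightarrow> 'a measure \<Rightarrow> ('g \<Rightarrow> 'a \<Rightarrow> 'a) \<Rightarrow>
    'b measure \<Rightarrow> ('g \<Rightarrow> 'b \<Rightarrow> 'b) \<Rightarrow> bool" where
  "isomorphic_systems G M T N S \<longleftrightarrow>
     (\<exists>\<phi> \<psi>. factor_map G M T N S \<phi> \<and> \<psi> \<in> measurable N M \<and>
        (AE x in M. \<psi> (\<phi> x) = x) \<and> (AE y in N. \<phi> (\<psi> y) = y))"

text \<open>The inverse limit of a sequence of systems \<open>(M i, T i)\<close> with bonding maps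
  \<open>\<pi> i : M (i + 1) \<rightarrow> M i\<close>, determined up to isomorphism: a system with a compatible family of
  factor maps onto the \<open>M i\<close> that together generate its \<open>\<sigma>\<close>-algebra modulo null sets. Since
  bonding maps are equivariant only almost everywhere, the set of compatible threads in the
  product need not be invariant, so the limit is not defined as that set.\<close>

definition inverse_limit :: "('g, 'z) monoid_scheme \<Rightarrow> (nat \<Rightarrow> 'a measure) \<Rightarrow>
    (nat \<Rightarrow> 'g \<Rightarrow> 'a \<Rightarrow> 'a) \<Rightarrow> (nat \<Rightarrow> 'a \<Rightarrow> 'a) \<Rightarrow> 'b measure \<Rightarrow> ('g \<Rightarrow> 'b \<Rightarrow> 'b) \<Rightarrow> bool" where
  "inverse_limit G M T \<pi> N S \<longleftrightarrow>
     G_system G N S \<and>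
     (\<exists>\<phi>. (\<forall>i. factor_map G N S (M i) (T i) (\<phi> i)) \<and>
          (\<forall>i. AE x in N. \<pi> i (\<phi> (Suc i) x) = \<phi> i x) \<and>
          (\<forall>A\<in>sets N. \<exists>B\<in>sigma_sets (space N) (\<Union>i. {\<phi> i -` C \<inter> space N |C. C \<in> sets (M i)}).
             (A - B) \<union> (B - A) \<in> null_sets N))"


section \<open>Metric processes\<close>

definition shift :: "('g, 'z) monoid_scheme \<Rightarrow> 'g \<Rightarrow> ('g \<Rightarrow> 'x) \<Rightarrow> 'g \<Rightarrow> 'x" where
  "shift G h x = (\<lambda>g\<in>carrier G. x (g \<otimes>\<^bsub>G\<^esub> h))"

text \<open>As with \<open>standard_borel\<close>, only the measurable space underlying the alphabet \<open>K\<close> is used.\<close>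

definition metric_process ::
  "('g, 'z) monoid_scheme \<Rightarrow> 'x measure \<Rightarrow> 'x metric \<Rightarrow> ('g \<Rightarrow> 'x) measure \<Rightarrow> bool" where
  "metric_process G K d \<mu> \<longleftrightarrow>
     standard_borel K \<and> compact_space (mtopology_of d) \<and>
     sets K = sets (borel_on (mtopology_of d)) \<and>
     prob_space \<mu> \<and> sets \<mu> = sets (PiM (carrier G) (\<lambda>_. K)) \<and>
     (\<forall>h\<in>carrier G. distr \<mu> \<mu> (shift G h) = \<mu>)"

definition process_topology :: "('g, 'z) monoid_scheme \<Rightarrow> 'x metric \<Rightarrow> ('g \<Rightarrow> 'x) topology" where
  "process_topology G d = product_topology (\<lambda>_. mtopology_of d) (carrier G)"

text \<open>The coarsest topology on the Borel probability measures on \<open>X\<close> making integration of every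
  continuous function continuous. It is used for compact \<open>X\<close>, where continuous functions are
  bounded. The choice \<open>f = 0\<close>, \<open>W = UNIV\<close> shows that the carrier is the set of all Borel
  probability measures.\<close>

definition weak_star_topology :: "'a topology \<Rightarrow> 'a measure topology" where
  "weak_star_topology X = topology_generated_by
     {{\<nu>. prob_space \<nu> \<and> sets \<nu> = sets (borel_on X) \<and> (\<integral>x. f x \<partial>\<nu>) \<in> W} | f W.
        continuous_map X euclideanreal f \<and> open W}"


section \<open>Connected model spaces\<close>

definition mean_dist :: "'x metric \<Rightarrow> 'v set \<Rightarrow> ('v \<Rightarrow> 'x) \<Rightarrow> ('v \<Rightarrow> 'x) \<Rightarrow> real" where
  "mean_dist d V x x' = (\<Sum>v\<in>V. mdist d (x v) (x' v)) / real (card V)"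

definition pullback_name ::
  "('g, 'z) monoid_scheme \<Rightarrow> ('g \<Rightarrow> 'v \<Rightarrow> 'v) \<Rightarrow> ('v \<Rightarrow> 'x) \<Rightarrow> 'v \<Rightarrow> 'g \<Rightarrow> 'x" where
  "pullback_name G s x v = (\<lambda>g\<in>carrier G. x (s g v))"

text \<open>The image of the uniform distribution on \<open>V\<close> under \<open>v \<mapsto> pullback_name G s x v\<close>, that is,
  the average of the corresponding point masses.\<close>

definition empirical_distribution :: "('g, 'z) monoid_scheme \<Rightarrow> 'x measure \<Rightarrow> 'v set \<Rightarrow>
    ('g \<Rightarrow> 'v \<Rightarrow> 'v) \<Rightarrow> ('v \<Rightarrow> 'x) \<Rightarrow> ('g \<Rightarrow> 'x) measure" where
  "empirical_distribution G K V s x =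
     distr (uniform_count_measure V) (PiM (carrier G) (\<lambda>_. K)) (pullback_name G s x)"

definition model_space :: "('g, 'z) monoid_scheme \<Rightarrow> 'x measure \<Rightarrow> 'v set \<Rightarrow>
    ('g \<Rightarrow> 'v \<Rightarrow> 'v) \<Rightarrow> ('g \<Rightarrow> 'x) measure set \<Rightarrow> ('v \<Rightarrow> 'x) set" where
  "model_space G K V s W = {x \<in> V \<rightarrow>\<^sub>E space K. empirical_distribution G K V s x \<in> W}"

definition delta_path ::
  "'y set \<Rightarrow> ('y \<Rightarrow> 'y \<Rightarrow> real) \<Rightarrow> real \<Rightarrow> 'y \<Rightarrow> 'y \<Rightarrow> nat \<Rightarrow> (nat \<Rightarrow> 'y) \<Rightarrow> bool" where
  "delta_path Y dY \<delta> x y l p \<longleftrightarrow>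
     p 0 = x \<and> p l = y \<and> (\<forall>j\<le>l. p j \<in> Y) \<and> (\<forall>j<l. dY (p j) (p (Suc j)) < \<delta>)"

definition process_connected_model_spaces :: "('g, 'z) monoid_scheme \<Rightarrow> (nat \<Rightarrow> 'v set) \<Rightarrow>
    (nat \<Rightarrow> 'g \<Rightarrow> 'v \<Rightarrow> 'v) \<Rightarrow> 'x measure \<Rightarrow> 'x metric \<Rightarrow> ('g \<Rightarrow> 'x) measure \<Rightarrow> bool" where
  "process_connected_model_spaces G V \<sigma> K d \<mu> \<longleftrightarrow>
     (\<forall>n x y. strict_mono n \<longrightarrow>
        (\<forall>i. x i \<in> V (n i) \<rightarrow>\<^sub>E space K) \<longrightarrow>
        (\<forall>i. y i \<in> V (n i) \<rightarrow>\<^sub>E space K) \<longrightarrow>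
        limitin (weak_star_topology (process_topology G d))
          (\<lambda>i. empirical_distribution G K (V (n i)) (\<sigma> (n i)) (x i)) \<mu> sequentially \<longrightarrow>
        limitin (weak_star_topology (process_topology G d))
          (\<lambda>i. empirical_distribution G K (V (n i)) (\<sigma> (n i)) (y i)) \<mu> sequentially \<longrightarrow>
        (\<exists>\<delta> l p. (\<forall>i. 0 < \<delta> i) \<and> decseq \<delta> \<and> \<delta> \<longlonglongrightarrow> 0 \<and>
           (\<forall>i. delta_path (V (n i) \<rightarrow>\<^sub>E space K) (mean_dist d (V (n i)))
                  (\<delta> i) (x i) (y i) (l i) (p i)) \<and>
           (\<forall>W. openin (weak_star_topology (process_topology G d)) W \<and> \<mu> \<in> W \<longrightarrow>
              (\<forall>\<^sub>F i in sequentially.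
                 p i ` {0..l i} \<subseteq> model_space G K (V (n i)) (\<sigma> (n i)) W))))"

text \<open>Alphabets are taken inside the fixed type \<^typ>\<open>nat \<Rightarrow> real\<close>, with an arbitrary carrier, metric
  and \<open>\<sigma>\<close>-algebra. This is no restriction: every compact metric space embeds in the Hilbert cube.\<close>

definition connected_model_spaces :: "('g, 'z) monoid_scheme \<Rightarrow> (nat \<Rightarrow> 'v set) \<Rightarrow>
    (nat \<Rightarrow> 'g \<Rightarrow> 'v \<Rightarrow> 'v) \<Rightarrow> 'a measure \<Rightarrow> ('g \<Rightarrow> 'a \<Rightarrow> 'a) \<Rightarrow> bool" where
  "connected_model_spaces G V \<sigma> M T \<longleftrightarrow>
     (\<exists>(K :: (nat \<Rightarrow> real) measure) d \<mu>.
        metric_process G K d \<mu> \<and>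
        isomorphic_systems G M T \<mu> (shift G) \<and>
        process_connected_model_spaces G V \<sigma> K d \<mu>)"

end

theory Submission
  imports Defs
begin

text \<open>
  Weak* convergence of empirical distributions means convergence of the averages of every
  continuous function over the pullback names \<open>\<Pi>\<^sub>v(x)\<close>. Model spaces of a metric process are
  therefore connected iff, for every finite set of continuous functions and every \<open>\<eta> > 0\<close>,
  any two sequences of models of the law are eventually joined by \<open>\<eta>\<close>-paths along which these
  averages stay within \<open>\<eta>\<close> of the integrals (\<open>process_connected_iff\<close>); separability of
  \<open>C(K\<^sup>G)\<close> and a diagonal choice return a single sequence of paths.

  The limit system is coded over the Hilbert cube. Level \<open>k\<close> is isomorphic to a process whose
  compact alphabet embeds in the cube, and the symbols at the identity that a point receives at
  all levels, interleaved, form one point of the cube (\<open>coding\<close>). Its orbit is the name of the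
  point. Since the levels generate, the names are an isomorphic copy of the limit
  (\<open>limit_process_isomorphic\<close>). Selecting the coordinates of level \<open>k\<close> is a continuous map
  of alphabets and carries the law of the names to the law of level \<open>k\<close>. In the other direction
  only approximate continuity is available: level \<open>k\<close> determines all lower levels through
  the measurable bonding maps, and late coordinates hardly count in the metric of the cube, so
  for large \<open>k\<close> the whole symbol at the identity is up to a small mean error a measurable
  function of the level \<open>k\<close> name, hence by density of continuous functions in \<open>L\<^sup>1\<close> a continuous
  function \<open>F\<close> of it (\<open>approximate_reconstruction\<close>). This is the reason for working over the
  cube: its coordinates can be approximated one by one, whereas continuous functions with values
  in a disconnected alphabet may be too few.

  Let now \<open>x\<close>, \<open>y\<close> be good models of the limit process. The coordinates of level \<open>k\<close> of \<open>x\<close> and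
  \<open>y\<close>, moved to nearest points of the embedded alphabet, are good models of level \<open>k\<close>
  (\<open>round_models\<close>), so a path \<open>p\<close> of good models of level \<open>k\<close> joins them. Replace each
  \<open>p j\<close> by the model \<open>v \<mapsto> F (\<Pi>\<^sub>v(p j))\<close>. Uniform continuity of \<open>F\<close> keeps the steps short. By
  soficity the new models nearly represent the image of the level \<open>k\<close> law under the
  sliding block code of \<open>F\<close>, which is close to the limit law. The first and the last of them are
  close to \<open>x\<close> and \<open>y\<close> in mean, because \<open>F\<close> almost reconstructs symbols, so one further short
  step at each end completes a path from \<open>x\<close> to \<open>y\<close> (\<open>process_connected_transfer\<close>,
  \<open>cube_process_connected\<close>).
\<close>

section \<open>Process spaces over compact metric alphabets\<close>

lemma dense_sequence_of_compact_metric: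
  assumes "compact_space (mtopology_of d)" and "mspace d \<noteq> {}"
  obtains e :: "nat \<Rightarrow> 'a" where "\<And>k. e k \<in> mspace d"
    and "\<And>x r. x \<in> mspace d \<Longrightarrow> 0 < r \<Longrightarrow> \<exists>k. mdist d (e k) x < r"
proof -
  interpret Metric_space "mspace d" "mdist d" by (rule Metric_space_mspace_mdist)
  have tb: "mtotally_bounded (mspace d)"
    using assms(1) compact_space_eq_mcomplete_mtotally_bounded mtopology_of_def by metis
  have "\<forall>n::nat. \<exists>F. finite F \<and> F \<subseteq> mspace d \<and> mspace d \<subseteq> (\<Union>x\<in>F. mball x (1 / Suc n))"
    using tb unfolding mtotally_bounded_def by simp
  then obtain F where F: "\<And>n::nat. finite (F n)" "\<And>n. F n \<subseteq> mspace d"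
      "\<And>n. mspace d \<subseteq> (\<Union>x\<in>F n. mball x (1 / Suc n))" by metis
  define C where "C = (\<Union>n. F n)"
  have C: "countable C" "C \<subseteq> mspace d" unfolding C_def using F by (auto intro: countable_finite)
  have "C \<noteq> {}" using F(3)[of 0] assms(2) unfolding C_def by fastforce
  have e: "range (from_nat_into C) = C" using C(1) \<open>C \<noteq> {}\<close> by (rule range_from_nat_into[rotated])
  show thesis
  proof
    show "from_nat_into C k \<in> mspace d" for k using C(2) e by blast
    fix x and r :: real assume x: "x \<in> mspace d" and r: "0 < r"
    obtain n :: nat where n: "1 / Suc n < r" using r nat_approx_posE by blast
    obtain c where c: "c \<in> F n" "x \<in> mball c (1 / Suc n)" using F(3)[of n] x by blast
    have "c \<in> range (from_nat_into C)" using c(1) e C_def by blast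
    then obtain k where "from_nat_into C k = c" by blast
    with c n show "\<exists>k. mdist d (from_nat_into C k) x < r"
      by (intro exI[of _ k]) simp
  qed
qed

lemma topspace_process_topology [simp]:
  "topspace (process_topology G d) = (\<Pi>\<^sub>E g\<in>carrier G. mspace d)"
  by (simp add: process_topology_def)

lemma compact_process_topology:
  assumes "compact_space (mtopology_of d)"
  shows "compact_space (process_topology G d)"
  using assms by (simp add: process_topology_def compact_space_product_topology)

lemma metrizable_process_topology:
  assumes "countable (carrier G)"
  shows "metrizable_space (process_topology G d)"
  unfolding process_topology_def metrizable_space_product_topology
  using assms by (auto simp: mtopology_of_def Metric_space.metrizable_space_mtopology
    intro: countable_subset)

lemma openin_process_topology_box:
  assumes "openin (process_topology G d) U" and "z \<in> U"
  obtains B where "finite {g \<in> carrier G. B g \<noteq> mspace d}"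
    "\<And>g. g \<in> carrier G \<Longrightarrow> openin (mtopology_of d) (B g)"
    "z \<in> Pi\<^sub>E (carrier G) B" "Pi\<^sub>E (carrier G) B \<subseteq> U"
proof -
  have "\<exists>B. finite {g \<in> carrier G. B g \<noteq> mspace d} \<and>
    (\<forall>g\<in>carrier G. openin (mtopology_of d) (B g)) \<and> z \<in> Pi\<^sub>E (carrier G) B \<and> Pi\<^sub>E (carrier G) B \<subseteq> U"
    using assms unfolding process_topology_def openin_product_topology_alt by simp
  then show thesis using that by blast
qed

text \<open>Uniform continuity in a form suited to names: closeness is only tested on a finite window of
  the group. Every point has a basic box on which \<open>f\<close> varies little, and finitely many boxes
  of half the radius cover the compact space.\<close>

lemma process_topology_uniform_continuity:
  assumes comp: "compact_space (mtopology_of d)"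
    and f: "continuous_map (process_topology G d) (mtopology_of e) f"
    and eps: "(0::real) < \<epsilon>"
  shows "\<exists>E \<tau>. finite E \<and> E \<subseteq> carrier G \<and> 0 < \<tau> \<and>
    (\<forall>z\<in>topspace (process_topology G d). \<forall>z'\<in>topspace (process_topology G d).
       (\<forall>g\<in>E. mdist d (z g) (z' g) < \<tau>) \<longrightarrow> mdist e (f z) (f z') < \<epsilon>)"
proof -
  let ?Z = "process_topology G d"
  interpret D: Metric_space "mspace d" "mdist d" by (rule Metric_space_mspace_mdist)
  interpret E: Metric_space "mspace e" "mdist e" by (rule Metric_space_mspace_mdist)
  have fim: "f z \<in> mspace e" if "z \<in> topspace ?Z" for z
    using f that continuous_map_funspace by fastforce
  have "\<exists>F t. finite F \<and> F \<subseteq> carrier G \<and> 0 < t \<and>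
      (\<forall>z'\<in>topspace ?Z. (\<forall>g\<in>F. mdist d (z g) (z' g) < 2 * t) \<longrightarrow> mdist e (f z) (f z') < \<epsilon> / 2)"
    if z: "z \<in> topspace ?Z" for z
  proof -
    have "openin ?Z {w \<in> topspace ?Z. f w \<in> E.mball (f z) (\<epsilon> / 2)}"
      using f by (intro openin_continuous_map_preimage) (auto simp: mtopology_of_def)
    moreover have "z \<in> {w \<in> topspace ?Z. f w \<in> E.mball (f z) (\<epsilon> / 2)}"
      using z fim eps by auto
    ultimately obtain U where U: "finite {g \<in> carrier G. U g \<noteq> mspace d}"
      "\<And>g. g \<in> carrier G \<Longrightarrow> openin (mtopology_of d) (U g)" "z \<in> Pi\<^sub>E (carrier G) U"
      "Pi\<^sub>E (carrier G) U \<subseteq> {w \<in> topspace ?Z. f w \<in> E.mball (f z) (\<epsilon> / 2)}"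
      by (rule openin_process_topology_box) blast
    define F where "F = {g \<in> carrier G. U g \<noteq> mspace d}"
    have "\<exists>r>0. D.mball (z g) r \<subseteq> U g" if "g \<in> F" for g
      using U(2)[of g] U(3) that unfolding mtopology_of_def D.openin_mtopology F_def
      by (auto simp: PiE_iff)
    then obtain r where r: "\<And>g. g \<in> F \<Longrightarrow> 0 < r g" "\<And>g. g \<in> F \<Longrightarrow> D.mball (z g) (r g) \<subseteq> U g"
      by metis
    define t where "t = Min (insert 1 (r ` F)) / 2"
    have fF: "finite F" using U(1) F_def by simp
    have t: "0 < t" "\<And>g. g \<in> F \<Longrightarrow> 2 * t \<le> r g" unfolding t_def using fF r(1) by (auto simp: Min_gr_iff)
    have "mdist e (f z) (f z') < \<epsilon> / 2"
      if z': "z' \<in> topspace ?Z" "\<forall>g\<in>F. mdist d (z g) (z' g) < 2 * t" for z'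
    proof -
      have "z' g \<in> U g" if g: "g \<in> carrier G" for g
      proof (cases "g \<in> F")
        case True
        then have "mdist d (z g) (z' g) < r g" using z'(2) t(2) by force
        then show ?thesis using r(2)[OF True] z z'(1) g by (auto simp: PiE_iff)
      next
        case False
        then show ?thesis using z'(1) g by (auto simp: F_def PiE_iff)
      qed
      then have "z' \<in> Pi\<^sub>E (carrier G) U" using z'(1) by (auto simp: PiE_iff)
      then show ?thesis using U(4) by auto
    qed
    then show ?thesis using fF t(1) F_def by (intro exI[of _ F] exI[of _ t]) auto
  qed
  then obtain F t where Ft: "\<And>z. z \<in> topspace ?Z \<Longrightarrow> finite (F z)"
    "\<And>z. z \<in> topspace ?Z \<Longrightarrow> F z \<subseteq> carrier G" "\<And>z. z \<in> topspace ?Z \<Longrightarrow> 0 < t z"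
    "\<And>z z'. z \<in> topspace ?Z \<Longrightarrow> z' \<in> topspace ?Z \<Longrightarrow> (\<forall>g\<in>F z. mdist d (z g) (z' g) < 2 * t z)
      \<Longrightarrow> mdist e (f z) (f z') < \<epsilon> / 2"
    by metis
  define W where "W z = {w \<in> topspace ?Z. \<forall>g\<in>F z. mdist d (z g) (w g) < t z}" for z
  have "openin ?Z (W z)" if z: "z \<in> topspace ?Z" for z
  proof -
    have "W z = Pi\<^sub>E (carrier G) (\<lambda>g. if g \<in> F z then D.mball (z g) (t z) else mspace d)"
      unfolding W_def using z Ft(2)[OF z] by (auto simp: PiE_iff extensional_def split: if_splits)
    also have "openin ?Z \<dots>"
    proof -
      have "{g \<in> carrier G. (if g \<in> F z then D.mball (z g) (t z) else mspace d) \<noteq> topspace (mtopology_of d)} \<subseteq> F z"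
        by (auto split: if_splits)
      then have "finite {g \<in> carrier G. (if g \<in> F z then D.mball (z g) (t z) else mspace d) \<noteq> topspace (mtopology_of d)}"
        using Ft(1)[OF z] finite_subset by blast
      moreover have "openin (mtopology_of d) (mspace d)" using openin_topspace[of "mtopology_of d"] by simp
      ultimately show ?thesis
        unfolding process_topology_def openin_PiE_gen by (auto simp: mtopology_of_def)
    qed
    finally show ?thesis .
  qed
  moreover have "z \<in> W z" if "z \<in> topspace ?Z" for z
    unfolding W_def using that Ft(3)[OF that] Ft(2)[OF that] by (auto simp: PiE_iff subset_iff)
  ultimately obtain C where C: "finite C" "C \<subseteq> topspace ?Z" "topspace ?Z \<subseteq> (\<Union>z\<in>C. W z)"
    using compact_process_topology[OF comp, of G]
    unfolding compact_space_def compactin_def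
    by (smt (verit, ccfv_threshold) UN_iff finite_subset_image image_iff subsetI)
  show ?thesis
  proof (intro exI conjI ballI impI)
    show "finite (\<Union>z\<in>C. F z)" "(\<Union>z\<in>C. F z) \<subseteq> carrier G" using C Ft(1,2) by blast+
    show t0: "0 < Min (insert 1 (t ` C))" using C Ft(3) by (auto simp: Min_gr_iff)
    fix z z' assume z: "z \<in> topspace ?Z" "z' \<in> topspace ?Z"
      and close: "\<forall>g\<in>(\<Union>z\<in>C. F z). mdist d (z g) (z' g) < Min (insert 1 (t ` C))"
    obtain c where c: "c \<in> C" "z \<in> W c" using C(3) z(1) by blast
    have cZ: "c \<in> topspace ?Z" using c C(2) by blast
    have zc: "\<forall>g\<in>F c. mdist d (c g) (z g) < t c" using c(2) W_def by simp
    have "mdist e (f c) (f z) < \<epsilon> / 2"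
      using Ft(4)[OF cZ z(1)] zc Ft(3)[OF cZ] by force
    moreover have "mdist d (c g) (z' g) < 2 * t c" if g: "g \<in> F c" for g
    proof -
      have "g \<in> carrier G" using g Ft(2)[OF cZ] by blast
      then have in_d: "c g \<in> mspace d" "z g \<in> mspace d" "z' g \<in> mspace d" using cZ z by auto
      have "Min (insert 1 (t ` C)) \<le> t c" using c(1) C(1) by simp
      then have "mdist d (z g) (z' g) < t c" using close c(1) g by fastforce
      then show ?thesis using zc g D.triangle[OF in_d] by force
    qed
    then have "mdist e (f c) (f z') < \<epsilon> / 2" using Ft(4)[OF cZ z(2)] by blast
    ultimately show "mdist e (f z) (f z') < \<epsilon>"
      using E.triangle''[of "f z" "f z'" "f c"] fim z cZ by (smt (verit) E.commute E.triangle field_sum_of_halves)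
  qed
qed

section \<open>Borel sets of process spaces\<close>

lemma space_borel_on [simp]: "space (borel_on X) = topspace X"
  unfolding borel_on_def by (rule space_measure_of) (auto dest: openin_subset)

lemma sets_borel_on: "sets (borel_on X) = sigma_sets (topspace X) {U. openin X U}"
  unfolding borel_on_def by (rule sets_measure_of) (auto dest: openin_subset)

lemma openin_in_sets_borel_on: "openin X U \<Longrightarrow> U \<in> sets (borel_on X)"
  by (auto simp: sets_borel_on)

lemma closedin_in_sets_borel_on: "closedin X U \<Longrightarrow> U \<in> sets (borel_on X)"
  by (metis closedin_def openin_in_sets_borel_on sets.compl_sets space_borel_on double_diff order_refl)

lemma measurable_borel_onI:
  assumes "f \<in> space M \<rightarrow> topspace X" and "\<And>U. openin X U \<Longrightarrow> f -` U \<inter> space M \<in> sets M"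
  shows "f \<in> measurable M (borel_on X)"
  unfolding borel_on_def using assms by (intro measurable_measure_of) (auto dest: openin_subset)

lemma continuous_map_measurable_borel_on:
  assumes "continuous_map X Y f"
  shows "f \<in> measurable (borel_on X) (borel_on Y)"
proof (rule measurable_borel_onI)
  show "f \<in> space (borel_on X) \<rightarrow> topspace Y" using assms continuous_map_funspace by fastforce
  fix U assume "openin Y U"
  then have "openin X {x \<in> topspace X. f x \<in> U}" using assms openin_continuous_map_preimage by blast
  moreover have "f -` U \<inter> space (borel_on X) = {x \<in> topspace X. f x \<in> U}" by auto
  ultimately show "f -` U \<inter> space (borel_on X) \<in> sets (borel_on X)" by (simp add: openin_in_sets_borel_on)
qed

lemma borel_on_euclidean [simp]: "sets (borel_on euclidean) = sets borel"
  by (simp add: sets_borel_on borel_def)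

lemma continuous_map_borel_measurable:
  assumes "continuous_map X euclidean f" and "sets M = sets (borel_on X)"
  shows "f \<in> borel_measurable M"
  using continuous_map_measurable_borel_on[OF assms(1)]
  by (simp add: measurable_cong_sets[OF assms(2) borel_on_euclidean[symmetric]])

text \<open>A product Borel set over a countable index set is Borel for the product topology; conversely
  open sets are countable unions of compact sets, hence of boxes. Laws of
  processes are given on the left-hand \<open>\<sigma>\<close>-algebra, weak* topologies refer to the right-hand one.\<close>

lemma sets_borel_on_product:
  assumes comp: "compact_space (mtopology_of d)" and I: "countable (carrier G)"
    and K: "sets K = sets (borel_on (mtopology_of d))"
  shows "sets (PiM (carrier G) (\<lambda>_. K)) = sets (borel_on (process_topology G d))"
proof
  let ?Z = "process_topology G d"
  have spK: "space K = mspace d" using sets_eq_imp_space_eq[OF K] by simp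
  show "sets (PiM (carrier G) (\<lambda>_. K)) \<subseteq> sets (borel_on ?Z)"
  proof (rule sets_PiM_in_sets)
    show "space (borel_on ?Z) = (\<Pi>\<^sub>E i\<in>carrier G. space K)" by (simp add: spK)
    fix g A assume g: "g \<in> carrier G" and A: "A \<in> sets K"
    have "(\<lambda>z. z g) \<in> measurable (borel_on ?Z) (borel_on (mtopology_of d))"
      using g by (intro continuous_map_measurable_borel_on)
        (auto simp: process_topology_def intro: continuous_map_product_projection)
    from measurable_sets[OF this, of A] A K
    show "{x \<in> space (borel_on ?Z). x g \<in> A} \<in> sets (borel_on ?Z)"
      by (simp add: vimage_def Int_def conj_commute)
  qed
  have "U \<in> sets (PiM (carrier G) (\<lambda>_. K))" if U: "openin ?Z U" for U
  proof -
    define \<B> where "\<B> = {Pi\<^sub>E (carrier G) B |B. finite {g \<in> carrier G. B g \<noteq> mspace d} \<and>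
        (\<forall>g\<in>carrier G. openin (mtopology_of d) (B g)) \<and> Pi\<^sub>E (carrier G) B \<subseteq> U}"
    have Bopen: "openin ?Z A" if "A \<in> \<B>" for A
      using that unfolding \<B>_def process_topology_def by (auto simp: openin_PiE_gen)
    have cover: "\<Union>\<B> = U"
    proof
      show "U \<subseteq> \<Union>\<B>"
      proof
        fix z assume "z \<in> U"
        then obtain B where "finite {g \<in> carrier G. B g \<noteq> mspace d}"
          "\<And>g. g \<in> carrier G \<Longrightarrow> openin (mtopology_of d) (B g)"
          "z \<in> Pi\<^sub>E (carrier G) B" "Pi\<^sub>E (carrier G) B \<subseteq> U"
          by (rule openin_process_topology_box[OF U]) blast
        then show "z \<in> \<Union>\<B>" unfolding \<B>_def by blast
      qed
    qed (auto simp: \<B>_def)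
    have "fsigma_in ?Z U"
      using open_imp_fsigma_in[OF metrizable_process_topology[OF I] U] .
    then obtain D where D: "\<And>n::nat. closedin ?Z (D n)" "\<Union>(range D) = U"
      unfolding fsigma_in_ascending by auto
    have "\<exists>\<F>. finite \<F> \<and> \<F> \<subseteq> \<B> \<and> D n \<subseteq> \<Union>\<F>" for n
      using closedin_compact_space[OF compact_process_topology[OF comp] D(1)] Bopen cover D(2)
      by (intro compactinD) blast+
    then obtain \<F> where \<F>: "\<And>n. finite (\<F> n)" "\<And>n. \<F> n \<subseteq> \<B>" "\<And>n. D n \<subseteq> \<Union>(\<F> n)" by metis
    define \<C> where "\<C> = (\<Union>n. \<F> n)"
    have "U \<subseteq> \<Union>\<C>" unfolding D(2)[symmetric] \<C>_def using \<F>(3) by blast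
    moreover have "\<C> \<subseteq> \<B>" unfolding \<C>_def using \<F>(2) by blast
    moreover have "countable \<C>"
      unfolding \<C>_def using \<F>(1) by (intro countable_UN) (auto intro: countable_finite)
    ultimately have C: "countable \<C>" "\<C> \<subseteq> \<B>" "\<Union>\<C> = U" using cover by blast+
    have "A \<in> sets (PiM (carrier G) (\<lambda>_. K))" if A: "A \<in> \<C>" for A
    proof -
      obtain B where B: "A = Pi\<^sub>E (carrier G) B" "\<forall>g\<in>carrier G. openin (mtopology_of d) (B g)"
        using A C(2) unfolding \<B>_def by blast
      show ?thesis unfolding B(1)
        using B(2) I K by (intro sets_PiM_I_countable) (auto intro: openin_in_sets_borel_on)
    qed
    then show ?thesis using C by (metis sets.countable_Union subsetI)
  qed
  then have "sigma_sets (space (PiM (carrier G) (\<lambda>_. K))) {U. openin ?Z U} \<subseteq> sets (PiM (carrier G) (\<lambda>_. K))"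
    by (intro sets.sigma_sets_subset) auto
  then show "sets (borel_on ?Z) \<subseteq> sets (PiM (carrier G) (\<lambda>_. K))"
    by (simp add: sets_borel_on space_PiM spK)
qed

section \<open>Countable families and density of continuous functions\<close>

text \<open>The maximum of the cones with apex height \<open>q\<close> over the point \<open>e k\<close> and slope \<open>N\<close>, cut off
  below at height \<open>- N\<close>. Integer slopes and rational heights leave countably many such functions.\<close>

primrec cone_max :: "('a \<Rightarrow> 'a \<Rightarrow> real) \<Rightarrow> (nat \<Rightarrow> 'a) \<Rightarrow> nat \<Rightarrow> (nat \<times> rat) list \<Rightarrow> 'a \<Rightarrow> real" where
  "cone_max D e N [] x = - real N"
| "cone_max D e N (a # L) x = max (of_rat (snd a) - N * D (e (fst a)) x) (cone_max D e N L x)"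

lemma cone_max_le_iff:
  "cone_max D e N L x \<le> t \<longleftrightarrow> - real N \<le> t \<and> (\<forall>(k, q)\<in>set L. of_rat q - N * D (e k) x \<le> t)"
  by (induction L) auto

text \<open>Take \<open>f\<close> with modulus \<open>\<rho>\<close> at scale \<open>\<epsilon>\<close>. Cones of apex slightly below the graph of \<open>f\<close> over a
  fine finite net, steep enough to fall under the minimum of \<open>f\<close> within distance \<open>\<rho>\<close>, never
  exceed \<open>f + \<epsilon>\<close>, and near each point the cone of a close net point comes within \<open>\<epsilon>\<close> of \<open>f\<close>.\<close>

lemma separable_continuous_functions:
  fixes X :: "'a topology"
  assumes comp: "compact_space X" and metr: "metrizable_space X"
  obtains h :: "nat \<Rightarrow> 'a \<Rightarrow> real" where "\<And>m. continuous_map X euclideanreal (h m)"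
    "\<And>f \<epsilon>. continuous_map X euclideanreal f \<Longrightarrow> 0 < \<epsilon> \<Longrightarrow> \<exists>m. \<forall>x\<in>topspace X. \<bar>f x - h m x\<bar> < \<epsilon>"
proof (cases "topspace X = {}")
  case True
  then show thesis using that[of "\<lambda>_ _. 0"] by auto
next
  case False
  obtain M D where M: "Metric_space M D" and X: "X = Metric_space.mtopology M D"
    using metr unfolding metrizable_space_def by auto
  interpret Metric_space M D by (fact M)
  have mX: "mtopology_of (metric (M, D)) = X" using X by simp
  have tX: "topspace X = M" using X by simp
  obtain e :: "nat \<Rightarrow> 'a" where e: "\<And>k. e k \<in> M" "\<And>x r. x \<in> M \<Longrightarrow> 0 < r \<Longrightarrow> \<exists>k. D (e k) x < r"
    using dense_sequence_of_compact_metric[of "metric (M, D)"] comp mX False tX by auto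
  have cont: "continuous_map X euclideanreal (cone_max D e N L)" for N L
  proof (induction L)
    case (Cons a L)
    have "continuous_map X euclideanreal (\<lambda>x. mdist (metric (M, D)) (e (fst a)) x)"
      using mX e(1) tX by (intro continuous_map_mdist) (auto simp: continuous_map_const)
    then have "continuous_map X euclideanreal (\<lambda>x. of_rat (snd a) - N * D (e (fst a)) x)"
      by (intro continuous_intros) auto
    then show ?case using Cons by (simp add: continuous_map_real_max)
  qed simp
  have dense: "\<exists>N L. \<forall>x\<in>M. \<bar>f x - cone_max D e N L x\<bar> < \<epsilon>"
    if f: "continuous_map X euclideanreal f" and eps: "0 < \<epsilon>" for f \<epsilon>
  proof -
    have "compact (f ` M)"
      using image_compactin[OF _ f, of M] comp tX by (auto simp: compact_space_def)
    then have "bounded (f ` M)" by (rule compact_imp_bounded)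
    then obtain B where B: "\<And>x. x \<in> M \<Longrightarrow> \<bar>f x\<bar> \<le> B"
      by (auto simp: bounded_iff)
    have "uniformly_continuous_map (metric (M, D)) euclidean_metric f"
      by (intro continuous_imp_uniformly_continuous_map) (use f comp mX in auto)
    then obtain \<rho> where \<rho>: "0 < \<rho>" "\<And>x y. x \<in> M \<Longrightarrow> y \<in> M \<Longrightarrow> D y x < \<rho> \<Longrightarrow> \<bar>f y - f x\<bar> < \<epsilon> / 8"
      using eps unfolding uniformly_continuous_map_def
      by (auto simp: dist_real_def elim!: allE[of _ "\<epsilon> / 8"])
    \<comment> \<open>With slope \<open>N\<close> a cone drops by more than \<open>2 * B\<close> within distance \<open>\<rho>\<close>, and by at most
      \<open>\<epsilon> / 8\<close> within the width \<open>t\<close> of the net. The cut-off at \<open>- N\<close> stays below \<open>f\<close>.\<close>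
    obtain N :: nat where N: "N > max (\<bar>B\<bar> + 1) (2 * \<bar>B\<bar> / \<rho>)" using reals_Archimedean2 by blast
    have N1: "2 * \<bar>B\<bar> < N * \<rho>" using N \<rho>(1) by (simp add: field_simps)
    define t where "t = min \<rho> (\<epsilon> / (8 * N))"
    have N0: "\<bar>B\<bar> < N" "0 < real N" using N by auto
    have t: "0 < t" "t \<le> \<rho>" using \<rho>(1) eps N0 by (simp_all add: t_def)
    have "N * t \<le> N * (\<epsilon> / (8 * N))" by (intro mult_left_mono) (simp_all add: t_def)
    then have Nt: "N * t \<le> \<epsilon> / 8" using N0 by simp
    have "mtotally_bounded M"
      using comp X compact_space_eq_mcomplete_mtotally_bounded by blast
    moreover have "0 < t / 2" using t(1) by simp
    ultimately obtain C where C: "finite C" "C \<subseteq> M" "M \<subseteq> (\<Union>c\<in>C. mball c (t / 2))"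
      unfolding mtotally_bounded_def by meson
    have "\<forall>c\<in>C. \<exists>k. D (e k) c < t / 2" using e(2) C(2) \<open>0 < t / 2\<close> by blast
    then obtain \<kappa> where \<kappa>: "\<And>c. c \<in> C \<Longrightarrow> D (e (\<kappa> c)) c < t / 2" by metis
    define F where "F = \<kappa> ` C"
    have F: "finite F" "\<exists>k\<in>F. D (e k) x < t" if x: "x \<in> M" for x
    proof -
      obtain c where c: "c \<in> C" "D c x < t / 2" using C(3) x by auto
      have "D (e (\<kappa> c)) x \<le> D (e (\<kappa> c)) c + D c x" using triangle e(1) c(1) C(2) x by blast
      then have "D (e (\<kappa> c)) x < t" using c(2) \<kappa>[OF c(1)] by simp
      then show "\<exists>k\<in>F. D (e k) x < t" using c(1) F_def by blast
    qed (simp add: F_def C(1))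
    have "\<exists>q. f (e k) - \<epsilon> / 8 < of_rat q \<and> of_rat q < f (e k)" for k
      using eps by (intro of_rat_dense) auto
    then obtain q where q: "\<And>k. f (e k) - \<epsilon> / 8 < of_rat (q k)" "\<And>k. of_rat (q k) < f (e k)" by metis
    obtain L where L: "set L = (\<lambda>k. (k, q k)) ` F" using finite_list[of "(\<lambda>k. (k, q k)) ` F"] C(1) F_def by blast
    have "\<bar>f x - cone_max D e N L x\<bar> < \<epsilon>" if x: "x \<in> M" for x
    proof -
      have "of_rat (q k) - N * D (e k) x \<le> f x + \<epsilon> / 4" for k
      proof (cases "D (e k) x < \<rho>")
        case True
        then have "\<bar>f (e k) - f x\<bar> < \<epsilon> / 8" using \<rho>(2) e(1) x by blast
        moreover have "0 \<le> N * D (e k) x" using N0 by simp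
        ultimately show ?thesis using q(2)[of k] eps by linarith
      next
        case False
        then have "N * \<rho> \<le> N * D (e k) x" by (intro mult_left_mono) auto
        then show ?thesis using q(2)[of k] B[OF e(1)[of k]] B[OF x] N1 eps by linarith
      qed
      then have up: "cone_max D e N L x \<le> f x + \<epsilon> / 4"
        unfolding cone_max_le_iff using B[OF x] N0 eps L by auto
      obtain k where k: "k \<in> F" "D (e k) x < t" using F(2)[OF x] by blast
      have "of_rat (q k) - N * D (e k) x \<le> cone_max D e N L x"
        using cone_max_le_iff[of D e N L x "cone_max D e N L x"] L k(1) by auto
      moreover have "N * D (e k) x \<le> N * t" using k(2) by (intro mult_left_mono) auto
      moreover have "\<bar>f (e k) - f x\<bar> < \<epsilon> / 8" using \<rho>(2) e(1) x k(2) t(2) by (meson less_le_trans)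
      ultimately show ?thesis using up q(1)[of k] Nt eps by linarith
    qed
    then show ?thesis by blast
  qed
  show thesis
  proof
    show "continuous_map X euclideanreal (case from_nat m of (N, L) \<Rightarrow> cone_max D e N L)" for m
      using cont by (simp split: prod.split)
    fix f :: "'a \<Rightarrow> real" and \<epsilon> :: real assume "continuous_map X euclideanreal f" "0 < \<epsilon>"
    then obtain N L where "\<forall>x\<in>M. \<bar>f x - cone_max D e N L x\<bar> < \<epsilon>" using dense by blast
    then show "\<exists>m. \<forall>x\<in>topspace X. \<bar>f x - (case from_nat m of (N, L) \<Rightarrow> cone_max D e N L) x\<bar> < \<epsilon>"
      by (intro exI[of _ "to_nat (N, L)"]) (simp add: tX)
  qed
qed

lemma (in prob_space) integrable_unit_interval:
  assumes "f \<in> borel_measurable M" and "\<And>x. x \<in> space M \<Longrightarrow> 0 \<le> f x \<and> f x \<le> (1::real)"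
  shows "integrable M f"
  using assms by (intro integrable_const_bound[where B = 1]) auto

lemma (in prob_space) integrable_indicator_diff:
  assumes [measurable]: "A \<in> sets M" "w \<in> borel_measurable M" and "\<And>x. 0 \<le> w x \<and> w x \<le> (1::real)"
  shows "integrable M (\<lambda>x. \<bar>indicator A x - w x\<bar>)"
proof (rule integrable_unit_interval)
  show "(\<lambda>x. \<bar>indicator A x - w x\<bar>) \<in> borel_measurable M" by measurable
  show "0 \<le> \<bar>indicator A x - w x\<bar> \<and> \<bar>indicator A x - w x\<bar> \<le> 1" for x
    using assms(3)[of x] by (cases "x \<in> A") auto
qed

text \<open>The sets whose indicator can be approximated form a Dynkin system. It contains the closed
  sets: these are decreasing intersections of open sets, and a Urysohn function for a closed set
  inside an open set of nearly the same measure is a good approximation.\<close>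

lemma continuous_dense_L1_indicator:
  fixes X :: "'a topology"
  assumes metr: "metrizable_space X" and prob: "prob_space \<mu>" and sets: "sets \<mu> = sets (borel_on X)"
    and A: "A \<in> sets \<mu>" and eps: "0 < \<epsilon>"
  obtains w where "continuous_map X euclideanreal w" "\<And>x. 0 \<le> w x \<and> w x \<le> 1"
    "(\<integral>x. \<bar>indicator A x - w x\<bar> \<partial>\<mu>) < \<epsilon>"
proof -
  interpret prob_space \<mu> by (fact prob)
  have sp: "space \<mu> = topspace X" using sets_eq_imp_space_eq[OF sets] by simp
  have meas: "w \<in> borel_measurable \<mu>" if "continuous_map X euclideanreal w" for w
    using that sets continuous_map_borel_measurable by blast
  let ?approx = "\<lambda>\<epsilon> A w. continuous_map X euclideanreal w \<and> (\<forall>x. 0 \<le> w x \<and> w x \<le> 1) \<and>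
      (\<integral>x. \<bar>indicator A x - w x\<bar> \<partial>\<mu>) < \<epsilon>"
  let ?P = "\<lambda>A. \<forall>\<epsilon>>0. \<exists>w. ?approx \<epsilon> A w"
  have clamp: "\<exists>w. continuous_map X euclideanreal w \<and> (\<forall>x. 0 \<le> w x \<and> w x \<le> 1) \<and>
      (\<forall>x. 0 \<le> u x \<and> u x \<le> 1 \<longrightarrow> w x = u x)"
    if "continuous_map X euclideanreal u" for u :: "'a \<Rightarrow> real"
    using that by (intro exI[of _ "\<lambda>x. max 0 (min 1 (u x))"])
      (auto intro!: continuous_map_real_max continuous_map_real_min)
  have sig: "sets \<mu> = sigma_sets (topspace X) {C. closedin X C}"
  proof -
    have "sigma_sets (topspace X) {C. closedin X C} = sigma_sets (topspace X) {U. openin X U}"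
    proof (rule sigma_sets_eqI)
      fix C assume "C \<in> {C. closedin X C}"
      then have "topspace X - (topspace X - C) \<in> sigma_sets (topspace X) {U. openin X U}"
        by (intro sigma_sets.Compl sigma_sets.Basic) (auto simp: closedin_def)
      then show "C \<in> sigma_sets (topspace X) {U. openin X U}"
        using \<open>C \<in> _\<close> by (simp add: closedin_def double_diff)
    next
      fix U assume "U \<in> {U. openin X U}"
      then have "topspace X - (topspace X - U) \<in> sigma_sets (topspace X) {C. closedin X C}"
        by (intro sigma_sets.Compl sigma_sets.Basic) auto
      then show "U \<in> sigma_sets (topspace X) {C. closedin X C}"
        using \<open>U \<in> _\<close> by (simp add: double_diff openin_subset)
    qed
    then show ?thesis by (simp add: sets sets_borel_on)
  qed
  have "?P A"
  proof (rule sigma_sets_induct_disjoint[of "{C. closedin X C}" "topspace X" A])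
    show "Int_stable {C. closedin X C}" by (auto simp: Int_stable_def)
    show "{C. closedin X C} \<subseteq> Pow (topspace X)" by (auto dest: closedin_subset)
    show "A \<in> sigma_sets (topspace X) {C. closedin X C}" using A sig by simp
  next
    fix C assume "C \<in> {C. closedin X C}"
    then have C: "closedin X C" by simp
    then obtain U where U: "\<And>n. openin X (U n)" "\<And>n. U (Suc n) \<subseteq> U n" "\<Inter>(range U) = C"
      using closed_imp_gdelta_in[OF metr] unfolding gdelta_in_descending by metis
    have Us: "U n \<in> sets \<mu>" for n using U(1) sets openin_in_sets_borel_on by blast
    have Cs: "C \<in> sets \<mu>" using C sets closedin_in_sets_borel_on by blast
    have lim: "(\<lambda>n. measure \<mu> (U n)) \<longlonglongrightarrow> measure \<mu> C"
      using finite_Lim_measure_decseq[of U] Us U(2,3) by (auto simp: decseq_SucI)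
    show "?P C"
    proof (intro allI impI)
      fix \<epsilon> :: real assume eps: "0 < \<epsilon>"
      have "\<forall>\<^sub>F n in sequentially. measure \<mu> (U n) < measure \<mu> C + \<epsilon>"
        using order_tendstoD(2)[OF lim] eps by simp
      then obtain n where n: "measure \<mu> (U n) < measure \<mu> C + \<epsilon>" by (auto simp: eventually_sequentially)
      have CU: "C \<subseteq> U n" using U(3) by blast
      obtain u where u: "continuous_map X euclideanreal u" "u ` (topspace X - U n) \<subseteq> {0}" "u ` C \<subseteq> {1}"
        using Urysohn_lemma_alt[of X "topspace X - U n" C 0 1] C U(1) CU metr
        by (auto simp: disjnt_def metrizable_imp_normal_space)
      obtain w where w: "continuous_map X euclideanreal w" "\<forall>x. 0 \<le> w x \<and> w x \<le> 1"
        "\<forall>x. 0 \<le> u x \<and> u x \<le> 1 \<longrightarrow> w x = u x" using clamp[OF u(1)] by blast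
      have le: "\<bar>indicator C x - w x\<bar> \<le> indicator (U n - C) x" if "x \<in> space \<mu>" for x
        using that w(2,3) u(2,3) CU sp
        by (cases "x \<in> C"; cases "x \<in> U n") (auto simp: image_subset_iff)
      have "(\<integral>x. \<bar>indicator C x - w x\<bar> \<partial>\<mu>) \<le> (\<integral>x. indicator (U n - C) x \<partial>\<mu>)"
      proof (rule integral_mono)
        show "integrable \<mu> (\<lambda>x. \<bar>indicator C x - w x\<bar>)"
          using meas[OF w(1)] Cs w(2) by (intro integrable_indicator_diff) auto
        show "integrable \<mu> (indicator (U n - C) :: 'a \<Rightarrow> real)"
          using Us Cs by (intro integrable_unit_interval) auto
      qed (use le in auto)
      also have "\<dots> = measure \<mu> (U n) - measure \<mu> C"
        using finite_measure_Diff[OF Us Cs CU] Us Cs by simp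
      finally show "\<exists>w. ?approx \<epsilon> C w" using w n by (intro exI[of _ w]) auto
    qed
  next
    show "?P {}" by (auto intro!: exI[of _ "\<lambda>_. 0"])
  next
    fix A assume A: "A \<in> sigma_sets (topspace X) {C. closedin X C}" and PA: "?P A"
    show "?P (topspace X - A)"
    proof (intro allI impI)
      fix \<epsilon> :: real assume "0 < \<epsilon>"
      then obtain w where w: "continuous_map X euclideanreal w" "\<forall>x. 0 \<le> w x \<and> w x \<le> 1"
        "(\<integral>x. \<bar>indicator A x - w x\<bar> \<partial>\<mu>) < \<epsilon>" using PA by blast
      have "(\<integral>x. \<bar>indicator (topspace X - A) x - (1 - w x)\<bar> \<partial>\<mu>) = (\<integral>x. \<bar>indicator A x - w x\<bar> \<partial>\<mu>)"
        by (rule Bochner_Integration.integral_cong) (auto simp: sp indicator_def)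
      then show "\<exists>w. ?approx \<epsilon> (topspace X - A) w"
        using w by (intro exI[of _ "\<lambda>x. 1 - w x"]) (auto intro!: continuous_intros)
    qed
  next
    fix A :: "nat \<Rightarrow> 'a set" assume disj: "disjoint_family A"
      and rA: "range A \<subseteq> sigma_sets (topspace X) {C. closedin X C}" and PA: "\<And>i. ?P (A i)"
    have As: "A i \<in> sets \<mu>" for i using rA sig by blast
    show "?P (\<Union>i. A i)"
    proof (intro allI impI)
      fix \<epsilon> :: real assume eps: "0 < \<epsilon>"
      define B where "B n = (\<Union>i<n. A i)" for n
      have Bs: "B n \<in> sets \<mu>" for n using As B_def by auto
      have UB: "(\<Union>n. B n) = (\<Union>i. A i)" unfolding B_def by auto
      have "(\<lambda>n. measure \<mu> (B n)) \<longlonglongrightarrow> measure \<mu> (\<Union>n. B n)"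
        using Bs by (intro finite_Lim_measure_incseq) (auto simp: incseq_def B_def intro: less_le_trans)
      then have "\<forall>\<^sub>F n in sequentially. measure \<mu> (\<Union>i. A i) - \<epsilon> / 2 < measure \<mu> (B n)"
        unfolding UB using eps by (intro order_tendstoD(1)) auto
      then obtain n where n: "measure \<mu> (\<Union>i. A i) - \<epsilon> / 2 < measure \<mu> (B n)"
        by (auto simp: eventually_sequentially)
      have "0 < \<epsilon> / (2 * (real n + 1))" using eps by simp
      then have "\<forall>i. \<exists>w. ?approx (\<epsilon> / (2 * (real n + 1))) (A i) w" using PA by blast
      then obtain w where w: "\<And>i. continuous_map X euclideanreal (w i)"
        "\<And>i x. 0 \<le> w i x \<and> w i x \<le> 1"
        "\<And>i. (\<integral>x. \<bar>indicator (A i) x - w i x\<bar> \<partial>\<mu>) < \<epsilon> / (2 * (real n + 1))" by metis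
      define v where "v x = min 1 (\<Sum>i<n. w i x)" for x
      have v: "continuous_map X euclideanreal v" "\<And>x. 0 \<le> v x \<and> v x \<le> 1"
        unfolding v_def using w(1,2)
        by (auto intro!: continuous_map_real_min continuous_map_sum sum_nonneg)
      have int1: "integrable \<mu> (\<lambda>x. \<bar>indicator (A i) x - w i x\<bar>)" for i
        using meas[OF w(1)] As w(2) by (intro integrable_indicator_diff) auto
      have UA: "(\<Union>i. A i) \<in> sets \<mu>" using As by auto
      have intD: "integrable \<mu> (indicator ((\<Union>i. A i) - B n) :: 'a \<Rightarrow> real)"
        using UA Bs by (intro integrable_unit_interval) auto
      have le: "\<bar>indicator (\<Union>i. A i) x - v x\<bar>
          \<le> indicator ((\<Union>i. A i) - B n) x + (\<Sum>i<n. \<bar>indicator (A i) x - w i x\<bar>)" for x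
      proof -
        have disjn: "disjoint_family_on A {..<n}" using disj by (auto simp: disjoint_family_on_def)
        have "(\<Sum>i<n. indicator (A i) x) = (indicator (B n) x :: real)"
          unfolding B_def by (rule indicator_UN_disjoint[OF _ disjn, symmetric]) simp
        then have "\<bar>indicator (B n) x - (\<Sum>i<n. w i x)\<bar> \<le> (\<Sum>i<n. \<bar>indicator (A i) x - w i x\<bar>)"
          using sum_abs[of "\<lambda>i. indicator (A i) x - w i x" "{..<n}"] by (simp add: sum_subtractf)
        moreover have "indicator (\<Union>i. A i) x = indicator ((\<Union>i. A i) - B n) x + (indicator (B n) x :: real)"
          unfolding B_def by (auto simp: indicator_def)
        moreover have "indicator (B n) x \<le> (1::real)" "0 \<le> (indicator ((\<Union>i. A i) - B n) x :: real)" by (auto simp: indicator_def)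
        ultimately show ?thesis unfolding v_def by linarith
      qed
      have "(\<integral>x. \<bar>indicator (\<Union>i. A i) x - v x\<bar> \<partial>\<mu>)
          \<le> (\<integral>x. indicator ((\<Union>i. A i) - B n) x + (\<Sum>i<n. \<bar>indicator (A i) x - w i x\<bar>) \<partial>\<mu>)"
      proof (rule integral_mono)
        show "integrable \<mu> (\<lambda>x. \<bar>indicator (\<Union>i. A i) x - v x\<bar>)"
          using meas[OF v(1)] UA v(2) by (intro integrable_indicator_diff) auto
        show "integrable \<mu> (\<lambda>x. indicator ((\<Union>i. A i) - B n) x + (\<Sum>i<n. \<bar>indicator (A i) x - w i x\<bar>))"
          using int1 intD by (intro Bochner_Integration.integrable_add Bochner_Integration.integrable_sum)
      qed (use le in auto)
      also have "\<dots> = measure \<mu> ((\<Union>i. A i) - B n) + (\<Sum>i<n. \<integral>x. \<bar>indicator (A i) x - w i x\<bar> \<partial>\<mu>)"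
        using int1 intD UA Bs by (simp add: Bochner_Integration.integral_sum)
      also have "\<dots> \<le> measure \<mu> ((\<Union>i. A i) - B n) + (\<Sum>i<n. \<epsilon> / (2 * (real n + 1)))"
        using w(3) by (intro add_left_mono sum_mono less_imp_le)
      also have "(\<Sum>i<n. \<epsilon> / (2 * (real n + 1))) \<le> \<epsilon> / 2"
        using eps by (simp add: field_simps)
      also have "measure \<mu> ((\<Union>i. A i) - B n) = measure \<mu> (\<Union>i. A i) - measure \<mu> (B n)"
        using UA Bs by (intro finite_measure_Diff) (auto simp: B_def)
      finally have "(\<integral>x. \<bar>indicator (\<Union>i. A i) x - v x\<bar> \<partial>\<mu>) < \<epsilon>" using n by simp
      then show "\<exists>w. ?approx \<epsilon> (\<Union>i. A i) w" using v by blast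
    qed
  qed
  then show thesis using that eps by blast
qed

text \<open>A function with values in the unit interval is within \<open>1 / n\<close> of the mean of the indicators
  of its superlevel sets at heights \<open>1 / n, \<dots>, n / n\<close>.\<close>

lemma continuous_dense_L1:
  fixes X :: "'a topology"
  assumes metr: "metrizable_space X" and prob: "prob_space \<mu>" and sets: "sets \<mu> = sets (borel_on X)"
    and h: "h \<in> borel_measurable \<mu>" "\<And>x. x \<in> space \<mu> \<Longrightarrow> 0 \<le> h x \<and> h x \<le> (1::real)"
    and eps: "0 < \<epsilon>"
  obtains w where "continuous_map X euclideanreal w" "\<And>x. 0 \<le> w x \<and> w x \<le> 1"
    "(\<integral>x. \<bar>h x - w x\<bar> \<partial>\<mu>) < \<epsilon>"
proof -
  interpret prob_space \<mu> by (fact prob)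
  have meas: "w \<in> borel_measurable \<mu>" if "continuous_map X euclideanreal w" for w
    using that sets continuous_map_borel_measurable by blast
  obtain n :: nat where n: "n > 2 / \<epsilon>" using reals_Archimedean2 by blast
  have n0: "0 < real n" using n eps by (smt (verit) divide_pos_pos)
  have n1: "1 / n < \<epsilon> / 2" using n n0 eps by (simp add: field_simps)
  define A where "A i = {x \<in> space \<mu>. real (Suc i) / n \<le> h x}" for i
  have As: "A i \<in> sets \<mu>" for i unfolding A_def using h(1) by measurable
  have "\<exists>w. continuous_map X euclideanreal w \<and> (\<forall>x. 0 \<le> w x \<and> w x \<le> 1) \<and>
      (\<integral>x. \<bar>indicator (A i) x - w x\<bar> \<partial>\<mu>) < \<epsilon> / 2" for i
  proof -
    have "0 < \<epsilon> / 2" using eps by simp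
    then show ?thesis by (rule continuous_dense_L1_indicator[OF metr prob sets As[of i]]) blast
  qed
  then obtain w where w: "\<And>i. continuous_map X euclideanreal (w i)" "\<And>i x. 0 \<le> w i x \<and> w i x \<le> 1"
    "\<And>i. (\<integral>x. \<bar>indicator (A i) x - w i x\<bar> \<partial>\<mu>) < \<epsilon> / 2" by metis
  define v where "v x = (\<Sum>i<n. w i x) / n" for x
  have "continuous_map X euclideanreal v"
    unfolding v_def using w(1) by (intro continuous_intros) (use n0 in auto)
  moreover have v01: "0 \<le> v x \<and> v x \<le> 1" for x
  proof -
    have "(\<Sum>i<n. w i x) \<le> (\<Sum>i<n. 1)" using w(2) by (intro sum_mono) auto
    then show ?thesis unfolding v_def using w(2) n0 by (auto intro!: sum_nonneg divide_nonneg_nonneg)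
  qed
  moreover have "(\<integral>x. \<bar>h x - v x\<bar> \<partial>\<mu>) < \<epsilon>"
  proof -
    have int1: "integrable \<mu> (\<lambda>x. \<bar>indicator (A i) x - w i x\<bar>)" for i
      using meas[OF w(1)] As w(2) by (intro integrable_indicator_diff) auto
    have quant: "\<bar>h x - (\<Sum>i<n. indicator (A i) x) / n\<bar> \<le> 1 / n" if x: "x \<in> space \<mu>" for x
    proof -
      define k where "k = nat \<lfloor>n * h x\<rfloor>"
      have nh: "0 \<le> n * h x" "n * h x \<le> n" using h(2)[OF x] n0 by (auto simp: mult_left_le)
      have k: "real k \<le> n * h x" "n * h x < real k + 1" unfolding k_def using nh by linarith+
      have kn: "k \<le> n" using k nh by linarith
      have "(\<Sum>i<n. indicator (A i) x) = (\<Sum>i<n. if i < k then 1 else 0 :: real)"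
      proof (rule sum.cong)
        fix i
        have "x \<in> A i \<longleftrightarrow> real (Suc i) \<le> n * h x" unfolding A_def using x n0 by (simp add: field_simps)
        also have "\<dots> \<longleftrightarrow> i < k" using k by linarith
        finally show "indicator (A i) x = (if i < k then 1 else 0 :: real)" by simp
      qed simp
      also have "\<dots> = (\<Sum>i<k. 1)"
        using kn by (intro sum.mono_neutral_cong_right) auto
      finally have "(\<Sum>i<n. indicator (A i) x) = real k" by simp
      moreover have "h x - real k / n = (n * h x - k) / n" using n0 by (simp add: field_simps)
      moreover have "\<bar>n * h x - k\<bar> / n \<le> 1 / n" using k by (intro divide_right_mono) auto
      ultimately show ?thesis by simp
    qed
    have le: "\<bar>h x - v x\<bar> \<le> 1 / n + (\<Sum>i<n. \<bar>indicator (A i) x - w i x\<bar>) / n" if x: "x \<in> space \<mu>" for x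
    proof -
      have "\<bar>(\<Sum>i<n. indicator (A i) x) / n - v x\<bar> = \<bar>\<Sum>i<n. indicator (A i) x - w i x\<bar> / n"
        unfolding v_def by (simp add: diff_divide_distrib[symmetric] sum_subtractf)
      also have "\<dots> \<le> (\<Sum>i<n. \<bar>indicator (A i) x - w i x\<bar>) / n"
        by (intro divide_right_mono sum_abs) simp
      finally show ?thesis using quant[OF x] by linarith
    qed
    have "(\<integral>x. \<bar>h x - v x\<bar> \<partial>\<mu>) \<le> (\<integral>x. 1 / n + (\<Sum>i<n. \<bar>indicator (A i) x - w i x\<bar>) / n \<partial>\<mu>)"
    proof (rule integral_mono)
      show "integrable \<mu> (\<lambda>x. \<bar>h x - v x\<bar>)"
      proof (rule integrable_unit_interval)
        show "(\<lambda>x. \<bar>h x - v x\<bar>) \<in> borel_measurable \<mu>"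
          using h(1) meas[OF \<open>continuous_map X euclideanreal v\<close>] by measurable
        show "0 \<le> \<bar>h x - v x\<bar> \<and> \<bar>h x - v x\<bar> \<le> 1" if "x \<in> space \<mu>" for x
          using h(2)[OF that] v01[of x] by (auto simp: abs_le_iff)
      qed
      show "integrable \<mu> (\<lambda>x. 1 / n + (\<Sum>i<n. \<bar>indicator (A i) x - w i x\<bar>) / n)"
        using int1 by (intro Bochner_Integration.integrable_add integrable_const
          integrable_divide Bochner_Integration.integrable_sum) auto
    qed (use le in auto)
    also have "\<dots> = 1 / n + (\<Sum>i<n. \<integral>x. \<bar>indicator (A i) x - w i x\<bar> \<partial>\<mu>) / n"
      using int1 by (subst Bochner_Integration.integral_add) (auto simp: prob_space)
    also have "(\<Sum>i<n. \<integral>x. \<bar>indicator (A i) x - w i x\<bar> \<partial>\<mu>) \<le> (\<Sum>i<n. \<epsilon> / 2)"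
      using w(3) by (intro sum_mono less_imp_le)
    then have "1 / n + (\<Sum>i<n. \<integral>x. \<bar>indicator (A i) x - w i x\<bar> \<partial>\<mu>) / n \<le> 1 / n + \<epsilon> / 2"
      using n0 by (simp add: field_simps)
    finally show ?thesis using n1 by linarith
  qed
  ultimately show thesis using that by blast
qed

section \<open>Connected model spaces in terms of averages\<close>

text \<open>The integral of \<open>f\<close> against the empirical distribution of \<open>x\<close>, as a finite sum.\<close>

definition name_average :: "('g, 'z) monoid_scheme \<Rightarrow> 'v set \<Rightarrow> ('g \<Rightarrow> 'v \<Rightarrow> 'v) \<Rightarrow>
    (('g \<Rightarrow> 'x) \<Rightarrow> real) \<Rightarrow> ('v \<Rightarrow> 'x) \<Rightarrow> real" where
  "name_average G V s f x = (\<Sum>v\<in>V. f (pullback_name G s x v)) / real (card V)"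

text \<open>Weak* convergence of the empirical distributions of \<open>x i\<close> to \<open>\<mu>\<close>, see
  \<open>limitin_empirical_iff\<close> below.\<close>

definition models_converge :: "('g, 'z) monoid_scheme \<Rightarrow> 'x metric \<Rightarrow> (nat \<Rightarrow> 'v set) \<Rightarrow>
    (nat \<Rightarrow> 'g \<Rightarrow> 'v \<Rightarrow> 'v) \<Rightarrow> ('g \<Rightarrow> 'x) measure \<Rightarrow> (nat \<Rightarrow> 'v \<Rightarrow> 'x) \<Rightarrow> bool" where
  "models_converge G d V \<sigma> \<mu> x \<longleftrightarrow>
     (\<forall>f. continuous_map (process_topology G d) euclideanreal f \<longrightarrow>
        (\<lambda>i. name_average G (V i) (\<sigma> i) f (x i)) \<longlonglongrightarrow> (\<integral>z. f z \<partial>\<mu>))"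

definition model_path :: "('g, 'z) monoid_scheme \<Rightarrow> 'x metric \<Rightarrow> 'v set \<Rightarrow> ('g \<Rightarrow> 'v \<Rightarrow> 'v) \<Rightarrow>
    ('g \<Rightarrow> 'x) measure \<Rightarrow> (('g \<Rightarrow> 'x) \<Rightarrow> real) set \<Rightarrow> real \<Rightarrow> ('v \<Rightarrow> 'x) \<Rightarrow> ('v \<Rightarrow> 'x) \<Rightarrow>
    nat \<Rightarrow> (nat \<Rightarrow> 'v \<Rightarrow> 'x) \<Rightarrow> bool" where
  "model_path G d V s \<mu> \<Phi> \<eta> x y l p \<longleftrightarrow>
     delta_path (V \<rightarrow>\<^sub>E mspace d) (mean_dist d V) \<eta> x y l p \<and>
     (\<forall>j\<le>l. \<forall>f\<in>\<Phi>. \<bar>name_average G V s f (p j) - (\<integral>z. f z \<partial>\<mu>)\<bar> < \<eta>)"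

definition eventually_joined :: "('g, 'z) monoid_scheme \<Rightarrow> 'x metric \<Rightarrow> (nat \<Rightarrow> 'v set) \<Rightarrow>
    (nat \<Rightarrow> 'g \<Rightarrow> 'v \<Rightarrow> 'v) \<Rightarrow> ('g \<Rightarrow> 'x) measure \<Rightarrow> (nat \<Rightarrow> 'v \<Rightarrow> 'x) \<Rightarrow> (nat \<Rightarrow> 'v \<Rightarrow> 'x) \<Rightarrow> bool" where
  "eventually_joined G d V \<sigma> \<mu> x y \<longleftrightarrow>
     (\<forall>\<Phi> \<eta>. finite \<Phi> \<longrightarrow> (\<forall>f\<in>\<Phi>. continuous_map (process_topology G d) euclideanreal f) \<longrightarrow> 0 < \<eta> \<longrightarrow>
        (\<forall>\<^sub>F i in sequentially. \<exists>l p. model_path G d (V i) (\<sigma> i) \<mu> \<Phi> \<eta> (x i) (y i) l p))"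

lemma pullback_name_in_PiE:
  assumes "\<And>g. g \<in> carrier G \<Longrightarrow> s g permutes V" and "x \<in> V \<rightarrow>\<^sub>E A" and "v \<in> V"
  shows "pullback_name G s x v \<in> carrier G \<rightarrow>\<^sub>E A"
  using assms by (auto simp: pullback_name_def PiE_iff permutes_in_image)

lemma empirical_distribution_props:
  assumes V: "finite V" "V \<noteq> {}" and perm: "\<And>g. g \<in> carrier G \<Longrightarrow> s g permutes V"
    and x: "x \<in> V \<rightarrow>\<^sub>E space K"
  shows prob_space_empirical_distribution: "prob_space (empirical_distribution G K V s x)"
    and sets_empirical_distribution:
      "sets (empirical_distribution G K V s x) = sets (PiM (carrier G) (\<lambda>_. K))"
    and integral_empirical_distribution:
      "f \<in> borel_measurable (PiM (carrier G) (\<lambda>_. K)) \<Longrightarrow>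
         (\<integral>z. f z \<partial>empirical_distribution G K V s x) = name_average G V s f x"
proof -
  have m: "pullback_name G s x \<in> measurable (uniform_count_measure V) (PiM (carrier G) (\<lambda>_. K))"
    unfolding measurable_cong_sets[OF sets_uniform_count_measure_count_space refl]
    using pullback_name_in_PiE[where s = s and G = G, OF perm x] by (simp add: space_PiM Pi_iff)
  show "prob_space (empirical_distribution G K V s x)"
    unfolding empirical_distribution_def
    using V m by (intro prob_space.prob_space_distr prob_space_uniform_count_measure)
  show "sets (empirical_distribution G K V s x) = sets (PiM (carrier G) (\<lambda>_. K))"
    by (simp add: empirical_distribution_def)
  assume "f \<in> borel_measurable (PiM (carrier G) (\<lambda>_. K))"
  then show "(\<integral>z. f z \<partial>empirical_distribution G K V s x) = name_average G V s f x"
    unfolding empirical_distribution_def name_average_def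
    using m V by (simp add: integral_distr integral_uniform_count_measure)
qed

lemma metric_processD:
  assumes "metric_process G K d \<mu>" and "countable (carrier G)"
  shows "compact_space (mtopology_of d)" "sets K = sets (borel_on (mtopology_of d))"
    "space K = mspace d" "prob_space \<mu>" "sets \<mu> = sets (PiM (carrier G) (\<lambda>_. K))"
    "sets \<mu> = sets (borel_on (process_topology G d))"
    "space \<mu> = (\<Pi>\<^sub>E g\<in>carrier G. mspace d)"
    "\<And>h. h \<in> carrier G \<Longrightarrow> distr \<mu> \<mu> (shift G h) = \<mu>"
proof -
  show 1: "compact_space (mtopology_of d)" "sets K = sets (borel_on (mtopology_of d))"
    "prob_space \<mu>" and 2: "sets \<mu> = sets (PiM (carrier G) (\<lambda>_. K))"
    "\<And>h. h \<in> carrier G \<Longrightarrow> distr \<mu> \<mu> (shift G h) = \<mu>"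
    using assms(1) by (auto simp: metric_process_def)
  show "space K = mspace d" using sets_eq_imp_space_eq[OF 1(2)] by simp
  show 3: "sets \<mu> = sets (borel_on (process_topology G d))"
    using sets_borel_on_product[OF 1(1) assms(2) 1(2)] 2(1) by simp
  show "space \<mu> = (\<Pi>\<^sub>E g\<in>carrier G. mspace d)" using sets_eq_imp_space_eq[OF 3] by simp
qed

lemma continuous_map_bounded:
  assumes "compact_space X" and "continuous_map X euclideanreal f"
  obtains B where "0 < B" "\<And>x. x \<in> topspace X \<Longrightarrow> \<bar>f x\<bar> \<le> B"
proof -
  have "compact (f ` topspace X)"
    using image_compactin[OF _ assms(2), of "topspace X"] assms(1) by (auto simp: compact_space_def)
  then have "bounded (f ` topspace X)" by (rule compact_imp_bounded)
  then obtain B where "\<And>x. x \<in> topspace X \<Longrightarrow> \<bar>f x\<bar> \<le> B" by (auto simp: bounded_iff)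
  then show thesis using that[of "\<bar>B\<bar> + 1"] by fastforce
qed

lemma integrable_continuous_map:
  assumes "compact_space X" and "continuous_map X euclideanreal f"
    and "prob_space \<mu>" and "sets \<mu> = sets (borel_on X)"
  shows "integrable \<mu> f"
proof -
  interpret prob_space \<mu> by fact
  have "space \<mu> = topspace X" using sets_eq_imp_space_eq[OF assms(4)] by simp
  then show ?thesis
    using continuous_map_bounded[OF assms(1,2)] continuous_map_borel_measurable[OF assms(2,4)]
    by (metis AE_I2 integrable_const_bound real_norm_def)
qed

text \<open>The sets \<open>A i\<close> are singletons when convergence of a sequence is meant, and the empirical
  distributions along a whole path when a path has to stay near \<open>\<mu>\<close>. Open sets containing \<open>\<mu>\<close>
  arise from subbasic ones by finite intersections and unions, and both preserve the property.\<close>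

lemma weak_star_neighbourhoods_iff:
  assumes \<mu>: "prob_space \<mu>" "sets \<mu> = sets (borel_on X)"
  shows "(\<forall>W. openin (weak_star_topology X) W \<and> \<mu> \<in> W \<longrightarrow> (\<forall>\<^sub>F i in F. A i \<subseteq> W)) \<longleftrightarrow>
    (\<forall>f. continuous_map X euclideanreal f \<longrightarrow> (\<forall>\<eta>>0. \<forall>\<^sub>F i in F. \<forall>\<nu>\<in>A i.
       prob_space \<nu> \<and> sets \<nu> = sets (borel_on X) \<and> \<bar>(\<integral>x. f x \<partial>\<nu>) - (\<integral>x. f x \<partial>\<mu>)\<bar> < \<eta>))"
    (is "?L \<longleftrightarrow> ?R")
proof
  assume L: ?L
  show ?R
  proof (intro allI impI)
    fix f and \<eta> :: real assume f: "continuous_map X euclideanreal f" and \<eta>: "0 < \<eta>"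
    let ?W = "{\<nu>. prob_space \<nu> \<and> sets \<nu> = sets (borel_on X) \<and> (\<integral>x. f x \<partial>\<nu>) \<in> ball (\<integral>x. f x \<partial>\<mu>) \<eta>}"
    have "openin (weak_star_topology X) ?W"
      unfolding weak_star_topology_def using f by (intro topology_generated_by_Basis) blast
    moreover have "\<mu> \<in> ?W" using \<mu> \<eta> by simp
    ultimately have "\<forall>\<^sub>F i in F. A i \<subseteq> ?W" using L by blast
    then show "\<forall>\<^sub>F i in F. \<forall>\<nu>\<in>A i.
       prob_space \<nu> \<and> sets \<nu> = sets (borel_on X) \<and> \<bar>(\<integral>x. f x \<partial>\<nu>) - (\<integral>x. f x \<partial>\<mu>)\<bar> < \<eta>"
      by (rule eventually_mono) (auto simp: dist_real_def abs_minus_commute)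
  qed
next
  assume R: ?R
  show ?L
  proof (intro allI impI; elim conjE)
    fix W assume "openin (weak_star_topology X) W" "\<mu> \<in> W"
    then have "generate_topology_on {{\<nu>. prob_space \<nu> \<and> sets \<nu> = sets (borel_on X) \<and> (\<integral>x. f x \<partial>\<nu>) \<in> W} |
       f W. continuous_map X euclideanreal f \<and> open W} W"
      unfolding weak_star_topology_def by (simp add: openin_topology_generated_by_iff)
    then show "\<forall>\<^sub>F i in F. A i \<subseteq> W" using \<open>\<mu> \<in> W\<close>
    proof induction
      case (Int a b)
      then have "\<forall>\<^sub>F i in F. A i \<subseteq> a" "\<forall>\<^sub>F i in F. A i \<subseteq> b" by auto
      then show ?case by eventually_elim auto
    next
      case (UN K)
      then obtain k where k: "k \<in> K" "\<mu> \<in> k" by blast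
      then have "\<forall>\<^sub>F i in F. A i \<subseteq> k" using UN by blast
      then show ?case by eventually_elim (use k in auto)
    next
      case (Basis s)
      then obtain f W where s: "s = {\<nu>. prob_space \<nu> \<and> sets \<nu> = sets (borel_on X) \<and> (\<integral>x. f x \<partial>\<nu>) \<in> W}"
        and f: "continuous_map X euclideanreal f" and W: "open W" by blast
      obtain \<eta> where \<eta>: "0 < \<eta>" "ball (\<integral>x. f x \<partial>\<mu>) \<eta> \<subseteq> W"
        using W Basis(2) s by (auto simp: open_contains_ball)
      have "\<forall>\<^sub>F i in F. \<forall>\<nu>\<in>A i.
       prob_space \<nu> \<and> sets \<nu> = sets (borel_on X) \<and> \<bar>(\<integral>x. f x \<partial>\<nu>) - (\<integral>x. f x \<partial>\<mu>)\<bar> < \<eta>"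
        using R f \<eta>(1) by blast
      then show ?case
      proof eventually_elim
        case (elim i)
        show ?case
        proof
          fix \<nu> assume "\<nu> \<in> A i"
          with elim have "prob_space \<nu>" "sets \<nu> = sets (borel_on X)"
            "(\<integral>x. f x \<partial>\<nu>) \<in> ball (\<integral>x. f x \<partial>\<mu>) \<eta>"
            by (auto simp: dist_real_def abs_minus_commute)
          then show "\<nu> \<in> s" using \<eta>(2) s by blast
        qed
      qed
    qed simp
  qed
qed

text \<open>Let \<open>m i\<close> be the largest \<open>k \<le> i\<close> for which \<open>P k\<close> holds from \<open>i\<close> on. Monotonicity of \<open>m\<close> is what
  makes the step sizes of the resulting paths decrease.\<close>

lemma diagonal_sequence:
  fixes P :: "nat \<Rightarrow> nat \<Rightarrow> bool"
  assumes ev: "\<And>k. \<forall>\<^sub>F i in sequentially. P k i" and P0: "\<And>i. P 0 i"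
  obtains m where "mono m" "filterlim m at_top sequentially" "\<And>i. P (m i) i"
proof -
  define A where "A i = {k. k \<le> i \<and> (\<forall>j\<ge>i. P k j)}" for i
  have A: "finite (A i)" "0 \<in> A i" for i
    using P0 unfolding A_def by (auto intro: finite_subset[of _ "{..i}"])
  define m where "m i = Max (A i)" for i
  have mA: "m i \<in> A i" for i unfolding m_def using A by (intro Max_in) auto
  show thesis
  proof
    show "mono m"
    proof (rule monoI)
      fix i j :: nat assume "i \<le> j"
      then have "A i \<subseteq> A j" unfolding A_def by auto
      then show "m i \<le> m j" unfolding m_def using A by (intro Max_mono) auto
    qed
    show "filterlim m at_top sequentially"
      unfolding filterlim_at_top
    proof
      fix k
      obtain N where N: "\<And>i. N \<le> i \<Longrightarrow> P k i" using ev[of k] by (auto simp: eventually_sequentially)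
      have "k \<le> m i" if "max k N \<le> i" for i
        unfolding m_def using that N A by (intro Max_ge) (auto simp: A_def)
      then show "\<forall>\<^sub>F i in sequentially. k \<le> m i" unfolding eventually_sequentially by blast
    qed
    show "P (m i) i" for i using mA[of i] unfolding A_def by auto
  qed
qed

text \<open>The assumptions pass to subsequences of the approximation, and statements along a subsequence
  are obtained by instantiating the locale with it.\<close>

locale sofic_models =
  fixes G :: "('g, 'z) monoid_scheme" (structure)
    and V :: "nat \<Rightarrow> 'v set" and \<sigma> :: "nat \<Rightarrow> 'g \<Rightarrow> 'v \<Rightarrow> 'v"
  assumes group: "group G" and countable: "countable (carrier G)"
    and sofic: "sofic_approximation G V \<sigma>"
begin

abbreviation "average i \<equiv> name_average G (V i) (\<sigma> i)"
abbreviation "name i \<equiv> pullback_name G (\<sigma> i)"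

lemma finite_V: "finite (V i)" and perm: "g \<in> carrier G \<Longrightarrow> \<sigma> i g permutes V i"
  using sofic by (auto simp: sofic_approximation_def)

lemma eventually_V_nonempty: "\<forall>\<^sub>F i in sequentially. V i \<noteq> {}"
proof -
  have "\<forall>\<^sub>F i in sequentially. 1 \<le> card (V i)"
    using sofic by (auto simp: sofic_approximation_def filterlim_at_top)
  then show ?thesis by eventually_elim auto
qed

lemma subsequence: "strict_mono n \<Longrightarrow> sofic_models G (\<lambda>i. V (n i)) (\<lambda>i. \<sigma> (n i))"
proof -
  assume n: "strict_mono n"
  have lim: "filterlim (\<lambda>i. f (n i)) F sequentially" if "filterlim f F sequentially" for f :: "nat \<Rightarrow> 'c" and F
    using filterlim_compose[OF that filterlim_subseq[OF n]] .
  show ?thesis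
    using sofic
    by (intro sofic_models.intro group countable) (auto simp: sofic_approximation_def intro!: lim)
qed

lemma eventually_model_space_iff:
  fixes l :: "nat \<Rightarrow> nat"
  assumes mp: "metric_process G K d \<mu>"
    and p: "\<And>i j. j \<le> l i \<Longrightarrow> p i j \<in> V i \<rightarrow>\<^sub>E mspace d"
  shows "(\<forall>W. openin (weak_star_topology (process_topology G d)) W \<and> \<mu> \<in> W \<longrightarrow>
      (\<forall>\<^sub>F i in sequentially. p i ` {0..l i} \<subseteq> model_space G K (V i) (\<sigma> i) W)) \<longleftrightarrow>
    (\<forall>f. continuous_map (process_topology G d) euclideanreal f \<longrightarrow> (\<forall>\<eta>>0.
      \<forall>\<^sub>F i in sequentially. \<forall>j\<le>l i. \<bar>average i f (p i j) - (\<integral>z. f z \<partial>\<mu>)\<bar> < \<eta>))"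
proof -
  note mpD = metric_processD[OF mp countable]
  let ?Z = "process_topology G d"
  define A where "A i = (\<lambda>j. empirical_distribution G K (V i) (\<sigma> i) (p i j)) ` {0..l i}" for i
  have "p i ` {0..l i} \<subseteq> model_space G K (V i) (\<sigma> i) W \<longleftrightarrow> A i \<subseteq> W" for i W
    using p mpD(3) unfolding A_def model_space_def by (auto simp: image_subset_iff)
  moreover have "(\<forall>\<^sub>F i in sequentially. \<forall>\<nu>\<in>A i. prob_space \<nu> \<and> sets \<nu> = sets (borel_on ?Z) \<and>
        \<bar>(\<integral>x. f x \<partial>\<nu>) - (\<integral>x. f x \<partial>\<mu>)\<bar> < \<eta>) \<longleftrightarrow>
      (\<forall>\<^sub>F i in sequentially. \<forall>j\<le>l i. \<bar>average i f (p i j) - (\<integral>z. f z \<partial>\<mu>)\<bar> < \<eta>)"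
    if f: "continuous_map ?Z euclideanreal f" for f \<eta>
  proof (rule eventually_subst, use eventually_V_nonempty in eventually_elim)
    case (elim i)
    have f': "f \<in> borel_measurable (PiM (carrier G) (\<lambda>_. K))"
      using continuous_map_borel_measurable[OF f mpD(6)] mpD(5) measurable_cong_sets by blast
    have e: "prob_space (empirical_distribution G K (V i) (\<sigma> i) (p i j))"
      "sets (empirical_distribution G K (V i) (\<sigma> i) (p i j)) = sets (borel_on ?Z)"
      "(\<integral>z. f z \<partial>empirical_distribution G K (V i) (\<sigma> i) (p i j)) = average i f (p i j)"
      if "j \<le> l i" for j
      using empirical_distribution_props[of "V i" G "\<sigma> i" "p i j" K] f' finite_V elim perm p[OF that] mpD
      by auto
    have "empirical_distribution G K (V i) (\<sigma> i) (p i j) \<in> A i" if "j \<le> l i" for j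
      using that unfolding A_def by auto
    then show ?case using e by (fastforce simp: A_def)
  qed
  ultimately show ?thesis
    using weak_star_neighbourhoods_iff[OF mpD(4,6), of A sequentially] by simp
qed

lemma limitin_empirical_iff:
  assumes mp: "metric_process G K d \<mu>" and x: "\<And>i. x i \<in> V i \<rightarrow>\<^sub>E mspace d"
  shows "limitin (weak_star_topology (process_topology G d))
      (\<lambda>i. empirical_distribution G K (V i) (\<sigma> i) (x i)) \<mu> sequentially \<longleftrightarrow> models_converge G d V \<sigma> \<mu> x"
proof -
  note mpD = metric_processD[OF mp countable]
  let ?Z = "process_topology G d"
  have "\<mu> \<in> topspace (weak_star_topology ?Z)"
    unfolding weak_star_topology_def topology_generated_by_topspace
    using mpD(4,6) by (intro UnionI[of "{\<nu>. prob_space \<nu> \<and> sets \<nu> = sets (borel_on ?Z) \<and> (\<integral>x. 0 \<partial>\<nu>) \<in> (UNIV :: real set)}"])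
      (auto intro!: exI[of _ "\<lambda>_. 0"] exI[of _ UNIV])
  moreover have "x i \<in> model_space G K (V i) (\<sigma> i) W \<longleftrightarrow>
      empirical_distribution G K (V i) (\<sigma> i) (x i) \<in> W" for i W
    using x mpD(3) by (auto simp: model_space_def)
  moreover have "(\<forall>W. openin (weak_star_topology ?Z) W \<and> \<mu> \<in> W \<longrightarrow>
      (\<forall>\<^sub>F i in sequentially. x i \<in> model_space G K (V i) (\<sigma> i) W)) \<longleftrightarrow> models_converge G d V \<sigma> \<mu> x"
    using eventually_model_space_iff[OF mp, of "\<lambda>_. 0" "\<lambda>i _. x i"] x
    unfolding models_converge_def tendsto_iff dist_real_def by simp
  ultimately show ?thesis unfolding limitin_def by simp
qed

lemma name_in_PiE:
  "x \<in> V i \<rightarrow>\<^sub>E A \<Longrightarrow> v \<in> V i \<Longrightarrow> name i x v \<in> carrier G \<rightarrow>\<^sub>E A"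
  by (rule pullback_name_in_PiE[OF perm])

lemma name_average_diff_le:
  assumes "\<And>z. z \<in> topspace (process_topology G d) \<Longrightarrow> \<bar>f z - h z\<bar> \<le> c" and "0 \<le> c"
    and "x \<in> V i \<rightarrow>\<^sub>E mspace d"
  shows "\<bar>average i f x - average i h x\<bar> \<le> c"
proof -
  have "\<bar>\<Sum>v\<in>V i. f (name i x v) - h (name i x v)\<bar> \<le> (\<Sum>v\<in>V i. c)"
    using assms(1) name_in_PiE[OF assms(3)]
    by (intro order_trans[OF sum_abs] sum_mono) simp
  then show ?thesis
    unfolding name_average_def diff_divide_distrib[symmetric] sum_subtractf[symmetric]
    using assms(2) by (cases "card (V i) = 0") (auto simp: field_simps)
qed

lemma mean_dist_bound:
  assumes "compact_space (mtopology_of d)"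
  obtains B where "0 < B" "\<And>i x y. x \<in> V i \<rightarrow>\<^sub>E mspace d \<Longrightarrow> y \<in> V i \<rightarrow>\<^sub>E mspace d \<Longrightarrow>
    mean_dist d (V i) x y < B"
proof -
  interpret Metric_space "mspace d" "mdist d" by (rule Metric_space_mspace_mdist)
  have "mbounded (mspace d)"
    using assms compactin_imp_mbounded unfolding compact_space_def by (simp add: mtopology_of_def)
  then obtain B where B: "\<And>a b. a \<in> mspace d \<Longrightarrow> b \<in> mspace d \<Longrightarrow> mdist d a b \<le> B"
    unfolding mbounded_alt by blast
  have "mean_dist d (V i) x y < \<bar>B\<bar> + 1"
    if "x \<in> V i \<rightarrow>\<^sub>E mspace d" "y \<in> V i \<rightarrow>\<^sub>E mspace d" for i x y
  proof -
    have "(\<Sum>v\<in>V i. mdist d (x v) (y v)) \<le> (\<Sum>v\<in>V i. \<bar>B\<bar>)"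
      using that B by (intro sum_mono) (metis PiE_mem abs_ge_self order_trans)
    then have "mean_dist d (V i) x y \<le> \<bar>B\<bar>"
      unfolding mean_dist_def by (cases "card (V i) = 0") (auto simp: field_simps)
    then show ?thesis by simp
  qed
  then show thesis using that[of "\<bar>B\<bar> + 1"] by simp
qed

text \<open>Stage \<open>m\<close> of the diagonal asks for control of the first \<open>m\<close> functions of a dense sequence
  up to an error proportional to \<open>1 / (m + 1)\<close>.\<close>

lemma model_paths_diagonal:
  assumes mp: "metric_process G K d \<mu>"
    and x: "\<And>i. x i \<in> V i \<rightarrow>\<^sub>E mspace d" and y: "\<And>i. y i \<in> V i \<rightarrow>\<^sub>E mspace d"
    and paths: "\<And>\<Phi> \<eta>. finite \<Phi> \<Longrightarrow> (\<And>f. f \<in> \<Phi> \<Longrightarrow> continuous_map (process_topology G d) euclideanreal f) \<Longrightarrow>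
      0 < \<eta> \<Longrightarrow> \<forall>\<^sub>F i in sequentially. \<exists>l p. model_path G d (V i) (\<sigma> i) \<mu> \<Phi> \<eta> (x i) (y i) l p"
  obtains \<delta> l p where "\<And>i. 0 < \<delta> i" "decseq \<delta>" "\<delta> \<longlonglongrightarrow> 0"
    "\<And>i. delta_path (V i \<rightarrow>\<^sub>E mspace d) (mean_dist d (V i)) (\<delta> i) (x i) (y i) (l i) (p i)"
    "\<And>f \<eta>. continuous_map (process_topology G d) euclideanreal f \<Longrightarrow> 0 < \<eta> \<Longrightarrow>
      \<forall>\<^sub>F i in sequentially. \<forall>j\<le>l i. \<bar>average i f (p i j) - (\<integral>z. f z \<partial>\<mu>)\<bar> < \<eta>"
proof -
  note mpD = metric_processD[OF mp countable]
  let ?Z = "process_topology G d"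
  have comp: "compact_space ?Z" using mpD(1) by (rule compact_process_topology)
  interpret \<mu>: prob_space \<mu> by (rule mpD(4))
  obtain h :: "nat \<Rightarrow> ('g \<Rightarrow> 'a) \<Rightarrow> real" where h: "\<And>m. continuous_map ?Z euclideanreal (h m)"
    "\<And>f \<epsilon>. continuous_map ?Z euclideanreal f \<Longrightarrow> 0 < \<epsilon> \<Longrightarrow> \<exists>m. \<forall>z\<in>topspace ?Z. \<bar>f z - h m z\<bar> < \<epsilon>"
    by (rule separable_continuous_functions[OF comp metrizable_process_topology[OF countable]]) blast
  obtain B where B: "0 < B" "\<And>i x y. x \<in> V i \<rightarrow>\<^sub>E mspace d \<Longrightarrow> y \<in> V i \<rightarrow>\<^sub>E mspace d \<Longrightarrow>
    mean_dist d (V i) x y < B" using mean_dist_bound[OF mpD(1)] by blast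
  \<comment> \<open>At stage \<open>0\<close> no function is controlled and the step bound exceeds the diameter, so that a
    single step from \<open>x i\<close> to \<open>y i\<close> is admissible for every \<open>i\<close>.\<close>
  define P where "P m i \<longleftrightarrow> (\<exists>l p. model_path G d (V i) (\<sigma> i) \<mu> (h ` {..<m}) (B / Suc m) (x i) (y i) l p)" for m i
  have "\<forall>\<^sub>F i in sequentially. P m i" for m
    unfolding P_def using h(1) B(1) by (intro paths) auto
  moreover have "P 0 i" for i
    unfolding P_def model_path_def
  proof (intro exI conjI)
    show "delta_path (V i \<rightarrow>\<^sub>E mspace d) (mean_dist d (V i)) (B / Suc 0) (x i) (y i) 1
      (\<lambda>j. if j = 0 then x i else y i)"
      using B(2)[OF x y] x y by (auto simp: delta_path_def)
  qed simp
  ultimately obtain m where m: "mono m" "filterlim m at_top sequentially" "\<And>i. P (m i) i"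
    using diagonal_sequence[of P] by blast
  then obtain l p where lp: "\<And>i. model_path G d (V i) (\<sigma> i) \<mu> (h ` {..<m i}) (B / Suc (m i)) (x i) (y i) (l i) (p i)"
    unfolding P_def by metis
  define \<delta> where "\<delta> i = B / Suc (m i)" for i
  have lim: "\<delta> \<longlonglongrightarrow> 0"
  proof -
    have "(\<lambda>n. B / Suc n) \<longlonglongrightarrow> 0"
      using tendsto_mult[OF tendsto_const[of B] LIMSEQ_inverse_real_of_nat] by (simp add: divide_inverse)
    from filterlim_compose[OF this m(2)] show ?thesis unfolding \<delta>_def[abs_def] .
  qed
  show thesis
  proof
    show "0 < \<delta> i" for i using B(1) by (simp add: \<delta>_def)
    show "decseq \<delta>" unfolding decseq_def \<delta>_def
      using m(1) B(1) by (auto intro!: divide_left_mono simp: monoD)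
    show "\<delta> \<longlonglongrightarrow> 0" by (fact lim)
    show dp: "delta_path (V i \<rightarrow>\<^sub>E mspace d) (mean_dist d (V i)) (\<delta> i) (x i) (y i) (l i) (p i)" for i
      using lp by (simp add: model_path_def \<delta>_def)
    fix f \<eta> assume f: "continuous_map ?Z euclideanreal f" and \<eta>: "(0::real) < \<eta>"
    obtain s where s: "\<And>z. z \<in> topspace ?Z \<Longrightarrow> \<bar>f z - h s z\<bar> < \<eta> / 3" using h(2)[OF f, of "\<eta> / 3"] \<eta> by auto
    have int: "\<bar>(\<integral>z. f z \<partial>\<mu>) - (\<integral>z. h s z \<partial>\<mu>)\<bar> \<le> \<eta> / 3"
    proof -
      have i: "integrable \<mu> f" "integrable \<mu> (h s)"
        using integrable_continuous_map[OF comp _ mpD(4,6)] f h(1) by blast+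
      then have "\<bar>(\<integral>z. f z \<partial>\<mu>) - (\<integral>z. h s z \<partial>\<mu>)\<bar> = \<bar>\<integral>z. f z - h s z \<partial>\<mu>\<bar>" by simp
      also have "\<dots> \<le> (\<integral>z. \<bar>f z - h s z\<bar> \<partial>\<mu>)" by (rule integral_abs_bound)
      also have "\<dots> \<le> (\<integral>z. \<eta> / 3 \<partial>\<mu>)"
        using i s mpD(7) by (intro integral_mono) (auto simp: less_imp_le)
      finally show ?thesis by (simp add: \<mu>.prob_space)
    qed
    have "\<forall>\<^sub>F i in sequentially. Suc s \<le> m i"
      using m(2) unfolding filterlim_at_top by blast
    then have "\<forall>\<^sub>F i in sequentially. s < m i" by (simp add: Suc_le_eq)
    moreover have "\<forall>\<^sub>F i in sequentially. \<delta> i < \<eta> / 3" using order_tendstoD(2)[OF lim, of "\<eta> / 3"] \<eta> by simp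
    ultimately show "\<forall>\<^sub>F i in sequentially. \<forall>j\<le>l i.
        \<bar>average i f (p i j) - (\<integral>z. f z \<partial>\<mu>)\<bar> < \<eta>"
    proof (eventually_elim, intro allI impI)
      fix i j assume i: "s < m i" "\<delta> i < \<eta> / 3" and j: "j \<le> l i"
      have "p i j \<in> V i \<rightarrow>\<^sub>E mspace d" using dp[of i] j by (auto simp: delta_path_def)
      then have "\<bar>average i f (p i j) - average i (h s) (p i j)\<bar> \<le> \<eta> / 3"
        using s \<eta> by (intro name_average_diff_le[where d = d]) (auto simp: less_imp_le)
      moreover have "\<bar>average i (h s) (p i j) - (\<integral>z. h s z \<partial>\<mu>)\<bar> < \<delta> i"
        using lp[of i] i(1) j by (auto simp: model_path_def \<delta>_def)
      ultimately show "\<bar>average i f (p i j) - (\<integral>z. f z \<partial>\<mu>)\<bar> < \<eta>"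
        using int i(2) by linarith
    qed
  qed
qed

text \<open>Fixing the functions and the tolerance before the paths are chosen loses nothing, by the
  diagonal argument above.\<close>

lemma eventually_joined_iff:
  assumes mp: "metric_process G K d \<mu>"
    and x: "\<And>i. x i \<in> V i \<rightarrow>\<^sub>E mspace d" and y: "\<And>i. y i \<in> V i \<rightarrow>\<^sub>E mspace d"
  shows "(\<exists>\<delta> l p. (\<forall>i. 0 < \<delta> i) \<and> decseq \<delta> \<and> \<delta> \<longlonglongrightarrow> 0 \<and>
       (\<forall>i. delta_path (V i \<rightarrow>\<^sub>E mspace d) (mean_dist d (V i)) (\<delta> i) (x i) (y i) (l i) (p i)) \<and>
       (\<forall>W. openin (weak_star_topology (process_topology G d)) W \<and> \<mu> \<in> W \<longrightarrow>
         (\<forall>\<^sub>F i in sequentially. p i ` {0..l i} \<subseteq> model_space G K (V i) (\<sigma> i) W)))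
    \<longleftrightarrow> eventually_joined G d V \<sigma> \<mu> x y" (is "?L \<longleftrightarrow> ?R")
proof
  assume ?L
  then obtain \<delta> l p where \<delta>: "\<delta> \<longlonglongrightarrow> 0"
    and dp: "\<And>i. delta_path (V i \<rightarrow>\<^sub>E mspace d) (mean_dist d (V i)) (\<delta> i) (x i) (y i) (l i) (p i)"
    and good: "\<forall>W. openin (weak_star_topology (process_topology G d)) W \<and> \<mu> \<in> W \<longrightarrow>
      (\<forall>\<^sub>F i in sequentially. p i ` {0..l i} \<subseteq> model_space G K (V i) (\<sigma> i) W)" by blast
  have pV: "p i j \<in> V i \<rightarrow>\<^sub>E mspace d" if "j \<le> l i" for i j
    using dp[of i] that by (auto simp: delta_path_def)
  show ?R
    unfolding eventually_joined_def
  proof (intro allI impI)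
    fix \<Phi> and \<eta> :: real
    assume \<Phi>: "finite \<Phi>" "\<forall>f\<in>\<Phi>. continuous_map (process_topology G d) euclideanreal f" and \<eta>: "0 < \<eta>"
    have "\<forall>f\<in>\<Phi>. \<forall>\<^sub>F i in sequentially. \<forall>j\<le>l i. \<bar>average i f (p i j) - (\<integral>z. f z \<partial>\<mu>)\<bar> < \<eta>"
      using eventually_model_space_iff[OF mp, of l p, OF pV] good \<Phi>(2) \<eta> by blast
    then have "\<forall>\<^sub>F i in sequentially. \<forall>f\<in>\<Phi>. \<forall>j\<le>l i. \<bar>average i f (p i j) - (\<integral>z. f z \<partial>\<mu>)\<bar> < \<eta>"
      by (rule eventually_ball_finite[OF \<Phi>(1)])
    moreover have "\<forall>\<^sub>F i in sequentially. \<delta> i < \<eta>" using order_tendstoD(2)[OF \<delta>] \<eta> by simp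
    ultimately show "\<forall>\<^sub>F i in sequentially. \<exists>l p. model_path G d (V i) (\<sigma> i) \<mu> \<Phi> \<eta> (x i) (y i) l p"
    proof eventually_elim
      case (elim i)
      then have "model_path G d (V i) (\<sigma> i) \<mu> \<Phi> \<eta> (x i) (y i) (l i) (p i)"
        using dp[of i] by (auto simp: model_path_def delta_path_def intro: less_trans)
      then show ?case by blast
    qed
  qed
next
  assume R: ?R
  have "\<forall>\<^sub>F i in sequentially. \<exists>l p. model_path G d (V i) (\<sigma> i) \<mu> \<Phi> \<eta> (x i) (y i) l p"
    if "finite \<Phi>" "\<And>f. f \<in> \<Phi> \<Longrightarrow> continuous_map (process_topology G d) euclideanreal f" "0 < \<eta>" for \<Phi> \<eta>
    using R that unfolding eventually_joined_def by simp
  from model_paths_diagonal[OF mp x y this]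
  obtain \<delta> l p where D: "\<And>i. 0 < \<delta> i" "decseq \<delta>" "\<delta> \<longlonglongrightarrow> 0"
    and dp: "\<And>i. delta_path (V i \<rightarrow>\<^sub>E mspace d) (mean_dist d (V i)) (\<delta> i) (x i) (y i) (l i) (p i)"
    and good: "\<And>f \<eta>. continuous_map (process_topology G d) euclideanreal f \<Longrightarrow> 0 < \<eta> \<Longrightarrow>
      \<forall>\<^sub>F i in sequentially. \<forall>j\<le>l i. \<bar>average i f (p i j) - (\<integral>z. f z \<partial>\<mu>)\<bar> < \<eta>"
    by blast
  have pV: "p i j \<in> V i \<rightarrow>\<^sub>E mspace d" if "j \<le> l i" for i j
    using dp[of i] that by (auto simp: delta_path_def)
  have "\<forall>W. openin (weak_star_topology (process_topology G d)) W \<and> \<mu> \<in> W \<longrightarrow>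
      (\<forall>\<^sub>F i in sequentially. p i ` {0..l i} \<subseteq> model_space G K (V i) (\<sigma> i) W)"
    using eventually_model_space_iff[OF mp, of l p, OF pV] good by blast
  then show ?L using D dp by blast
qed

text \<open>The form in which connectedness is used and proved below: no topology on measures occurs, and
  the paths may depend on the functions and the tolerance.\<close>

theorem process_connected_iff:
  assumes proc: "metric_process G K d \<mu>"
  shows "process_connected_model_spaces G V \<sigma> K d \<mu> \<longleftrightarrow>
    (\<forall>n x y. strict_mono n \<longrightarrow> (\<forall>i. x i \<in> V (n i) \<rightarrow>\<^sub>E mspace d) \<longrightarrow> (\<forall>i. y i \<in> V (n i) \<rightarrow>\<^sub>E mspace d) \<longrightarrow>
       models_converge G d (\<lambda>i. V (n i)) (\<lambda>i. \<sigma> (n i)) \<mu> x \<longrightarrow>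
       models_converge G d (\<lambda>i. V (n i)) (\<lambda>i. \<sigma> (n i)) \<mu> y \<longrightarrow>
       eventually_joined G d (\<lambda>i. V (n i)) (\<lambda>i. \<sigma> (n i)) \<mu> x y)"
  unfolding process_connected_model_spaces_def metric_processD(3)[OF proc countable]
proof (intro iff_allI imp_cong refl)
  fix n :: "nat \<Rightarrow> nat" and x y :: "nat \<Rightarrow> 'v \<Rightarrow> 'a"
  assume n: "strict_mono n" and x: "\<forall>i. x i \<in> V (n i) \<rightarrow>\<^sub>E mspace d" and y: "\<forall>i. y i \<in> V (n i) \<rightarrow>\<^sub>E mspace d"
  interpret S: sofic_models G "\<lambda>i. V (n i)" "\<lambda>i. \<sigma> (n i)" by (rule subsequence[OF n])
  show "limitin (weak_star_topology (process_topology G d))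
        (\<lambda>i. empirical_distribution G K (V (n i)) (\<sigma> (n i)) (x i)) \<mu> sequentially \<longleftrightarrow>
      models_converge G d (\<lambda>i. V (n i)) (\<lambda>i. \<sigma> (n i)) \<mu> x"
    "limitin (weak_star_topology (process_topology G d))
        (\<lambda>i. empirical_distribution G K (V (n i)) (\<sigma> (n i)) (y i)) \<mu> sequentially \<longleftrightarrow>
      models_converge G d (\<lambda>i. V (n i)) (\<lambda>i. \<sigma> (n i)) \<mu> y"
    using x y by (simp_all add: S.limitin_empirical_iff[OF proc])
qed (rule sofic_models.eventually_joined_iff[OF subsequence proc]; blast)

end

section \<open>Transport of paths along continuous codes\<close>

definition lift_model :: "('g, 'z) monoid_scheme \<Rightarrow> 'v set \<Rightarrow> ('g \<Rightarrow> 'v \<Rightarrow> 'v) \<Rightarrow>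
    (('g \<Rightarrow> 'x) \<Rightarrow> 'y) \<Rightarrow> ('v \<Rightarrow> 'x) \<Rightarrow> 'v \<Rightarrow> 'y" where
  "lift_model G V s F p = (\<lambda>v\<in>V. F (pullback_name G s p v))"

text \<open>The equivariant map \<open>z \<mapsto> (F (S\<^sup>g z))\<^sub>g\<close> determined by its coordinate \<open>F\<close> at the identity;
  \<open>lift_model\<close> is its analogue for models.\<close>

definition sliding_code :: "('g, 'z) monoid_scheme \<Rightarrow> (('g \<Rightarrow> 'x) \<Rightarrow> 'y) \<Rightarrow> ('g \<Rightarrow> 'x) \<Rightarrow> 'g \<Rightarrow> 'y" where
  "sliding_code G F z = (\<lambda>g\<in>carrier G. F (shift G g z))"

definition lifts_approximately :: "('g, 'z) monoid_scheme \<Rightarrow> (nat \<Rightarrow> 'v set) \<Rightarrow> (nat \<Rightarrow> 'g \<Rightarrow> 'v \<Rightarrow> 'v) \<Rightarrow>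
    'x metric \<Rightarrow> 'y metric \<Rightarrow> ('g \<Rightarrow> 'y) measure \<Rightarrow> (('g \<Rightarrow> 'y) \<Rightarrow> 'x) \<Rightarrow> real \<Rightarrow>
    (nat \<Rightarrow> 'v \<Rightarrow> 'x) \<Rightarrow> (nat \<Rightarrow> 'v \<Rightarrow> 'y) \<Rightarrow> bool" where
  "lifts_approximately G V \<sigma> d d' \<mu>' F \<epsilon> x x' \<longleftrightarrow>
     (\<forall>i. x' i \<in> V i \<rightarrow>\<^sub>E mspace d') \<and> models_converge G d' V \<sigma> \<mu>' x' \<and>
     (\<forall>\<^sub>F i in sequentially. mean_dist d (V i) (x i) (lift_model G (V i) (\<sigma> i) F (x' i)) < \<epsilon>)"

context sofic_models
begin

abbreviation "lifted i \<equiv> lift_model G (V i) (\<sigma> i)"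

interpretation group G by (rule group)

lemma continuous_map_shift:
  assumes "g \<in> carrier G"
  shows "continuous_map (process_topology G d) (process_topology G d) (shift G g)"
  unfolding process_topology_def continuous_map_componentwise
proof (intro conjI ballI)
  fix k assume k: "k \<in> carrier G"
  have "continuous_map (product_topology (\<lambda>_. mtopology_of d) (carrier G)) (mtopology_of d) (\<lambda>x. x (k \<otimes> g))"
    using k assms by (intro continuous_map_product_projection) simp
  then show "continuous_map (product_topology (\<lambda>_. mtopology_of d) (carrier G)) (mtopology_of d) (\<lambda>x. shift G g x k)"
    using k by (simp add: shift_def)
qed (auto simp: shift_def)

lemma continuous_map_sliding_code:
  assumes "continuous_map (process_topology G d') (mtopology_of d) F"
  shows "continuous_map (process_topology G d') (process_topology G d) (sliding_code G F)"
  unfolding process_topology_def continuous_map_componentwise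
proof (intro conjI ballI)
  fix k assume k: "k \<in> carrier G"
  have "continuous_map (process_topology G d') (mtopology_of d) (F \<circ> shift G k)"
    using continuous_map_compose[OF continuous_map_shift[OF k] assms] .
  then show "continuous_map (product_topology (\<lambda>_. mtopology_of d') (carrier G)) (mtopology_of d) (\<lambda>x. sliding_code G F x k)"
    using k by (simp add: sliding_code_def process_topology_def o_def)
qed (auto simp: sliding_code_def)

lemma shift_in_PiE: "z \<in> carrier G \<rightarrow>\<^sub>E A \<Longrightarrow> g \<in> carrier G \<Longrightarrow> shift G g z \<in> carrier G \<rightarrow>\<^sub>E A"
  by (auto simp: shift_def PiE_iff)

lemma lift_model_in_PiE:
  assumes "continuous_map (process_topology G d') (mtopology_of d) F" and "p \<in> V i \<rightarrow>\<^sub>E mspace d'"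
  shows "lifted i F p \<in> V i \<rightarrow>\<^sub>E mspace d"
  using continuous_map_funspace[OF assms(1)] name_in_PiE[OF assms(2)]
  by (auto simp: lift_model_def)

text \<open>If the names of \<open>x\<close> and \<open>x'\<close> at \<open>v\<close> are not close on the window \<open>E\<close>, then the distances
  over the window sum to at least \<open>\<tau>\<close>. As the maps \<open>\<sigma>\<^sup>g\<close> are permutations, the average of these
  sums is \<open>card E\<close> times the mean distance of \<open>x\<close> and \<open>x'\<close>.\<close>

lemma uniform_name_distance:
  assumes comp: "compact_space (mtopology_of d)"
    and F: "continuous_map (process_topology G d) (mtopology_of e) F" and eps: "(0::real) < \<epsilon>"
  obtains \<kappa> where "0 < \<kappa>" "\<And>i x x'. x \<in> V i \<rightarrow>\<^sub>E mspace d \<Longrightarrow> x' \<in> V i \<rightarrow>\<^sub>E mspace d \<Longrightarrow>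
    mean_dist d (V i) x x' < \<kappa> \<Longrightarrow>
    (\<Sum>v\<in>V i. mdist e (F (name i x v)) (F (name i x' v))) / card (V i) < \<epsilon>"
proof -
  let ?Z = "process_topology G d"
  interpret D: Metric_space "mspace d" "mdist d" by (rule Metric_space_mspace_mdist)
  interpret E: Metric_space "mspace e" "mdist e" by (rule Metric_space_mspace_mdist)
  have "E.mbounded (F ` topspace ?Z)"
    using image_compactin[OF _ F, of "topspace ?Z"] compact_process_topology[OF comp, of G]
    by (intro E.compactin_imp_mbounded) (auto simp: compact_space_def mtopology_of_def)
  then obtain B0 where B0: "\<And>z z'. z \<in> topspace ?Z \<Longrightarrow> z' \<in> topspace ?Z \<Longrightarrow> mdist e (F z) (F z') \<le> B0"
    unfolding E.mbounded_alt by blast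
  define B where "B = \<bar>B0\<bar> + 1"
  have B1: "0 < B" by (simp add: B_def)
  have B2: "mdist e (F z) (F z') \<le> B" if "z \<in> topspace ?Z" "z' \<in> topspace ?Z" for z z'
    using B0[OF that] by (simp add: B_def)
  obtain E \<tau> where E: "finite E" "E \<subseteq> carrier G" "0 < \<tau>"
    "\<And>z z'. z \<in> topspace ?Z \<Longrightarrow> z' \<in> topspace ?Z \<Longrightarrow>
       \<forall>g\<in>E. mdist d (z g) (z' g) < \<tau> \<Longrightarrow> mdist e (F z) (F z') < \<epsilon> / 2"
    using process_topology_uniform_continuity[OF comp F half_gt_zero[OF eps]] by blast
  \<comment> \<open>The points where the window test fails then contribute less than \<open>\<epsilon> / 2\<close>.\<close>
  define \<kappa> where "\<kappa> = \<epsilon> * \<tau> / (2 * B * (card E + 1))"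
  show thesis
  proof
    show "0 < \<kappa>" unfolding \<kappa>_def using eps E(3) B1 by (intro divide_pos_pos mult_pos_pos) auto
    fix i x x'
    assume x: "x \<in> V i \<rightarrow>\<^sub>E mspace d" and x': "x' \<in> V i \<rightarrow>\<^sub>E mspace d" and \<kappa>: "mean_dist d (V i) x x' < \<kappa>"
    let ?P = "\<lambda>x v. name i x v"
    have *: "mdist e (F (?P x v)) (F (?P x' v)) \<le> \<epsilon> / 2 + B / \<tau> * (\<Sum>g\<in>E. mdist d (x (\<sigma> i g v)) (x' (\<sigma> i g v)))"
      if v: "v \<in> V i" for v
    proof (cases "\<forall>g\<in>E. mdist d (?P x v g) (?P x' v g) < \<tau>")
      case True
      then have "mdist e (F (?P x v)) (F (?P x' v)) < \<epsilon> / 2"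
        using E(4) name_in_PiE[OF x v] name_in_PiE[OF x' v] by simp
      moreover have "0 \<le> B / \<tau> * (\<Sum>g\<in>E. mdist d (x (\<sigma> i g v)) (x' (\<sigma> i g v)))"
        using B1 E(3) by (intro mult_nonneg_nonneg sum_nonneg) auto
      ultimately show ?thesis by linarith
    next
      case False
      then obtain g where g: "g \<in> E" "\<tau> \<le> mdist d (x (\<sigma> i g v)) (x' (\<sigma> i g v))"
        using E(2) by (auto simp: pullback_name_def subset_iff not_less)
      note g(2)
      also have "mdist d (x (\<sigma> i g v)) (x' (\<sigma> i g v)) \<le> (\<Sum>g\<in>E. mdist d (x (\<sigma> i g v)) (x' (\<sigma> i g v)))"
        using g(1) E(1) by (intro member_le_sum) auto
      finally have "B \<le> B / \<tau> * (\<Sum>g\<in>E. mdist d (x (\<sigma> i g v)) (x' (\<sigma> i g v)))"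
        using B1 E(3) by (simp add: field_simps)
      then show ?thesis using B2[of "?P x v" "?P x' v"] name_in_PiE[OF x v] name_in_PiE[OF x' v] eps by simp
    qed
    have "(\<Sum>v\<in>V i. mdist e (F (?P x v)) (F (?P x' v))) \<le>
        (\<Sum>v\<in>V i. \<epsilon> / 2 + B / \<tau> * (\<Sum>g\<in>E. mdist d (x (\<sigma> i g v)) (x' (\<sigma> i g v))))"
      using * by (rule sum_mono)
    also have "\<dots> = card (V i) * (\<epsilon> / 2) + B / \<tau> * (\<Sum>g\<in>E. \<Sum>v\<in>V i. mdist d (x (\<sigma> i g v)) (x' (\<sigma> i g v)))"
      by (simp only: sum.distrib sum_distrib_left[symmetric] sum_constant sum.swap[where A = E and B = "V i"])
    also have "(\<Sum>g\<in>E. \<Sum>v\<in>V i. mdist d (x (\<sigma> i g v)) (x' (\<sigma> i g v))) = (\<Sum>g\<in>E. \<Sum>v\<in>V i. mdist d (x v) (x' v))"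
    proof (rule sum.cong)
      fix g assume "g \<in> E"
      then show "(\<Sum>v\<in>V i. mdist d (x (\<sigma> i g v)) (x' (\<sigma> i g v))) = (\<Sum>v\<in>V i. mdist d (x v) (x' v))"
        using sum.permute[OF perm[of g i], of "\<lambda>v. mdist d (x v) (x' v)"] E(2) by (auto simp: o_def)
    qed simp
    finally have le: "(\<Sum>v\<in>V i. mdist e (F (?P x v)) (F (?P x' v))) \<le>
        card (V i) * (\<epsilon> / 2) + B / \<tau> * card E * (\<Sum>v\<in>V i. mdist d (x v) (x' v))" by (simp add: mult.assoc)
    show "(\<Sum>v\<in>V i. mdist e (F (?P x v)) (F (?P x' v))) / card (V i) < \<epsilon>"
    proof (cases "card (V i) = 0")
      case False
      then have "(\<Sum>v\<in>V i. mdist e (F (?P x v)) (F (?P x' v))) / card (V i) \<le>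
          \<epsilon> / 2 + B / \<tau> * card E * mean_dist d (V i) x x'"
        using le unfolding mean_dist_def by (simp add: field_simps)
      also have "B / \<tau> * card E * mean_dist d (V i) x x' \<le> B / \<tau> * card E * \<kappa>"
        using \<kappa> B1 E(3) by (intro mult_left_mono) auto
      also have "B / \<tau> * card E * \<kappa> = \<epsilon> / 2 * (card E / (card E + 1))"
      proof -
        have "B / \<tau> * c * (\<epsilon> * \<tau> / (2 * B * a)) = \<epsilon> / 2 * (c / a)" if "0 < a" for a c
          using that B1 E(3) by (simp add: field_simps)
        then show ?thesis unfolding \<kappa>_def by simp
      qed
      also have "\<dots> < \<epsilon> / 2"
        using eps by (simp add: field_simps)
      finally show ?thesis by simp
    qed (use eps in auto)
  qed
qed

lemma name_average_close:
  assumes comp: "compact_space (mtopology_of d)"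
    and f: "continuous_map (process_topology G d) euclideanreal f" and eps: "(0::real) < \<epsilon>"
  obtains \<kappa> where "0 < \<kappa>" "\<And>i x x'. x \<in> V i \<rightarrow>\<^sub>E mspace d \<Longrightarrow> x' \<in> V i \<rightarrow>\<^sub>E mspace d \<Longrightarrow>
    mean_dist d (V i) x x' < \<kappa> \<Longrightarrow>
    \<bar>average i f x - average i f x'\<bar> < \<epsilon>"
proof -
  have f': "continuous_map (process_topology G d) (mtopology_of euclidean_metric) f" using f by simp
  obtain \<kappa> where \<kappa>: "0 < \<kappa>" "\<And>i x x'. x \<in> V i \<rightarrow>\<^sub>E mspace d \<Longrightarrow> x' \<in> V i \<rightarrow>\<^sub>E mspace d \<Longrightarrow>
    mean_dist d (V i) x x' < \<kappa> \<Longrightarrow>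
    (\<Sum>v\<in>V i. mdist euclidean_metric (f (name i x v)) (f (name i x' v))) / card (V i) < \<epsilon>"
    by (rule uniform_name_distance[OF comp f' eps]) blast
  show thesis
  proof
    show "0 < \<kappa>" by fact
    fix i x x' assume a: "x \<in> V i \<rightarrow>\<^sub>E mspace d" "x' \<in> V i \<rightarrow>\<^sub>E mspace d" "mean_dist d (V i) x x' < \<kappa>"
    have "\<bar>average i f x - average i f x'\<bar> =
        \<bar>\<Sum>v\<in>V i. f (name i x v) - f (name i x' v)\<bar> / card (V i)"
      unfolding name_average_def by (simp add: diff_divide_distrib[symmetric] sum_subtractf)
    also have "\<dots> \<le> (\<Sum>v\<in>V i. \<bar>f (name i x v) - f (name i x' v)\<bar>) / card (V i)"
      by (intro divide_right_mono sum_abs) simp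
    also have "\<dots> < \<epsilon>" using \<kappa>(2)[OF a] by (simp add: dist_real_def)
    finally show "\<bar>average i f x - average i f x'\<bar> < \<epsilon>" .
  qed
qed

lemma multiplicative_defect_tendsto_0:
  assumes "h \<in> carrier G" "g \<in> carrier G"
  shows "(\<lambda>i. real (card {v \<in> V i. \<sigma> i h (\<sigma> i g v) \<noteq> \<sigma> i (h \<otimes> g) v}) / card (V i)) \<longlonglongrightarrow> 0"
proof -
  have "(\<lambda>i. 1 - real (card {v \<in> V i. \<sigma> i h (\<sigma> i g v) = \<sigma> i (h \<otimes> g) v}) / card (V i)) \<longlonglongrightarrow> 1 - 1"
    using sofic assms by (intro tendsto_diff tendsto_const) (auto simp: sofic_approximation_def)
  moreover have "\<forall>\<^sub>F i in sequentially.
    1 - real (card {v \<in> V i. \<sigma> i h (\<sigma> i g v) = \<sigma> i (h \<otimes> g) v}) / card (V i) =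
    real (card {v \<in> V i. \<sigma> i h (\<sigma> i g v) \<noteq> \<sigma> i (h \<otimes> g) v}) / card (V i)"
    using eventually_V_nonempty
  proof eventually_elim
    case (elim i)
    have "card (V i) = card ({v \<in> V i. \<sigma> i h (\<sigma> i g v) = \<sigma> i (h \<otimes> g) v} \<union> {v \<in> V i. \<sigma> i h (\<sigma> i g v) \<noteq> \<sigma> i (h \<otimes> g) v})"
      by (rule arg_cong[where f = card]) auto
    also have "\<dots> = card {v \<in> V i. \<sigma> i h (\<sigma> i g v) = \<sigma> i (h \<otimes> g) v} + card {v \<in> V i. \<sigma> i h (\<sigma> i g v) \<noteq> \<sigma> i (h \<otimes> g) v}"
      using finite_V by (intro card_Un_disjoint) auto
    finally have "real (card (V i)) = card {v \<in> V i. \<sigma> i h (\<sigma> i g v) = \<sigma> i (h \<otimes> g) v} + card {v \<in> V i. \<sigma> i h (\<sigma> i g v) \<noteq> \<sigma> i (h \<otimes> g) v}"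
      by simp
    moreover have "card (V i) \<noteq> 0" using elim finite_V by simp
    ultimately show ?case by (simp add: field_simps)
  qed
  ultimately show ?thesis by (simp add: tendsto_cong)
qed

text \<open>A permutation \<open>s\<close> with \<open>s (s v) = s v\<close> fixes \<open>v\<close>.\<close>

lemma identity_defect_tendsto_0:
  "(\<lambda>i. real (card {v \<in> V i. \<sigma> i \<one> v \<noteq> v}) / card (V i)) \<longlonglongrightarrow> 0"
proof -
  have "\<sigma> i \<one> (\<sigma> i \<one> v) \<noteq> \<sigma> i (\<one> \<otimes> \<one>) v \<longleftrightarrow> \<sigma> i \<one> v \<noteq> v" for i v
    using permutes_inj[OF perm[OF one_closed]] by (auto simp: inj_eq)
  then show ?thesis using multiplicative_defect_tendsto_0[OF one_closed one_closed] by simp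
qed

text \<open>At a point \<open>v\<close> where \<open>\<sigma>\<^sup>h \<sigma>\<^sup>g v = \<sigma>\<^sup>h\<^sup>g v\<close> for all \<open>g\<close>, \<open>h\<close> of two finite windows, the name of the lifted
  model agrees approximately, on one of the windows, with the sliding block code of the name of \<open>p\<close>.
  The proportion of the other points tends to zero, and the bound does not depend on \<open>p\<close>.\<close>

lemma name_average_lift_model:
  assumes comp: "compact_space (mtopology_of d)" and comp': "compact_space (mtopology_of d')"
    and F: "continuous_map (process_topology G d') (mtopology_of d) F"
    and f: "continuous_map (process_topology G d) euclideanreal f" and eps: "(0::real) < \<epsilon>"
  shows "\<forall>\<^sub>F i in sequentially. \<forall>p\<in>V i \<rightarrow>\<^sub>E mspace d'.
    \<bar>average i f (lifted i F p) -
     average i (\<lambda>z. f (sliding_code G F z)) p\<bar> < \<epsilon>"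
proof -
  let ?Z = "process_topology G d" and ?Z' = "process_topology G d'"
  interpret D: Metric_space "mspace d" "mdist d" by (rule Metric_space_mspace_mdist)
  interpret D': Metric_space "mspace d'" "mdist d'" by (rule Metric_space_mspace_mdist)
  obtain B where B: "0 < B" "\<And>z. z \<in> topspace ?Z \<Longrightarrow> \<bar>f z\<bar> \<le> B"
    using continuous_map_bounded[OF compact_process_topology[OF comp] f] by blast
  have f': "continuous_map ?Z (mtopology_of euclidean_metric) f" using f by simp
  obtain D \<rho> where D: "finite D" "D \<subseteq> carrier G" "0 < \<rho>"
    "\<And>z z'. z \<in> topspace ?Z \<Longrightarrow> z' \<in> topspace ?Z \<Longrightarrow>
       \<forall>g\<in>D. mdist d (z g) (z' g) < \<rho> \<Longrightarrow> mdist euclidean_metric (f z) (f z') < \<epsilon> / 2"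
    using process_topology_uniform_continuity[OF comp f' half_gt_zero[OF eps]] by blast
  obtain E \<tau> where E: "finite E" "E \<subseteq> carrier G" "0 < \<tau>"
    "\<And>z z'. z \<in> topspace ?Z' \<Longrightarrow> z' \<in> topspace ?Z' \<Longrightarrow>
       \<forall>g\<in>E. mdist d' (z g) (z' g) < \<tau> \<Longrightarrow> mdist d (F z) (F z') < \<rho>"
    using process_topology_uniform_continuity[OF comp' F D(3)] by blast
  define defect where "defect i h g = {v \<in> V i. \<sigma> i h (\<sigma> i g v) \<noteq> \<sigma> i (h \<otimes> g) v}" for i h g
  have "(\<lambda>i. \<Sum>g\<in>D. \<Sum>h\<in>E. real (card (defect i h g)) / card (V i)) \<longlonglongrightarrow> (\<Sum>g\<in>D. \<Sum>h\<in>E. 0)"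
    unfolding defect_def using D(2) E(2) by (intro tendsto_sum multiplicative_defect_tendsto_0) auto
  then have "\<forall>\<^sub>F i in sequentially. (\<Sum>g\<in>D. \<Sum>h\<in>E. real (card (defect i h g)) / card (V i)) < \<epsilon> / (4 * B)"
    using eps B(1) by (intro order_tendstoD(2)) auto
  then show ?thesis using eventually_V_nonempty
  proof eventually_elim
    case (elim i)
    show ?case
    proof
      fix p assume p: "p \<in> V i \<rightarrow>\<^sub>E mspace d'"
      let ?P = "name i p"
      let ?L = "lifted i F p"
      have Fim: "F z \<in> mspace d" if "z \<in> topspace ?Z'" for z
        using that continuous_map_funspace[OF F] by auto
      have LV: "?L \<in> V i \<rightarrow>\<^sub>E mspace d" using lift_model_in_PiE[OF F p] .
      have *: "\<bar>f (name i ?L v) - f (sliding_code G F (?P v))\<bar>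
          \<le> \<epsilon> / 2 + 2 * B * (\<Sum>g\<in>D. \<Sum>h\<in>E. indicator (defect i h g) v)" if v: "v \<in> V i" for v
      proof -
        have Pv: "?P v \<in> topspace ?Z'" using name_in_PiE[OF p v] by simp
        have in1: "name i ?L v \<in> topspace ?Z" using name_in_PiE[OF LV v] by simp
        have in2: "sliding_code G F (?P v) \<in> topspace ?Z"
          using continuous_map_funspace[OF continuous_map_sliding_code[OF F]] Pv by blast
        show ?thesis
        proof (cases "\<forall>g\<in>D. \<forall>h\<in>E. v \<notin> defect i h g")
          case True
          have "mdist d (name i ?L v g) (sliding_code G F (?P v) g) < \<rho>" if g: "g \<in> D" for g
          proof -
            have gG: "g \<in> carrier G" using g D(2) by blast
            then have sv: "\<sigma> i g v \<in> V i" using v by (simp add: permutes_in_image[OF perm])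
            have "name i ?L v g = F (?P (\<sigma> i g v))"
              unfolding pullback_name_def[of G "\<sigma> i" ?L v] using gG sv by (simp add: lift_model_def)
            moreover have "sliding_code G F (?P v) g = F (shift G g (?P v))"
              using gG by (simp add: sliding_code_def)
            moreover have "?P (\<sigma> i g v) h = shift G g (?P v) h" if h: "h \<in> E" for h
              using True g h gG E(2) v by (auto simp: pullback_name_def shift_def defect_def subset_iff)
            moreover have in': "?P (\<sigma> i g v) \<in> topspace ?Z'" "shift G g (?P v) \<in> topspace ?Z'"
              using name_in_PiE[OF p sv] shift_in_PiE[OF _ gG, of "?P v" "mspace d'"] Pv by simp_all
            moreover have "mdist d' (?P (\<sigma> i g v) h) (?P (\<sigma> i g v) h) < \<tau>" if "h \<in> E" for h
              using in'(1) that E(2,3) by (auto simp: PiE_iff subset_iff)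
            ultimately show ?thesis using E(4)[of "?P (\<sigma> i g v)" "shift G g (?P v)"] by simp
          qed
          then have "\<bar>f (name i ?L v) - f (sliding_code G F (?P v))\<bar> < \<epsilon> / 2"
            using D(4)[OF in1 in2] by (simp add: dist_real_def)
          moreover have "0 \<le> 2 * B * (\<Sum>g\<in>D. \<Sum>h\<in>E. indicator (defect i h g) v)"
            using B(1) by (intro mult_nonneg_nonneg sum_nonneg) auto
          ultimately show ?thesis by linarith
        next
          case False
          then obtain g h where gh: "g \<in> D" "h \<in> E" "v \<in> defect i h g" by blast
          have "(1::real) = indicator (defect i h g) v" using gh by simp
          also have "\<dots> \<le> (\<Sum>h\<in>E. indicator (defect i h g) v)"
            using gh E(1) by (intro member_le_sum) auto
          also have "\<dots> \<le> (\<Sum>g\<in>D. \<Sum>h\<in>E. indicator (defect i h g) v)"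
            using gh D(1) by (intro member_le_sum[of g D "\<lambda>g. \<Sum>h\<in>E. indicator (defect i h g) v"]) (auto intro: sum_nonneg)
          finally have "2 * B * 1 \<le> 2 * B * (\<Sum>g\<in>D. \<Sum>h\<in>E. indicator (defect i h g) v)"
            using B(1) by (intro mult_left_mono) auto
          then show ?thesis using B(2)[OF in1] B(2)[OF in2] eps by linarith
        qed
      qed
      have card_ind: "(\<Sum>v\<in>V i. indicator (defect i h g) v) = real (card (defect i h g))" for h g
        using finite_V by (simp add: indicator_def of_bool_def sum.If_cases defect_def Int_def conj_commute)
      have "\<bar>\<Sum>v\<in>V i. f (name i ?L v) - f (sliding_code G F (?P v))\<bar>
          \<le> (\<Sum>v\<in>V i. \<epsilon> / 2 + 2 * B * (\<Sum>g\<in>D. \<Sum>h\<in>E. indicator (defect i h g) v))"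
        using * by (intro order_trans[OF sum_abs] sum_mono)
      also have "\<dots> = card (V i) * (\<epsilon> / 2) + 2 * B * (\<Sum>g\<in>D. \<Sum>h\<in>E. \<Sum>v\<in>V i. indicator (defect i h g) v)"
        by (simp add: sum.distrib sum_distrib_left[symmetric] sum.swap[of _ _ "V i"])
      also have "\<dots> = card (V i) * (\<epsilon> / 2) + 2 * B * (\<Sum>g\<in>D. \<Sum>h\<in>E. real (card (defect i h g)))"
        by (simp add: card_ind)
      finally have "\<bar>\<Sum>v\<in>V i. f (name i ?L v) - f (sliding_code G F (?P v))\<bar> / card (V i)
          \<le> (card (V i) * (\<epsilon> / 2) + 2 * B * (\<Sum>g\<in>D. \<Sum>h\<in>E. real (card (defect i h g)))) / card (V i)"
        by (rule divide_right_mono) simp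
      also have "\<dots> = \<epsilon> / 2 + 2 * B * (\<Sum>g\<in>D. \<Sum>h\<in>E. real (card (defect i h g)) / card (V i))"
        using elim(2) finite_V by (simp add: add_divide_distrib sum_divide_distrib[symmetric])
      also have "\<dots> < \<epsilon> / 2 + 2 * B * (\<epsilon> / (4 * B))"
        using elim(1) B(1) by (intro add_strict_left_mono mult_strict_left_mono) auto
      also have "\<dots> = \<epsilon>" using B(1) by simp
      finally show "\<bar>average i f ?L -
          average i (\<lambda>z. f (sliding_code G F z)) p\<bar> < \<epsilon>"
        unfolding name_average_def by (simp add: diff_divide_distrib[symmetric] sum_subtractf)
    qed
  qed
qed

text \<open>The path lifted from the auxiliary process consists of good models once
  \<open>\<integral> f \<circ> sliding_code G F d\<mu>'\<close> is close to \<open>\<integral> f d\<mu>\<close>. This comes for free from the given models: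
  averages of \<open>f\<close> over \<open>x i\<close> approximate the latter integral, and averages over the nearby lift of
  \<open>x' i\<close> approximate the former.\<close>

lemma process_connected_transfer:
  assumes proc: "metric_process G K d \<mu>"
    and step: "\<And>n x y \<epsilon>. strict_mono n \<Longrightarrow> (\<And>i. x i \<in> V (n i) \<rightarrow>\<^sub>E mspace d) \<Longrightarrow> (\<And>i. y i \<in> V (n i) \<rightarrow>\<^sub>E mspace d) \<Longrightarrow>
       models_converge G d (\<lambda>i. V (n i)) (\<lambda>i. \<sigma> (n i)) \<mu> x \<Longrightarrow>
       models_converge G d (\<lambda>i. V (n i)) (\<lambda>i. \<sigma> (n i)) \<mu> y \<Longrightarrow> 0 < \<epsilon> \<Longrightarrow>
       \<exists>(K' :: 'k measure) d' \<mu>' F x' y'. metric_process G K' d' \<mu>' \<and>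
         process_connected_model_spaces G V \<sigma> K' d' \<mu>' \<and>
         continuous_map (process_topology G d') (mtopology_of d) F \<and>
         lifts_approximately G (\<lambda>i. V (n i)) (\<lambda>i. \<sigma> (n i)) d d' \<mu>' F \<epsilon> x x' \<and>
         lifts_approximately G (\<lambda>i. V (n i)) (\<lambda>i. \<sigma> (n i)) d d' \<mu>' F \<epsilon> y y'"
  shows "process_connected_model_spaces G V \<sigma> K d \<mu>"
  unfolding process_connected_iff[OF proc] eventually_joined_def
proof (intro allI impI)
  note procD = metric_processD[OF proc countable]
  let ?Z = "process_topology G d"
  fix n x y \<Phi> and \<eta> :: real
  assume n: "strict_mono n" and x: "\<forall>i. x i \<in> V (n i) \<rightarrow>\<^sub>E mspace d" and y: "\<forall>i. y i \<in> V (n i) \<rightarrow>\<^sub>E mspace d"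
    and cx: "models_converge G d (\<lambda>i. V (n i)) (\<lambda>i. \<sigma> (n i)) \<mu> x"
    and cy: "models_converge G d (\<lambda>i. V (n i)) (\<lambda>i. \<sigma> (n i)) \<mu> y"
    and \<Phi>: "finite \<Phi>" "\<forall>f\<in>\<Phi>. continuous_map ?Z euclideanreal f" and \<eta>: "0 < \<eta>"
  interpret S: sofic_models G "\<lambda>i. V (n i)" "\<lambda>i. \<sigma> (n i)" by (rule subsequence[OF n])
  let ?V = "\<lambda>i. V (n i)" and ?s = "\<lambda>i. \<sigma> (n i)"
  have \<eta>8: "0 < \<eta> / 8" using \<eta> by simp
  have "\<forall>f\<in>\<Phi>. \<exists>\<kappa>>0. \<forall>i x x'. x \<in> ?V i \<rightarrow>\<^sub>E mspace d \<longrightarrow> x' \<in> ?V i \<rightarrow>\<^sub>E mspace d \<longrightarrow>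
    mean_dist d (?V i) x x' < \<kappa> \<longrightarrow> \<bar>S.average i f x - S.average i f x'\<bar> < \<eta> / 8"
  proof
    fix f assume "f \<in> \<Phi>"
    then have f: "continuous_map ?Z euclideanreal f" using \<Phi>(2) by blast
    show "\<exists>\<kappa>>0. \<forall>i x x'. x \<in> ?V i \<rightarrow>\<^sub>E mspace d \<longrightarrow> x' \<in> ?V i \<rightarrow>\<^sub>E mspace d \<longrightarrow>
    mean_dist d (?V i) x x' < \<kappa> \<longrightarrow> \<bar>S.average i f x - S.average i f x'\<bar> < \<eta> / 8"
      by (rule S.name_average_close[OF procD(1) f \<eta>8]) blast
  qed
  then obtain \<kappa> where \<kappa>: "\<And>f. f \<in> \<Phi> \<Longrightarrow> 0 < \<kappa> f" "\<And>f i x x'. f \<in> \<Phi> \<Longrightarrow> x \<in> ?V i \<rightarrow>\<^sub>E mspace d \<Longrightarrow>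
    x' \<in> ?V i \<rightarrow>\<^sub>E mspace d \<Longrightarrow> mean_dist d (?V i) x x' < \<kappa> f \<Longrightarrow>
    \<bar>S.average i f x - S.average i f x'\<bar> < \<eta> / 8"
    by metis
  \<comment> \<open>Moving a model by less than \<open>\<epsilon>\<close> changes the averages of \<open>\<Phi>\<close> by less than \<open>\<eta> / 8\<close>, and
    is an admissible step.\<close>
  define \<epsilon> where "\<epsilon> = Min (insert \<eta> (\<kappa> ` \<Phi>))"
  have \<epsilon>: "0 < \<epsilon>" "\<epsilon> \<le> \<eta>" "\<And>f. f \<in> \<Phi> \<Longrightarrow> \<epsilon> \<le> \<kappa> f"
    unfolding \<epsilon>_def using \<Phi>(1) \<kappa>(1) \<eta> by (auto simp: Min_gr_iff)
  obtain K' :: "'k measure" and d' \<mu>' F x' y' where proc': "metric_process G K' d' \<mu>'"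
    and conn: "process_connected_model_spaces G V \<sigma> K' d' \<mu>'"
    and F: "continuous_map (process_topology G d') (mtopology_of d) F"
    and lx: "lifts_approximately G ?V ?s d d' \<mu>' F \<epsilon> x x'"
    and ly: "lifts_approximately G ?V ?s d d' \<mu>' F \<epsilon> y y'"
    using step[OF n x[rule_format] y[rule_format] cx cy \<epsilon>(1)] by blast
  have x': "\<forall>i. x' i \<in> ?V i \<rightarrow>\<^sub>E mspace d'" and cx': "models_converge G d' ?V ?s \<mu>' x'"
    and Lx: "\<forall>\<^sub>F i in sequentially. mean_dist d (?V i) (x i) (S.lifted i F (x' i)) < \<epsilon>"
    using lx by (simp_all add: lifts_approximately_def)
  have y': "\<forall>i. y' i \<in> ?V i \<rightarrow>\<^sub>E mspace d'" and cy': "models_converge G d' ?V ?s \<mu>' y'"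
    and Ly: "\<forall>\<^sub>F i in sequentially. mean_dist d (?V i) (y i) (S.lifted i F (y' i)) < \<epsilon>"
    using ly by (simp_all add: lifts_approximately_def)
  note proc'D = metric_processD[OF proc' countable]
  let ?L = "\<lambda>i. S.lifted i F"
  let ?hat = "\<lambda>f z. f (sliding_code G F z)"
  have hat: "continuous_map (process_topology G d') euclideanreal (?hat f)" if "f \<in> \<Phi>" for f
    using continuous_map_compose[OF continuous_map_sliding_code[OF F]] \<Phi>(2) that by (auto simp: o_def)
  have lift_avg: "\<forall>\<^sub>F i in sequentially. \<forall>f\<in>\<Phi>. \<forall>p\<in>?V i \<rightarrow>\<^sub>E mspace d'.
    \<bar>S.average i f (?L i p) - S.average i (?hat f) p\<bar> < \<eta> / 8"
    using S.name_average_lift_model[OF procD(1) proc'D(1) F _ \<eta>8] \<Phi>(2)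
    by (intro eventually_ball_finite[OF \<Phi>(1)]) blast
  have ev_conv: "\<forall>\<^sub>F i in sequentially. \<forall>f\<in>\<Phi>. \<bar>S.average i f (w i) - (\<integral>z. f z \<partial>\<mu>)\<bar> < \<eta> / 8"
    if "models_converge G d ?V ?s \<mu> w" for w
    using that \<Phi>(2) \<eta>8 unfolding models_converge_def tendsto_iff dist_real_def
    by (intro eventually_ball_finite[OF \<Phi>(1)]) blast
  have ev_conv': "\<forall>\<^sub>F i in sequentially. \<forall>f\<in>\<Phi>.
      \<bar>S.average i (?hat f) (x' i) - (\<integral>z. ?hat f z \<partial>\<mu>')\<bar> < \<eta> / 8"
    using cx' hat \<eta>8 unfolding models_converge_def tendsto_iff dist_real_def
    by (intro eventually_ball_finite[OF \<Phi>(1)]) blast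
  have int_close: "\<bar>(\<integral>z. ?hat f z \<partial>\<mu>') - (\<integral>z. f z \<partial>\<mu>)\<bar> < \<eta> / 2" if f: "f \<in> \<Phi>" for f
  proof -
    have "\<forall>\<^sub>F i in sequentially. \<bar>(\<integral>z. ?hat f z \<partial>\<mu>') - (\<integral>z. f z \<partial>\<mu>)\<bar> < \<eta> / 2"
      using lift_avg ev_conv[OF cx] ev_conv' Lx
    proof eventually_elim
      case (elim i)
      have "mean_dist d (?V i) (x i) (?L i (x' i)) < \<kappa> f" using elim(4) \<epsilon>(3)[OF f] by simp
      from \<kappa>(2)[OF f x[rule_format] S.lift_model_in_PiE[OF F x'[rule_format]] this]
      have "\<bar>S.average i f (x i) - S.average i f (?L i (x' i))\<bar> < \<eta> / 8" .
      moreover have "\<bar>S.average i f (?L i (x' i)) - S.average i (?hat f) (x' i)\<bar> < \<eta> / 8"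
        using elim(1) f x' by blast
      moreover have "\<bar>S.average i f (x i) - (\<integral>z. f z \<partial>\<mu>)\<bar> < \<eta> / 8" using elim(2) f by blast
      moreover have "\<bar>S.average i (?hat f) (x' i) - (\<integral>z. ?hat f z \<partial>\<mu>')\<bar> < \<eta> / 8"
        using elim(3) f by blast
      ultimately show ?case by linarith
    qed
    then show ?thesis by simp
  qed
  obtain \<kappa>' where \<kappa>': "0 < \<kappa>'" "\<And>i p p'. p \<in> ?V i \<rightarrow>\<^sub>E mspace d' \<Longrightarrow> p' \<in> ?V i \<rightarrow>\<^sub>E mspace d' \<Longrightarrow>
    mean_dist d' (?V i) p p' < \<kappa>' \<Longrightarrow>
    (\<Sum>v\<in>?V i. mdist d (F (S.name i p v)) (F (S.name i p' v))) / card (?V i) < \<eta>"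
    by (rule S.uniform_name_distance[OF proc'D(1) F \<eta>]) blast
  define \<eta>' where "\<eta>' = min \<kappa>' (\<eta> / 8)"
  have "\<forall>\<^sub>F i in sequentially. \<exists>l p. model_path G d' (?V i) (?s i) \<mu>' (?hat ` \<Phi>) \<eta>' (x' i) (y' i) l p"
  proof -
    have "eventually_joined G d' ?V ?s \<mu>' x' y'"
      using conn n x' y' cx' cy' unfolding process_connected_iff[OF proc'] by blast
    then show ?thesis
      unfolding eventually_joined_def using hat \<Phi>(1) \<kappa>'(1) \<eta> by (simp add: \<eta>'_def)
  qed
  then show "\<forall>\<^sub>F i in sequentially. \<exists>l p. model_path G d (?V i) (?s i) \<mu> \<Phi> \<eta> (x i) (y i) l p"
    using lift_avg ev_conv[OF cx] ev_conv[OF cy] Lx Ly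
  proof eventually_elim
    case (elim i)
    then obtain l p where p0: "p 0 = x' i" "p l = y' i" and pV: "\<And>j. j \<le> l \<Longrightarrow> p j \<in> ?V i \<rightarrow>\<^sub>E mspace d'"
      and pd: "\<And>j. j < l \<Longrightarrow> mean_dist d' (?V i) (p j) (p (Suc j)) < \<eta>'"
      and pf: "\<And>j f. j \<le> l \<Longrightarrow> f \<in> \<Phi> \<Longrightarrow> \<bar>S.average i (?hat f) (p j) - (\<integral>z. ?hat f z \<partial>\<mu>')\<bar> < \<eta>'"
      unfolding model_path_def delta_path_def by auto
    \<comment> \<open>The lifted path, preceded by \<open>x i\<close> and followed by \<open>y i\<close>.\<close>
    define q where "q j = (if j = 0 then x i else if j \<le> Suc l then ?L i (p (j - 1)) else y i)" for j
    have q: "q 0 = x i" "\<And>j. j \<le> l \<Longrightarrow> q (Suc j) = ?L i (p j)" "q (Suc (Suc l)) = y i" by (auto simp: q_def)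
    have cases: "j = 0 \<or> (\<exists>k\<le>l. j = Suc k) \<or> j = Suc (Suc l)" if "j \<le> Suc (Suc l)" for j
      using that by (cases j) (auto simp: le_Suc_eq)
    have LV: "?L i (p j) \<in> ?V i \<rightarrow>\<^sub>E mspace d" if "j \<le> l" for j
      using S.lift_model_in_PiE[OF F pV[OF that]] .
    have mean_dist_sym: "mean_dist d (?V i) a b = mean_dist d (?V i) b a" for a b
      unfolding mean_dist_def by (simp add: mdist_commute)
    have "delta_path (?V i \<rightarrow>\<^sub>E mspace d) (mean_dist d (?V i)) \<eta> (x i) (y i) (Suc (Suc l)) q"
      unfolding delta_path_def
    proof (intro conjI allI impI)
      show "q 0 = x i" "q (Suc (Suc l)) = y i" using q by auto
      show "q j \<in> ?V i \<rightarrow>\<^sub>E mspace d" if "j \<le> Suc (Suc l)" for j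
        using cases[OF that] by (elim disjE exE conjE) (use q x y LV in simp_all)
      fix j assume "j < Suc (Suc l)"
      then consider "j = 0" | k where "k < l" "j = Suc k" | "j = Suc l"
        by (cases j) (auto simp: less_Suc_eq)
      then show "mean_dist d (?V i) (q j) (q (Suc j)) < \<eta>"
      proof cases
        case 1
        then show ?thesis using q(1) q(2)[of 0] p0(1) elim(5) \<epsilon>(2) by simp
      next
        case 2
        have "mean_dist d (?V i) (?L i (p k)) (?L i (p (Suc k))) =
          (\<Sum>v\<in>?V i. mdist d (F (S.name i (p k) v)) (F (S.name i (p (Suc k)) v))) / card (?V i)"
          unfolding mean_dist_def lift_model_def by simp
        also have "\<dots> < \<eta>"
          using \<kappa>'(2)[of "p k" i "p (Suc k)"] pV pd[OF 2(1)] 2(1) by (simp add: \<eta>'_def)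
        finally show ?thesis using q(2) 2 by simp
      next
        case 3
        then show ?thesis using q(3) q(2)[of l] p0(2) elim(6) \<epsilon>(2) mean_dist_sym by simp
      qed
    qed
    moreover have "\<bar>S.average i f (q j) - (\<integral>z. f z \<partial>\<mu>)\<bar> < \<eta>"
      if j: "j \<le> Suc (Suc l)" and f: "f \<in> \<Phi>" for j f
      using cases[OF j]
    proof (elim disjE exE conjE)
      assume "j = 0"
      moreover have "\<bar>S.average i f (x i) - (\<integral>z. f z \<partial>\<mu>)\<bar> < \<eta> / 8" using elim(3) f by blast
      ultimately show ?thesis using q(1) \<eta> by simp
    next
      fix k assume k: "k \<le> l" "j = Suc k"
      have "\<bar>S.average i f (?L i (p k)) - S.average i (?hat f) (p k)\<bar> < \<eta> / 8"
        using elim(2) f pV[OF k(1)] by blast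
      moreover have "\<bar>S.average i (?hat f) (p k) - (\<integral>z. ?hat f z \<partial>\<mu>')\<bar> < \<eta> / 8"
        using pf[OF k(1) f] by (simp add: \<eta>'_def)
      ultimately have "\<bar>S.average i f (?L i (p k)) - (\<integral>z. f z \<partial>\<mu>)\<bar> < \<eta>"
        using int_close[OF f] \<eta> by linarith
      then show ?thesis using q(2) k by simp
    next
      assume "j = Suc (Suc l)"
      moreover have "\<bar>S.average i f (y i) - (\<integral>z. f z \<partial>\<mu>)\<bar> < \<eta> / 8" using elim(4) f by blast
      ultimately show ?thesis using q(3) \<eta> by simp
    qed
    ultimately show ?case unfolding model_path_def by blast
  qed
qed

end

section \<open>Models over the Hilbert cube\<close>

definition hilbert_cube :: "(nat \<Rightarrow> real) set" where
  "hilbert_cube = {w. \<forall>m. 0 \<le> w m \<and> w m \<le> 1}"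

definition cube_metric :: "(nat \<Rightarrow> real) metric" where
  "cube_metric = submetric euclidean_metric hilbert_cube"

abbreviation "cube_topology \<equiv> mtopology_of cube_metric"

abbreviation "cube_space G \<equiv> process_topology G cube_metric"

lemma mspace_cube [simp]: "mspace cube_metric = hilbert_cube"
  and mdist_cube [simp]: "mdist cube_metric = dist"
  and mtopology_cube: "cube_topology = top_of_set hilbert_cube"
  by (simp_all add: cube_metric_def mtopology_of_submetric)

lemma compact_hilbert_cube: "compact hilbert_cube"
proof -
  have "compactin (product_topology (\<lambda>_::nat. euclideanreal) UNIV) (\<Pi>\<^sub>E m\<in>UNIV. {0..1})"
    by (simp add: compactin_PiE)
  moreover have "hilbert_cube = (\<Pi>\<^sub>E m\<in>UNIV. {0..1})" by (auto simp: hilbert_cube_def PiE_iff)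
  ultimately show ?thesis by (simp add: euclidean_product_topology)
qed

lemma compact_space_cube: "compact_space cube_topology"
  using compact_hilbert_cube by (simp add: mtopology_cube compact_space_subtopology)

lemma continuous_map_cube_iff:
  "continuous_map X cube_topology f \<longleftrightarrow>
     f \<in> topspace X \<rightarrow> hilbert_cube \<and> (\<forall>m. continuous_map X euclideanreal (\<lambda>x. f x m))"
  unfolding mtopology_cube continuous_map_in_subtopology euclidean_product_topology[symmetric]
    continuous_map_componentwise_UNIV by auto

text \<open>Late coordinates carry little weight in the metric of a countable product.\<close>

lemma cube_dist_le:
  assumes "0 < (\<epsilon>::real)"
  obtains J where "finite J" "\<And>x y :: nat \<Rightarrow> real. dist x y \<le> 2 * (\<Sum>c\<in>J. \<bar>x c - y c\<bar>) + \<epsilon>"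
proof -
  obtain N where N: "(1/2) ^ N < \<epsilon>" using real_arch_pow_inv[OF assms, of "1/2"] by auto
  define J where "J = (from_nat :: nat \<Rightarrow> nat) ` {..N}"
  have fin: "finite J" unfolding J_def by simp
  have "dist x y \<le> 2 * (\<Sum>c\<in>J. \<bar>x c - y c\<bar>) + \<epsilon>" for x y :: "nat \<Rightarrow> real"
  proof -
    have set_eq: "{dist (x (from_nat n)) (y (from_nat n)) |n. n \<le> N} = (\<lambda>c. \<bar>x c - y c\<bar>) ` J"
      unfolding J_def by (auto simp: dist_real_def)
    have "Max ((\<lambda>c. \<bar>x c - y c\<bar>) ` J) \<le> (\<Sum>c\<in>J. \<bar>x c - y c\<bar>)"
      using fin by (subst Max_le_iff) (auto simp: J_def intro!: member_le_sum)
    then show ?thesis using dist_fun_le_dist_first_terms[of x y N] N unfolding set_eq by linarith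
  qed
  then show thesis using that fin by blast
qed

text \<open>Record the truncated distances to a dense sequence.\<close>

lemma compact_metric_embeds_in_cube:
  assumes "compact_space (mtopology_of d)" and "mspace d \<noteq> {}"
  obtains \<iota> where "continuous_map (mtopology_of d) cube_topology \<iota>" "inj_on \<iota> (mspace d)"
proof -
  interpret Metric_space "mspace d" "mdist d" by (rule Metric_space_mspace_mdist)
  obtain e :: "nat \<Rightarrow> 'a" where e: "\<And>k. e k \<in> mspace d"
    "\<And>x r. x \<in> mspace d \<Longrightarrow> 0 < r \<Longrightarrow> \<exists>k. mdist d (e k) x < r"
    using dense_sequence_of_compact_metric[OF assms] by blast
  define \<iota> where "\<iota> x m = min 1 (mdist d (e m) x)" for x m
  show thesis
  proof
    show "continuous_map (mtopology_of d) cube_topology \<iota>"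
      unfolding continuous_map_cube_iff
    proof (intro conjI allI)
      fix m show "continuous_map (mtopology_of d) euclideanreal (\<lambda>x. \<iota> x m)"
        unfolding \<iota>_def using e(1)
        by (intro continuous_map_real_min continuous_map_mdist) (auto simp: continuous_map_const)
    qed (auto simp: \<iota>_def hilbert_cube_def)
    show "inj_on \<iota> (mspace d)"
    proof (rule inj_onI, rule ccontr)
      fix x y assume xy: "x \<in> mspace d" "y \<in> mspace d" "\<iota> x = \<iota> y" "x \<noteq> y"
      define r where "r = min 1 (mdist d x y / 2)"
      have "0 < r" using xy by (simp add: r_def)
      then obtain k where k: "mdist d (e k) x < r" using e(2) xy(1) by blast
      moreover have "\<iota> x k = \<iota> y k" using xy(3) by simp
      ultimately have "mdist d (e k) y = mdist d (e k) x" unfolding \<iota>_def r_def by (auto simp: min_def split: if_splits)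
      moreover have "mdist d x y \<le> mdist d (e k) x + mdist d (e k) y"
        using triangle'' e(1) xy by blast
      ultimately show False using k unfolding r_def by linarith
    qed
  qed
qed

definition pointwise :: "('g, 'z) monoid_scheme \<Rightarrow> ('x \<Rightarrow> 'y) \<Rightarrow> ('g \<Rightarrow> 'x) \<Rightarrow> 'g \<Rightarrow> 'y" where
  "pointwise G h z = (\<lambda>g\<in>carrier G. h (z g))"

lemma continuous_map_pointwise:
  assumes "continuous_map (mtopology_of d) (mtopology_of e) h"
  shows "continuous_map (process_topology G d) (process_topology G e) (pointwise G h)"
  unfolding process_topology_def continuous_map_componentwise
proof (intro conjI ballI)
  fix k assume k: "k \<in> carrier G"
  have "continuous_map (product_topology (\<lambda>_. mtopology_of d) (carrier G)) (mtopology_of e) (h \<circ> (\<lambda>z. z k))"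
    using continuous_map_compose[OF continuous_map_product_projection[OF k] assms] .
  then show "continuous_map (product_topology (\<lambda>_. mtopology_of d) (carrier G)) (mtopology_of e) (\<lambda>z. pointwise G h z k)"
    using k by (simp add: pointwise_def o_def)
qed (auto simp: pointwise_def)

text \<open>The image of a compact process space under an embedding of alphabets is closed, and Tietze's
  theorem applies on it.\<close>

lemma extend_along_pointwise_embedding:
  assumes comp: "compact_space (mtopology_of d)" and count: "countable (carrier G)"
    and h: "continuous_map (mtopology_of d) (mtopology_of e) h" "inj_on h (mspace d)"
    and f: "continuous_map (process_topology G d) euclideanreal f"
  obtains f' where "continuous_map (process_topology G e) euclideanreal f'"
    "\<And>z. z \<in> topspace (process_topology G d) \<Longrightarrow> f' (pointwise G h z) = f z"
proof -
  let ?Z = "process_topology G d" and ?Z' = "process_topology G e" and ?h = "pointwise G h"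
  have cont: "continuous_map ?Z ?Z' ?h" using continuous_map_pointwise[OF h(1)] .
  have metr: "metrizable_space ?Z'" using metrizable_process_topology[OF count] .
  have closed: "closed_map ?Z ?Z' ?h"
    using continuous_imp_closed_map_gen[OF compact_process_topology[OF comp] _ cont]
      metrizable_imp_Hausdorff_space[OF metr] Hausdorff_imp_kc_space by blast
  have inj: "inj_on ?h (topspace ?Z)"
  proof (rule inj_onI)
    fix z z' assume z: "z \<in> topspace ?Z" "z' \<in> topspace ?Z" "?h z = ?h z'"
    have "z g = z' g" for g
    proof (cases "g \<in> carrier G")
      case True
      then have "h (z g) = h (z' g)" using fun_cong[OF z(3), of g] by (simp add: pointwise_def)
      then show ?thesis using h(2) True z(1,2) by (auto simp: inj_on_def PiE_iff)
    next
      case False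
      then show ?thesis using z(1,2) by (auto simp: PiE_iff extensional_def)
    qed
    then show "z = z'" by blast
  qed
  have "embedding_map ?Z ?Z' ?h" using injective_closed_imp_embedding_map[OF cont closed inj] .
  then obtain k where k: "homeomorphic_maps ?Z (subtopology ?Z' (?h ` topspace ?Z)) ?h k"
    unfolding embedding_map_def homeomorphic_map_maps by blast
  have "continuous_map (subtopology ?Z' (?h ` topspace ?Z)) euclideanreal (f \<circ> k)"
    using k f by (auto simp: homeomorphic_maps_def intro: continuous_map_compose)
  moreover have "closedin ?Z' (?h ` topspace ?Z)"
    using closed closedin_topspace[of ?Z] unfolding closed_map_def by blast
  ultimately obtain f' where f': "continuous_map ?Z' euclideanreal f'"
    "\<And>w. w \<in> ?h ` topspace ?Z \<Longrightarrow> f' w = (f \<circ> k) w"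
    using Tietze_extension_realinterval[OF metrizable_imp_normal_space[OF metr], of "?h ` topspace ?Z" UNIV "f \<circ> k"]
    by auto
  moreover have "k (?h z) = z" if "z \<in> topspace ?Z" for z
    using k that by (simp add: homeomorphic_maps_def)
  ultimately show thesis using that by fastforce
qed

context sofic_models
begin

interpretation group G by (rule group)

lemma name_average_pointwise:
  "average i f (\<lambda>v\<in>V i. h (x v)) = average i (\<lambda>z. f (pointwise G h z)) x"
proof -
  have "name i (\<lambda>v\<in>V i. h (x v)) v = pointwise G h (name i x v)"
    if "v \<in> V i" for v
    using that by (auto simp: pullback_name_def pointwise_def permutes_in_image[OF perm])
  then show ?thesis unfolding name_average_def by simp
qed

text \<open>Even where \<open>\<sigma>\<^sup>g\<close> for the identity \<open>g\<close> of the group fails to be the identity map, the sum over all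
  vertices is invariant under it.\<close>

lemma average_at_identity:
  "(\<Sum>v\<in>V i. h (x v)) / card (V i) = average i (\<lambda>z. h (z \<one>)) x" for h :: "'x \<Rightarrow> real"
  using sum.permute[OF perm[OF one_closed], of "\<lambda>v. h (x v)" i]
  by (simp add: name_average_def pullback_name_def o_def)

text \<open>A model \<open>x i\<close> over the cube whose law is carried by the embedded alphabet is replaced by
  nearest points of that alphabet. The mean displacement is the average of the continuous function
  \<open>z \<mapsto> infdist (z \<one>) I\<close>, whose integral vanishes.\<close>

lemma round_models:
  fixes d :: "'x metric"
  assumes proc: "metric_process G K d \<mu>"
    and \<iota>: "continuous_map (mtopology_of d) cube_topology \<iota>" "inj_on \<iota> (mspace d)"
    and x: "\<And>i. x i \<in> V i \<rightarrow>\<^sub>E hilbert_cube"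
    and conv: "\<And>f. continuous_map (cube_space G) euclideanreal f \<Longrightarrow>
      (\<lambda>i. average i f (x i)) \<longlonglongrightarrow> (\<integral>z. f (pointwise G \<iota> z) \<partial>\<mu>)"
  obtains x' where "\<And>i. x' i \<in> V i \<rightarrow>\<^sub>E mspace d" "models_converge G d V \<sigma> \<mu> x'"
    "(\<lambda>i. mean_dist cube_metric (V i) (x i) (\<lambda>v\<in>V i. \<iota> (x' i v))) \<longlonglongrightarrow> 0"
proof -
  note procD = metric_processD[OF proc countable]
  let ?Z = "process_topology G d" and ?H = "cube_space G"
  interpret \<mu>: prob_space \<mu> by (rule procD(4))
  have ne: "mspace d \<noteq> {}" using \<mu>.not_empty procD(7) one_closed by (auto simp: PiE_eq_empty_iff)
  define I where "I = \<iota> ` mspace d"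
  have I: "I \<subseteq> hilbert_cube" "I \<noteq> {}" using continuous_map_funspace[OF \<iota>(1)] ne by (auto simp: I_def)
  have "compact I"
  proof -
    have "compactin cube_topology I"
      unfolding I_def using image_compactin[OF _ \<iota>(1), of "mspace d"] procD(1) by (simp add: compact_space_def)
    then show ?thesis by (simp add: mtopology_cube compactin_subtopology)
  qed
  have "\<exists>b\<in>mspace d. dist w (\<iota> b) = infdist w I" for w
  proof -
    have "continuous_on I (dist w)" by (intro continuous_on_dist continuous_on_const continuous_on_id)
    then obtain c where c: "c \<in> I" "\<And>b. b \<in> I \<Longrightarrow> dist w c \<le> dist w b"
      using continuous_attains_inf[OF \<open>compact I\<close> I(2), of "dist w"] by blast
    have "infdist w I \<le> dist w c" using c(1) by (rule infdist_le)
    moreover have "dist w c \<le> infdist w I" using c I(2) by (auto simp: infdist_def intro!: cINF_greatest)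
    ultimately have "dist w c = infdist w I" by simp
    moreover obtain b where "b \<in> mspace d" "c = \<iota> b" using c(1) by (auto simp: I_def)
    ultimately show ?thesis by blast
  qed
  then obtain r where r: "\<And>w. r w \<in> mspace d" "\<And>w. dist w (\<iota> (r w)) = infdist w I" by metis
  define x' where "x' i = (\<lambda>v\<in>V i. r (x i v))" for i
  have x': "x' i \<in> V i \<rightarrow>\<^sub>E mspace d" for i using r(1) by (auto simp: x'_def)
  have im: "(\<lambda>v\<in>V i. \<iota> (x' i v)) \<in> V i \<rightarrow>\<^sub>E mspace cube_metric" for i
    using x'[of i] I(1) by (auto simp: I_def)
  have lim: "(\<lambda>i. mean_dist cube_metric (V i) (x i) (\<lambda>v\<in>V i. \<iota> (x' i v))) \<longlonglongrightarrow> 0"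
  proof -
    have "mean_dist cube_metric (V i) (x i) (\<lambda>v\<in>V i. \<iota> (x' i v)) =
        average i (\<lambda>z. infdist (z \<one>) I) (x i)" for i
    proof -
      have "mean_dist cube_metric (V i) (x i) (\<lambda>v\<in>V i. \<iota> (x' i v)) = (\<Sum>v\<in>V i. infdist (x i v) I) / card (V i)"
        unfolding mean_dist_def by (simp add: x'_def r(2))
      then show ?thesis using average_at_identity[where h = "\<lambda>w. infdist w I"] by simp
    qed
    moreover have "continuous_map ?H euclideanreal (\<lambda>z. infdist (z \<one>) I)"
    proof -
      have 1: "continuous_map cube_topology euclideanreal (\<lambda>w. infdist w I)"
        unfolding mtopology_cube by (auto intro!: continuous_intros)
      have 2: "continuous_map ?H cube_topology (\<lambda>z. z \<one>)"
        unfolding process_topology_def using one_closed by (intro continuous_map_product_projection)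
      show ?thesis using continuous_map_compose[OF 2 1] by (simp add: o_def)
    qed
    moreover have "(\<integral>z. infdist (pointwise G \<iota> z \<one>) I \<partial>\<mu>) = (\<integral>z. 0 \<partial>\<mu>)"
      using procD(7) by (intro Bochner_Integration.integral_cong) (auto simp: pointwise_def I_def PiE_iff)
    ultimately show ?thesis using conv by fastforce
  qed
  have "models_converge G d V \<sigma> \<mu> x'"
    unfolding models_converge_def
  proof (intro allI impI)
    fix f assume f: "continuous_map ?Z euclideanreal f"
    obtain f' where f': "continuous_map ?H euclideanreal f'"
      "\<And>z. z \<in> topspace ?Z \<Longrightarrow> f' (pointwise G \<iota> z) = f z"
      using extend_along_pointwise_embedding[OF procD(1) countable \<iota> f] by blast
    have eq: "average i f (x' i) = average i f' (\<lambda>v\<in>V i. \<iota> (x' i v))" for i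
      unfolding name_average_pointwise
      using f'(2) name_in_PiE[OF x'] by (auto simp: name_average_def)
    have close: "(\<lambda>i. average i f' (x i) - average i f' (\<lambda>v\<in>V i. \<iota> (x' i v))) \<longlonglongrightarrow> 0"
      unfolding tendsto_iff
    proof (intro allI impI)
      fix \<epsilon> :: real assume "0 < \<epsilon>"
      then obtain \<kappa> where \<kappa>: "0 < \<kappa>" "\<And>i x x'. x \<in> V i \<rightarrow>\<^sub>E mspace cube_metric \<Longrightarrow> x' \<in> V i \<rightarrow>\<^sub>E mspace cube_metric \<Longrightarrow>
          mean_dist cube_metric (V i) x x' < \<kappa> \<Longrightarrow>
          \<bar>average i f' x - average i f' x'\<bar> < \<epsilon>"
        by (rule name_average_close[OF compact_space_cube f'(1)]) blast
      have "\<forall>\<^sub>F i in sequentially. mean_dist cube_metric (V i) (x i) (\<lambda>v\<in>V i. \<iota> (x' i v)) < \<kappa>"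
        using order_tendstoD(2)[OF lim \<kappa>(1)] .
      then show "\<forall>\<^sub>F i in sequentially. dist (average i f' (x i) -
          average i f' (\<lambda>v\<in>V i. \<iota> (x' i v))) 0 < \<epsilon>"
        by eventually_elim (use \<kappa>(2) x im in \<open>simp add: dist_real_def\<close>)
    qed
    have "(\<lambda>i. average i f' (\<lambda>v\<in>V i. \<iota> (x' i v))) \<longlonglongrightarrow> (\<integral>z. f' (pointwise G \<iota> z) \<partial>\<mu>)"
      using tendsto_diff[OF conv[OF f'(1)] close] by simp
    moreover have "(\<integral>z. f' (pointwise G \<iota> z) \<partial>\<mu>) = (\<integral>z. f z \<partial>\<mu>)"
      using f'(2) procD(7) by (intro Bochner_Integration.integral_cong) auto
    ultimately show "(\<lambda>i. average i f (x' i)) \<longlonglongrightarrow> (\<integral>z. f z \<partial>\<mu>)"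
      unfolding eq by simp
  qed
  then show thesis using that x' lim by blast
qed

text \<open>The mean distance splits into three parts: the average of the continuous function
  \<open>dist (z \<one>) (F (q z))\<close>, which approximates its integral; the displacement by \<open>\<sigma>\<^sup>g\<close> at the
  identity \<open>g\<close>, which is rare; and the change of \<open>F\<close> when \<open>q x\<close> is replaced by \<open>y\<close>.\<close>

lemma lift_of_rounded_model:
  assumes x: "\<And>i. x i \<in> V i \<rightarrow>\<^sub>E hilbert_cube" and conv: "models_converge G cube_metric V \<sigma> \<mu> x"
    and q: "continuous_map cube_topology cube_topology q"
    and F: "continuous_map (cube_space G) cube_topology F"
    and y: "\<And>i. y i \<in> V i \<rightarrow>\<^sub>E hilbert_cube"
    and qxy: "(\<lambda>i. mean_dist cube_metric (V i) (\<lambda>v\<in>V i. q (x i v)) (y i)) \<longlonglongrightarrow> 0"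
    and small: "(\<integral>z. dist (z \<one>) (F (pointwise G q z)) \<partial>\<mu>) < \<epsilon>"
  shows "\<forall>\<^sub>F i in sequentially.
    mean_dist cube_metric (V i) (x i) (lifted i F (y i)) < \<epsilon>"
proof -
  let ?H = "cube_space G"
  let ?qx = "\<lambda>i. \<lambda>v\<in>V i. q (x i v)"
  have qim: "q w \<in> hilbert_cube" if "w \<in> hilbert_cube" for w
    using continuous_map_funspace[OF q] that by auto
  have Fim: "F z \<in> hilbert_cube" if "z \<in> topspace ?H" for z
    using continuous_map_funspace[OF F] that by auto
  have qx: "?qx i \<in> V i \<rightarrow>\<^sub>E hilbert_cube" for i using x[of i] qim by auto
  define g where "g z = dist (z \<one>) (F (pointwise G q z))" for z
  have g: "continuous_map ?H euclideanreal g"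
  proof -
    have "continuous_map ?H cube_topology (\<lambda>z. z \<one>)"
      unfolding process_topology_def using one_closed by (intro continuous_map_product_projection)
    moreover have "continuous_map ?H cube_topology (F \<circ> pointwise G q)"
      using continuous_map_compose[OF continuous_map_pointwise[OF q] F] .
    ultimately have "continuous_map ?H euclideanreal (\<lambda>z. mdist cube_metric (z \<one>) ((F \<circ> pointwise G q) z))"
      by (intro continuous_map_mdist)
    then show ?thesis by (simp add: g_def[abs_def])
  qed
  obtain B where B: "0 < B" "\<And>a b. a \<in> hilbert_cube \<Longrightarrow> b \<in> hilbert_cube \<Longrightarrow> dist a b \<le> B"
  proof -
    have "bounded hilbert_cube" using compact_hilbert_cube by (rule compact_imp_bounded)
    then obtain B0 where "\<And>a b. a \<in> hilbert_cube \<Longrightarrow> b \<in> hilbert_cube \<Longrightarrow> dist a b \<le> B0"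
      using bounded_two_points by metis
    then show thesis using that[of "\<bar>B0\<bar> + 1"] by fastforce
  qed
  \<comment> \<open>Each of the three parts may use a third of the slack below \<open>\<epsilon>\<close>.\<close>
  define \<gamma> where "\<gamma> = (\<epsilon> - (\<integral>z. g z \<partial>\<mu>)) / 3"
  have \<gamma>: "0 < \<gamma>" using small by (simp add: \<gamma>_def g_def[abs_def])
  have e1: "\<forall>\<^sub>F i in sequentially. average i g (x i) < (\<integral>z. g z \<partial>\<mu>) + \<gamma>"
    using conv g \<gamma> unfolding models_converge_def by (intro order_tendstoD(2)) auto
  have e2: "\<forall>\<^sub>F i in sequentially. real (card {v \<in> V i. \<sigma> i \<one> v \<noteq> v}) / card (V i) < \<gamma> / B"
    using \<gamma> B(1) by (intro order_tendstoD(2)[OF identity_defect_tendsto_0]) auto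
  obtain \<kappa> where \<kappa>: "0 < \<kappa>" "\<And>i x x'. x \<in> V i \<rightarrow>\<^sub>E mspace cube_metric \<Longrightarrow> x' \<in> V i \<rightarrow>\<^sub>E mspace cube_metric \<Longrightarrow>
    mean_dist cube_metric (V i) x x' < \<kappa> \<Longrightarrow>
    (\<Sum>v\<in>V i. mdist cube_metric (F (name i x v)) (F (name i x' v))) / card (V i) < \<gamma>"
    by (rule uniform_name_distance[OF compact_space_cube F \<gamma>]) blast
  have e3: "\<forall>\<^sub>F i in sequentially. mean_dist cube_metric (V i) (?qx i) (y i) < \<kappa>"
    using order_tendstoD(2)[OF qxy \<kappa>(1)] .
  show ?thesis
    using e1 e2 e3
  proof eventually_elim
    case (elim i)
    let ?P = "name i"
    have pq: "?P (?qx i) v = pointwise G q (?P (x i) v)" if "v \<in> V i" for v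
      using that by (auto simp: pullback_name_def pointwise_def permutes_in_image[OF perm])
    have "dist (x i v) (F (?P (y i) v)) \<le> g (?P (x i) v) + B * indicator {v \<in> V i. \<sigma> i \<one> v \<noteq> v} v
        + dist (F (?P (?qx i) v)) (F (?P (y i) v))" if v: "v \<in> V i" for v
    proof -
      have sv: "\<sigma> i \<one> v \<in> V i" using v by (simp add: permutes_in_image[OF perm])
      have "dist (x i v) (x i (\<sigma> i \<one> v)) \<le> B * indicator {v \<in> V i. \<sigma> i \<one> v \<noteq> v} v"
        using B(2)[of "x i v" "x i (\<sigma> i \<one> v)"] x[of i] v sv by (cases "\<sigma> i \<one> v = v") auto
      moreover have "g (?P (x i) v) = dist (x i (\<sigma> i \<one> v)) (F (?P (?qx i) v))"
        unfolding g_def pq[OF v] by (simp add: pullback_name_def)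
      moreover have "dist (x i v) (F (?P (y i) v)) \<le> dist (x i v) (x i (\<sigma> i \<one> v))
          + dist (x i (\<sigma> i \<one> v)) (F (?P (?qx i) v)) + dist (F (?P (?qx i) v)) (F (?P (y i) v))"
        by (smt (verit) dist_triangle)
      ultimately show ?thesis by linarith
    qed
    then have "(\<Sum>v\<in>V i. dist (x i v) (F (?P (y i) v))) \<le> (\<Sum>v\<in>V i. g (?P (x i) v)
        + B * indicator {v \<in> V i. \<sigma> i \<one> v \<noteq> v} v + dist (F (?P (?qx i) v)) (F (?P (y i) v)))"
      by (rule sum_mono)
    also have "\<dots> = (\<Sum>v\<in>V i. g (?P (x i) v)) + B * (\<Sum>v\<in>V i. indicator {v \<in> V i. \<sigma> i \<one> v \<noteq> v} v)
        + (\<Sum>v\<in>V i. dist (F (?P (?qx i) v)) (F (?P (y i) v)))"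
      by (simp add: sum.distrib sum_distrib_left)
    also have "(\<Sum>v\<in>V i. indicator {v \<in> V i. \<sigma> i \<one> v \<noteq> v} v) = real (card {v \<in> V i. \<sigma> i \<one> v \<noteq> v})"
      using finite_V by (simp add: indicator_def of_bool_def sum.If_cases Int_def conj_commute)
    finally have "(\<Sum>v\<in>V i. dist (x i v) (F (?P (y i) v))) / card (V i) \<le>
        ((\<Sum>v\<in>V i. g (?P (x i) v)) + B * real (card {v \<in> V i. \<sigma> i \<one> v \<noteq> v})
        + (\<Sum>v\<in>V i. dist (F (?P (?qx i) v)) (F (?P (y i) v)))) / card (V i)"
      by (rule divide_right_mono) simp
    also have "\<dots> = average i g (x i) + B * (real (card {v \<in> V i. \<sigma> i \<one> v \<noteq> v}) / card (V i))
        + (\<Sum>v\<in>V i. dist (F (?P (?qx i) v)) (F (?P (y i) v))) / card (V i)"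
      by (simp add: add_divide_distrib name_average_def)
    also have "B * (real (card {v \<in> V i. \<sigma> i \<one> v \<noteq> v}) / card (V i)) < \<gamma>"
      using elim(2) B(1) by (simp add: field_simps)
    also have "(\<Sum>v\<in>V i. dist (F (?P (?qx i) v)) (F (?P (y i) v))) / card (V i) < \<gamma>"
      using \<kappa>(2)[OF _ _ elim(3)] qx y by simp
    finally have "(\<Sum>v\<in>V i. dist (x i v) (F (?P (y i) v))) / card (V i) <
        average i g (x i) + \<gamma> + \<gamma>" by simp
    moreover have "3 * \<gamma> = \<epsilon> - (\<integral>z. g z \<partial>\<mu>)" by (simp add: \<gamma>_def)
    ultimately have "(\<Sum>v\<in>V i. dist (x i v) (F (?P (y i) v))) / card (V i) < \<epsilon>"
      using elim(1) by linarith
    then show ?case by (simp add: mean_dist_def lift_model_def)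
  qed
qed

text \<open>Here \<open>\<iota>\<close> embeds the alphabet of an auxiliary process, \<open>q\<close> maps the given process onto the
  embedded one, and \<open>F\<close> reconstructs the symbol at the identity up to a mean error \<open>\<epsilon>\<close>.\<close>

lemma cube_process_connected:
  assumes proc: "metric_process G K cube_metric \<mu>"
    and approx: "\<And>\<epsilon>. 0 < \<epsilon> \<Longrightarrow> \<exists>(K' :: 'k measure) d' \<mu>' \<iota> q F. metric_process G K' d' \<mu>' \<and>
      process_connected_model_spaces G V \<sigma> K' d' \<mu>' \<and>
      continuous_map (mtopology_of d') cube_topology \<iota> \<and> inj_on \<iota> (mspace d') \<and>
      continuous_map cube_topology cube_topology q \<and>
      (\<forall>f. continuous_map (cube_space G) euclideanreal f \<longrightarrow>
         (\<integral>z. f (pointwise G q z) \<partial>\<mu>) = (\<integral>z. f (pointwise G \<iota> z) \<partial>\<mu>')) \<and>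
      continuous_map (cube_space G) cube_topology F \<and>
      (\<integral>z. dist (z \<one>) (F (pointwise G q z)) \<partial>\<mu>) < \<epsilon>"
  shows "process_connected_model_spaces G V \<sigma> K cube_metric \<mu>"
proof (rule process_connected_transfer[OF proc, where 'k = 'k])
  fix n :: "nat \<Rightarrow> nat" and x y :: "nat \<Rightarrow> 'v \<Rightarrow> nat \<Rightarrow> real" and \<epsilon> :: real
  let ?V = "\<lambda>i. V (n i)" and ?s = "\<lambda>i. \<sigma> (n i)" and ?H = "cube_space G"
  assume n: "strict_mono n" and x: "\<And>i. x i \<in> ?V i \<rightarrow>\<^sub>E mspace cube_metric" and y: "\<And>i. y i \<in> ?V i \<rightarrow>\<^sub>E mspace cube_metric"
    and cx: "models_converge G cube_metric ?V ?s \<mu> x" and cy: "models_converge G cube_metric ?V ?s \<mu> y"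
    and \<epsilon>: "0 < \<epsilon>"
  interpret S: sofic_models G ?V ?s by (rule subsequence[OF n])
  obtain K' :: "'k measure" and d' \<mu>' \<iota> q F where proc': "metric_process G K' d' \<mu>'"
    and conn: "process_connected_model_spaces G V \<sigma> K' d' \<mu>'"
    and \<iota>: "continuous_map (mtopology_of d') cube_topology \<iota>" "inj_on \<iota> (mspace d')"
    and q: "continuous_map cube_topology cube_topology q"
    and int: "\<And>f. continuous_map ?H euclideanreal f \<Longrightarrow>
         (\<integral>z. f (pointwise G q z) \<partial>\<mu>) = (\<integral>z. f (pointwise G \<iota> z) \<partial>\<mu>')"
    and F: "continuous_map ?H cube_topology F"
    and small: "(\<integral>z. dist (z \<one>) (F (pointwise G q z)) \<partial>\<mu>) < \<epsilon>"
    using approx[OF \<epsilon>] by blast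
  have round: "\<exists>w'. lifts_approximately G ?V ?s cube_metric d' \<mu>' (F \<circ> pointwise G \<iota>) \<epsilon> w w'"
    if w: "\<And>i. w i \<in> ?V i \<rightarrow>\<^sub>E mspace cube_metric" and cw: "models_converge G cube_metric ?V ?s \<mu> w" for w
  proof -
    have qw: "(\<lambda>v\<in>?V i. q (w i v)) \<in> ?V i \<rightarrow>\<^sub>E hilbert_cube" for i
      using w[of i] continuous_map_funspace[OF q] by auto
    have "(\<lambda>i. S.average i f (\<lambda>v\<in>?V i. q (w i v))) \<longlonglongrightarrow> (\<integral>z. f (pointwise G \<iota> z) \<partial>\<mu>')"
      if f: "continuous_map ?H euclideanreal f" for f
    proof -
      have "continuous_map ?H euclideanreal (\<lambda>z. f (pointwise G q z))"
        using continuous_map_compose[OF continuous_map_pointwise[OF q] f] by (simp add: o_def)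
      from cw[unfolded models_converge_def, rule_format, OF this]
      show ?thesis unfolding S.name_average_pointwise int[OF f] .
    qed
    then obtain w' where w': "\<And>i. w' i \<in> ?V i \<rightarrow>\<^sub>E mspace d'" "models_converge G d' ?V ?s \<mu>' w'"
      "(\<lambda>i. mean_dist cube_metric (?V i) (\<lambda>v\<in>?V i. q (w i v)) (\<lambda>v\<in>?V i. \<iota> (w' i v))) \<longlonglongrightarrow> 0"
      using S.round_models[OF proc' \<iota> qw] by blast
    have "(\<lambda>v\<in>?V i. \<iota> (w' i v)) \<in> ?V i \<rightarrow>\<^sub>E hilbert_cube" for i
      using w'(1)[of i] continuous_map_funspace[OF \<iota>(1)] by auto
    then have "\<forall>\<^sub>F i in sequentially. mean_dist cube_metric (?V i) (w i)
        (S.lifted i F (\<lambda>v\<in>?V i. \<iota> (w' i v))) < \<epsilon>"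
      using S.lift_of_rounded_model[OF _ cw q F _ w'(3) small] w by simp
    moreover have "S.lifted i F (\<lambda>v\<in>?V i. \<iota> (w' i v)) =
        S.lifted i (F \<circ> pointwise G \<iota>) (w' i)" for i
    proof -
      have "S.name i (\<lambda>v\<in>?V i. \<iota> (w' i v)) v = pointwise G \<iota> (S.name i (w' i) v)"
        if "v \<in> ?V i" for v
        using that by (auto simp: pullback_name_def pointwise_def permutes_in_image[OF perm])
      then show ?thesis by (auto simp: lift_model_def)
    qed
    ultimately show ?thesis using w' by (auto simp: lifts_approximately_def)
  qed
  have F': "continuous_map (process_topology G d') cube_topology (F \<circ> pointwise G \<iota>)"
    using continuous_map_compose[OF continuous_map_pointwise[OF \<iota>(1)] F] .
  show "\<exists>(K' :: 'k measure) d' \<mu>' F x' y'. metric_process G K' d' \<mu>' \<and>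
         process_connected_model_spaces G V \<sigma> K' d' \<mu>' \<and>
         continuous_map (process_topology G d') cube_topology F \<and>
         lifts_approximately G (\<lambda>i. V (n i)) (\<lambda>i. \<sigma> (n i)) cube_metric d' \<mu>' F \<epsilon> x x' \<and>
         lifts_approximately G (\<lambda>i. V (n i)) (\<lambda>i. \<sigma> (n i)) cube_metric d' \<mu>' F \<epsilon> y y'"
  proof -
    obtain x' y' where lifts: "lifts_approximately G ?V ?s cube_metric d' \<mu>' (F \<circ> pointwise G \<iota>) \<epsilon> x x'"
      "lifts_approximately G ?V ?s cube_metric d' \<mu>' (F \<circ> pointwise G \<iota>) \<epsilon> y y'"
      using round[OF x cx] round[OF y cy] by (elim exE)
    show ?thesis
      by (rule exI[of _ K'], rule exI[of _ d'], rule exI[of _ \<mu>'], rule exI[of _ "F \<circ> pointwise G \<iota>"],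
          rule exI[of _ x'], rule exI[of _ y'], intro conjI proc' conn F' lifts)
  qed
qed

end

section \<open>Almost everywhere inverses of generating maps\<close>

text \<open>At scale \<open>1 / (n + 1)\<close> cover the standard Borel space by balls around a dense sequence.
  Each ball is almost everywhere the preimage of a measurable set, so \<open>\<Phi> x\<close> selects a centre
  within \<open>1 / (n + 1)\<close> of \<open>x\<close>. The inverse is the limit of the selected centres.\<close>

lemma ae_left_inverse:
  assumes std: "standard_borel N" and ne: "space N \<noteq> {}" and \<Phi>: "\<Phi> \<in> measurable N Z"
    and gen: "\<And>A. A \<in> sets N \<Longrightarrow> \<exists>B\<in>sets Z. AE x in N. x \<in> A \<longleftrightarrow> \<Phi> x \<in> B"
  obtains \<Psi> where "\<Psi> \<in> measurable Z N" "AE x in N. \<Psi> (\<Phi> x) = x"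
proof -
  obtain X where X: "completely_metrizable_space X" "second_countable X" and sN: "sets N = sets (borel_on X)"
    using std unfolding standard_borel_def by blast
  have spN: "space N = topspace X" using sets_eq_imp_space_eq[OF sN] by simp
  obtain M m where M: "Metric_space M m" "Metric_space.mcomplete M m" and Xm: "X = Metric_space.mtopology M m"
    using X(1) unfolding completely_metrizable_space_def by auto
  interpret Metric_space M m by (rule M(1))
  have tX: "topspace X = M" using Xm by simp
  obtain C where C: "countable C" "C \<subseteq> M" "X closure_of C = M"
    using second_countable_imp_separable_space[OF X(2)] tX unfolding separable_space_def by auto
  have "C \<noteq> {}" using C(3) ne spN tX by auto
  define e where "e = from_nat_into C"
  have rC: "range e = C" unfolding e_def using C(1) \<open>C \<noteq> {}\<close> by (rule range_from_nat_into[rotated])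
  have e: "e k \<in> M" for k using rC C(2) by blast
  have dense: "\<exists>k. m (e k) x < r" if x: "x \<in> M" and r: "0 < r" for x r
  proof -
    have "x \<in> mtopology closure_of C" using C(3) x Xm by simp
    then obtain y where "y \<in> C" "y \<in> mball x r" using r unfolding metric_closure_of by blast
    then show ?thesis using rC commute by (metis in_mball imageE)
  qed
  define isB where "isB n k B \<longleftrightarrow> B \<in> sets Z \<and> (AE x in N. x \<in> mball (e k) (1 / Suc n) \<longleftrightarrow> \<Phi> x \<in> B)" for n k B
  have "\<exists>B. isB n k B" for n k
  proof -
    have "mball (e k) (1 / Suc n) \<in> sets N" using Xm sN by (auto intro: openin_in_sets_borel_on)
    from gen[OF this] show ?thesis unfolding isB_def by blast
  qed
  then obtain B where "\<And>n k. isB n k (B n k)" by metis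
  then have B: "\<And>n k. B n k \<in> sets Z"
    "\<And>n k. AE x in N. x \<in> mball (e k) (1 / Suc n) \<longleftrightarrow> \<Phi> x \<in> B n k" unfolding isB_def by blast+
  define \<kappa> where "\<kappa> n z = (LEAST k. z \<in> B n k)" for n z
  have \<kappa>_meas: "\<kappa> n \<in> measurable Z (count_space UNIV)" for n
    unfolding \<kappa>_def[abs_def] using B(1) by measurable
  have meas1: "(\<lambda>z. m (e (\<kappa> n z)) a) \<in> borel_measurable Z" for n a
    by (rule measurable_compose_countable[OF _ \<kappa>_meas]) simp
  have meas2: "(\<lambda>z. m (e (\<kappa> n z)) (e (\<kappa> n' z))) \<in> borel_measurable Z" for n n'
    by (rule measurable_compose_countable[OF meas1 \<kappa>_meas])
  \<comment> \<open>The set where the selected centres form a Cauchy sequence; elsewhere \<open>\<Psi>\<close> takes the dummy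
    value \<open>e 0\<close>.\<close>
  define G0 where "G0 = {z \<in> space Z. \<forall>p. \<exists>N0. \<forall>a. \<forall>b. N0 \<le> a \<and> N0 \<le> b \<longrightarrow>
      m (e (\<kappa> a z)) (e (\<kappa> b z)) < 1 / real (Suc p)}"
  have G0: "G0 \<in> sets Z" unfolding G0_def using meas2 by measurable
  have Cauchy: "MCauchy (\<lambda>n. e (\<kappa> n z))" if z: "z \<in> G0" for z
    unfolding MCauchy_def
  proof (intro conjI allI impI)
    fix \<epsilon> :: real assume "0 < \<epsilon>"
    then obtain p :: nat where p: "1 / Suc p < \<epsilon>" using nat_approx_posE by blast
    obtain N0 where "\<And>a b. N0 \<le> a \<Longrightarrow> N0 \<le> b \<Longrightarrow> m (e (\<kappa> a z)) (e (\<kappa> b z)) < 1 / real (Suc p)"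
      using z unfolding G0_def by blast
    then show "\<exists>N. \<forall>n n'. N \<le> n \<longrightarrow> N \<le> n' \<longrightarrow> m (e (\<kappa> n z)) (e (\<kappa> n' z)) < \<epsilon>"
      using p by (meson less_trans)
  qed (use e in auto)
  define \<Psi> where "\<Psi> z = (if z \<in> G0 then SOME l. limitin mtopology (\<lambda>n. e (\<kappa> n z)) l sequentially else e 0)" for z
  have lim: "limitin mtopology (\<lambda>n. e (\<kappa> n z)) (\<Psi> z) sequentially" if "z \<in> G0" for z
  proof -
    have "\<exists>l. limitin mtopology (\<lambda>n. e (\<kappa> n z)) l sequentially"
      using M(2) Cauchy[OF that] by (simp add: mcomplete_def)
    from someI_ex[OF this] show ?thesis unfolding \<Psi>_def using that by simp
  qed
  have \<Psi>M: "\<Psi> z \<in> M" for z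
    using lim[of z] e by (cases "z \<in> G0") (auto simp: \<Psi>_def dest: limitin_mspace)
  have meas3: "(\<lambda>z. m (\<Psi> z) (e j)) \<in> borel_measurable Z" for j
  proof (rule borel_measurable_LIMSEQ_real)
    show "(\<lambda>z. if z \<in> G0 then m (e (\<kappa> n z)) (e j) else m (e 0) (e j)) \<in> borel_measurable Z" for n
      using meas1 G0 by measurable
    fix z assume "z \<in> space Z"
    show "(\<lambda>n. if z \<in> G0 then m (e (\<kappa> n z)) (e j) else m (e 0) (e j)) \<longlonglongrightarrow> m (\<Psi> z) (e j)"
    proof (cases "z \<in> G0")
      case True
      have to0: "(\<lambda>n. m (e (\<kappa> n z)) (\<Psi> z)) \<longlonglongrightarrow> 0"
        using lim[OF True] by (simp add: limitin_metric_dist_null)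
      have "norm (m (e (\<kappa> n z)) (e j) - m (\<Psi> z) (e j)) \<le> m (e (\<kappa> n z)) (\<Psi> z)" for n
        using triangle[of "e (\<kappa> n z)" "\<Psi> z" "e j"] triangle[of "\<Psi> z" "e (\<kappa> n z)" "e j"] e \<Psi>M
          commute[of "\<Psi> z" "e (\<kappa> n z)"]
        by (auto simp: abs_le_iff)
      then have "(\<lambda>n. m (e (\<kappa> n z)) (e j) - m (\<Psi> z) (e j)) \<longlonglongrightarrow> 0"
        by (intro Lim_null_comparison[OF _ to0] always_eventually allI)
      then show ?thesis using True by (simp add: LIM_zero_iff)
    qed (simp add: \<Psi>_def)
  qed
  have "\<Psi> \<in> measurable Z (borel_on X)"
  proof (rule measurable_borel_onI)
    show "\<Psi> \<in> space Z \<rightarrow> topspace X" using \<Psi>M tX by auto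
    fix U assume U: "openin X U"
    define Q where "Q = {(j, p). mball (e j) (1 / real (Suc p)) \<subseteq> U}"
    have "\<Psi> -` U \<inter> space Z = (\<Union>(j, p)\<in>Q. {z \<in> space Z. m (\<Psi> z) (e j) < 1 / real (Suc p)})"
    proof (intro equalityI subsetI)
      fix z assume z: "z \<in> \<Psi> -` U \<inter> space Z"
      then obtain r where r: "0 < r" "mball (\<Psi> z) r \<subseteq> U" using U Xm by (auto simp: openin_mtopology)
      obtain p :: nat where p: "1 / Suc p < r / 2" using r nat_approx_posE[of "r / 2"] by auto
      obtain j where j: "m (e j) (\<Psi> z) < 1 / Suc p" using dense[OF \<Psi>M, of "1 / Suc p"] by auto
      have "mball (e j) (1 / Suc p) \<subseteq> mball (\<Psi> z) r"
      proof
        fix y assume "y \<in> mball (e j) (1 / Suc p)"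
        then show "y \<in> mball (\<Psi> z) r"
          using p j triangle[of "\<Psi> z" "e j" y] commute[of "\<Psi> z" "e j"] \<Psi>M e by auto
      qed
      then show "z \<in> (\<Union>(j, p)\<in>Q. {z \<in> space Z. m (\<Psi> z) (e j) < 1 / real (Suc p)})"
        using r(2) j z by (auto simp: Q_def commute intro!: bexI[of _ "(j, p)"])
    next
      fix z assume "z \<in> (\<Union>(j, p)\<in>Q. {z \<in> space Z. m (\<Psi> z) (e j) < 1 / real (Suc p)})"
      then show "z \<in> \<Psi> -` U \<inter> space Z" using \<Psi>M e by (force simp: Q_def commute)
    qed
    also have "\<dots> \<in> sets Z"
      using meas3 by (intro sets.countable_UN') auto
    finally show "\<Psi> -` U \<inter> space Z \<in> sets Z" .
  qed
  then have "\<Psi> \<in> measurable Z N" using measurable_cong_sets[OF refl sN] by blast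
  moreover have "AE x in N. \<forall>n k. x \<in> mball (e k) (1 / Suc n) \<longleftrightarrow> \<Phi> x \<in> B n k"
    using B(2) by (simp add: AE_all_countable)
  then have "AE x in N. \<Psi> (\<Phi> x) = x"
    using AE_space
  proof eventually_elim
    case (elim x)
    have xM: "x \<in> M" using elim(2) spN tX by simp
    have small: "m (e (\<kappa> n (\<Phi> x))) x < 1 / Suc n" for n
    proof -
      obtain k where "m (e k) x < 1 / Suc n" using dense[OF xM, of "1 / Suc n"] by auto
      then have "\<Phi> x \<in> B n k" using elim(1) e xM by auto
      then have "\<Phi> x \<in> B n (\<kappa> n (\<Phi> x))" unfolding \<kappa>_def by (rule LeastI)
      then show ?thesis using elim(1) by auto
    qed
    have limx: "limitin mtopology (\<lambda>n. e (\<kappa> n (\<Phi> x))) x sequentially"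
    proof -
      have "(\<lambda>n. m (e (\<kappa> n (\<Phi> x))) x) \<longlonglongrightarrow> 0"
      proof (rule Lim_null_comparison)
        show "(\<lambda>n. 1 / real (Suc n)) \<longlonglongrightarrow> 0"
          using LIMSEQ_inverse_real_of_nat by (simp add: inverse_eq_divide)
        show "\<forall>\<^sub>F n in sequentially. norm (m (e (\<kappa> n (\<Phi> x))) x) \<le> 1 / real (Suc n)"
          by (rule always_eventually) (use small in \<open>simp add: less_imp_le\<close>)
      qed
      then show ?thesis using xM e by (simp add: limitin_metric_dist_null)
    qed
    have "\<Phi> x \<in> G0"
      unfolding G0_def
    proof (intro CollectI conjI allI)
      show "\<Phi> x \<in> space Z" using \<Phi> elim(2) by (rule measurable_space)
      fix p
      have "MCauchy (\<lambda>n. e (\<kappa> n (\<Phi> x)))" using limx e by (intro convergent_imp_MCauchy) auto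
      then have "\<exists>N0. \<forall>a b. N0 \<le> a \<longrightarrow> N0 \<le> b \<longrightarrow> m (e (\<kappa> a (\<Phi> x))) (e (\<kappa> b (\<Phi> x))) < 1 / real (Suc p)"
        unfolding MCauchy_def by simp
      then show "\<exists>N0. \<forall>a b. N0 \<le> a \<and> N0 \<le> b \<longrightarrow> m (e (\<kappa> a (\<Phi> x))) (e (\<kappa> b (\<Phi> x))) < 1 / real (Suc p)"
        by blast
    qed
    then show ?case using limitin_metric_unique[OF lim limx] by simp
  qed
  ultimately show thesis using that by blast
qed

section \<open>Coding the inverse limit over the Hilbert cube\<close>

definition cube_algebra :: "(nat \<Rightarrow> real) measure" where
  "cube_algebra = borel_on cube_topology"

lemma space_cube_algebra [simp]: "space cube_algebra = hilbert_cube"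
  by (simp add: cube_algebra_def)

lemma standard_borel_cube_algebra: "standard_borel cube_algebra"
  unfolding standard_borel_def
proof (intro exI conjI)
  have "closed hilbert_cube" using compact_hilbert_cube by (rule compact_imp_closed)
  then show "completely_metrizable_space cube_topology"
    unfolding mtopology_cube by (intro completely_metrizable_space_closedin completely_metrizable_space_euclidean) simp
  show "second_countable cube_topology"
  proof -
    obtain \<B> :: "(nat \<Rightarrow> real) set set" where \<B>: "countable \<B>" "topological_basis \<B>"
      using ex_countable_basis by blast
    have "second_countable (euclidean :: (nat \<Rightarrow> real) topology)"
      unfolding second_countable_def
    proof (intro exI[of _ \<B>] conjI ballI allI impI)
      show "countable \<B>" by fact
      show "openin euclidean B" if "B \<in> \<B>" for B
        using topological_basis_open[OF \<B>(2) that] by simp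
      fix U and w :: "nat \<Rightarrow> real" assume "openin euclidean U \<and> w \<in> U"
      then have "open U" "w \<in> U" by simp_all
      then show "\<exists>B\<in>\<B>. w \<in> B \<and> B \<subseteq> U" by (rule topological_basisE[OF \<B>(2)]) blast
    qed
    then show ?thesis unfolding mtopology_cube by (rule second_countable_subtopology)
  qed
  show "sets cube_algebra = sets (borel_on cube_topology)" by (simp add: cube_algebra_def)
qed

lemma measurable_cube_algebraI:
  assumes "\<And>x. x \<in> space M \<Longrightarrow> f x \<in> hilbert_cube" and "\<And>m. (\<lambda>x. f x m) \<in> borel_measurable M"
  shows "f \<in> measurable M cube_algebra"
  unfolding cube_algebra_def
proof (rule measurable_borel_onI)
  show "f \<in> space M \<rightarrow> topspace cube_topology" using assms(1) by auto
  fix U assume "openin cube_topology U"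
  then obtain W where W: "open W" "U = hilbert_cube \<inter> W" by (auto simp: mtopology_cube openin_open)
  have "f \<in> borel_measurable M" using assms(2) by (rule measurable_coordinatewise_then_product)
  then have "f -` W \<inter> space M \<in> sets M" using W(1) by (intro measurable_sets) auto
  moreover have "f -` U \<inter> space M = f -` W \<inter> space M" using assms(1) W(2) by auto
  ultimately show "f -` U \<inter> space M \<in> sets M" by simp
qed

lemma measurable_coordinate_cube_algebra: "(\<lambda>w. w m) \<in> borel_measurable cube_algebra"
proof (rule continuous_map_borel_measurable)
  have "continuous_map cube_topology cube_topology (\<lambda>w. w)" by (rule continuous_map_id[unfolded id_def])
  then show "continuous_map cube_topology euclideanreal (\<lambda>w. w m)"
    unfolding continuous_map_cube_iff by blast
qed (simp add: cube_algebra_def)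

text \<open>The image of a compact alphabet is closed, and the inverse is continuous on it; off the image
  any constant serves.\<close>

lemma measurable_left_inverse_of_embedding:
  assumes comp: "compact_space (mtopology_of d)" and ne: "mspace d \<noteq> {}"
    and K: "sets K = sets (borel_on (mtopology_of d))"
    and \<iota>: "continuous_map (mtopology_of d) cube_topology \<iota>" "inj_on \<iota> (mspace d)"
  obtains r where "r \<in> measurable cube_algebra K" "\<And>a. a \<in> mspace d \<Longrightarrow> r (\<iota> a) = a"
proof -
  let ?D = "mtopology_of d" and ?H = "cube_topology"
  obtain a0 where a0: "a0 \<in> mspace d" using ne by blast
  define I where "I = \<iota> ` mspace d"
  define r where "r w = (if w \<in> I then inv_into (mspace d) \<iota> w else a0)" for w
  have Haus: "Hausdorff_space ?H"
    using Metric_space.Hausdorff_space_mtopology[OF Metric_space_mspace_mdist, of cube_metric]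
    by (simp add: mtopology_of_def)
  have closed: "closed_map ?D ?H \<iota>"
    using continuous_imp_closed_map_gen[OF comp _ \<iota>(1)] Hausdorff_imp_kc_space[OF Haus] by blast
  have r\<iota>: "r (\<iota> a) = a" if "a \<in> mspace d" for a
    using that \<iota>(2) by (simp add: r_def I_def)
  have I: "I \<subseteq> hilbert_cube" using continuous_map_funspace[OF \<iota>(1)] by (auto simp: I_def)
  have "closedin ?H I" using closed closedin_topspace[of ?D] unfolding closed_map_def I_def by (metis topspace_mtopology_of)
  then have Is: "I \<in> sets cube_algebra" unfolding cube_algebra_def by (rule closedin_in_sets_borel_on)
  have "r \<in> measurable cube_algebra (borel_on ?D)"
  proof (rule measurable_borel_onI)
    show "r \<in> space cube_algebra \<rightarrow> topspace ?D"
      using a0 r\<iota> by (auto simp: r_def I_def)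
    fix U assume U: "openin ?D U"
    then have Ud: "U \<subseteq> mspace d" using openin_subset by fastforce
    have "closedin ?D (mspace d - U)" using U by (metis closedin_def openin_subset double_diff topspace_mtopology_of Diff_subset order_refl)
    then have "closedin ?H (\<iota> ` (mspace d - U))" using closed unfolding closed_map_def by blast
    then have "\<iota> ` (mspace d - U) \<in> sets cube_algebra" unfolding cube_algebra_def by (rule closedin_in_sets_borel_on)
    then have *: "I - \<iota> ` (mspace d - U) \<in> sets cube_algebra" using Is by blast
    have "r -` U \<inter> space cube_algebra = (I - \<iota> ` (mspace d - U)) \<union> (if a0 \<in> U then space cube_algebra - I else {})"
    proof (rule Set.set_eqI)
      fix w
      show "w \<in> r -` U \<inter> space cube_algebra \<longleftrightarrow>
        w \<in> (I - \<iota> ` (mspace d - U)) \<union> (if a0 \<in> U then space cube_algebra - I else {})"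
      proof (cases "w \<in> I")
        case True
        then obtain a where a: "a \<in> mspace d" "w = \<iota> a" by (auto simp: I_def)
        have "w \<in> \<iota> ` (mspace d - U) \<longleftrightarrow> a \<notin> U" using a \<iota>(2) by (auto simp: inj_on_def)
        then show ?thesis using True a r\<iota> I by auto
      next
        case False
        then show ?thesis by (auto simp: r_def)
      qed
    qed
    also have "\<dots> \<in> sets cube_algebra" using sets.Un[OF * sets.compl_sets[OF Is]] * by (simp del: space_cube_algebra)
    finally show "r -` U \<inter> space cube_algebra \<in> sets cube_algebra" .
  qed
  then have "r \<in> measurable cube_algebra K" using measurable_cong_sets[OF refl K] by blast
  then show thesis using that r\<iota> by blast
qed

lemma measurable_pointwise:
  assumes "h \<in> measurable K L"
  shows "pointwise G h \<in> measurable (PiM (carrier G) (\<lambda>_. K)) (PiM (carrier G) (\<lambda>_. L))"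
  unfolding pointwise_def[abs_def]
  using assms by (intro measurable_restrict) (auto intro: measurable_compose[OF measurable_component_singleton])

text \<open>A system \<open>N\<close> over levels \<open>M k\<close> that generate it; \<open>\<alpha> k\<close> and \<open>\<beta> k\<close> identify level \<open>k\<close> with a
  process of law \<open>\<nu> k\<close>, and \<open>\<iota> k\<close>, with left inverse \<open>r k\<close>, embeds its alphabet in the cube.\<close>

locale process_tower = sofic_models G V \<sigma>
  for G :: "('g, 'z) monoid_scheme" (structure) and V :: "nat \<Rightarrow> 'v set" and \<sigma> +
  fixes N :: "'b measure" and S :: "'g \<Rightarrow> 'b \<Rightarrow> 'b"
    and M :: "nat \<Rightarrow> 'a measure" and T :: "nat \<Rightarrow> 'g \<Rightarrow> 'a \<Rightarrow> 'a" and \<pi> :: "nat \<Rightarrow> 'a \<Rightarrow> 'a"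
    and \<phi> :: "nat \<Rightarrow> 'b \<Rightarrow> 'a"
    and K :: "nat \<Rightarrow> 'k measure" and d :: "nat \<Rightarrow> 'k metric" and \<nu> :: "nat \<Rightarrow> ('g \<Rightarrow> 'k) measure"
    and \<alpha> :: "nat \<Rightarrow> 'a \<Rightarrow> 'g \<Rightarrow> 'k" and \<beta> :: "nat \<Rightarrow> ('g \<Rightarrow> 'k) \<Rightarrow> 'a"
    and \<iota> :: "nat \<Rightarrow> 'k \<Rightarrow> nat \<Rightarrow> real" and r :: "nat \<Rightarrow> (nat \<Rightarrow> real) \<Rightarrow> 'k"
  assumes sysN: "G_system G N S"
    and factor_\<phi>: "\<And>k. factor_map G N S (M k) (T k) (\<phi> k)"
    and \<pi>: "\<And>k. \<pi> k \<in> measurable (M (Suc k)) (M k)"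
    and \<pi>\<phi>: "\<And>k. AE x in N. \<pi> k (\<phi> (Suc k) x) = \<phi> k x"
    and generating: "\<And>A. A \<in> sets N \<Longrightarrow>
      \<exists>B\<in>sigma_sets (space N) (\<Union>i. {\<phi> i -` C \<inter> space N |C. C \<in> sets (M i)}). (A - B) \<union> (B - A) \<in> null_sets N"
    and proc: "\<And>k. metric_process G (K k) (d k) (\<nu> k)"
    and conn: "\<And>k. process_connected_model_spaces G V \<sigma> (K k) (d k) (\<nu> k)"
    and factor_\<alpha>: "\<And>k. factor_map G (M k) (T k) (\<nu> k) (shift G) (\<alpha> k)"
    and \<beta>: "\<And>k. \<beta> k \<in> measurable (\<nu> k) (M k)" "\<And>k. AE x in M k. \<beta> k (\<alpha> k x) = x"
    and \<iota>: "\<And>k. continuous_map (mtopology_of (d k)) cube_topology (\<iota> k)" "\<And>k. inj_on (\<iota> k) (mspace (d k))"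
    and r: "\<And>k. r k \<in> measurable cube_algebra (K k)" "\<And>k a. a \<in> mspace (d k) \<Longrightarrow> r k (\<iota> k a) = a"
begin

interpretation group G by (rule group)

interpretation N: prob_space N using sysN by (simp add: G_system_def)

abbreviation "cube_names \<equiv> PiM (carrier G) (\<lambda>_. cube_algebra)"

lemma S: "g \<in> carrier G \<Longrightarrow> S g \<in> measurable N N" "x \<in> space N \<Longrightarrow> S \<one> x = x"
  "g \<in> carrier G \<Longrightarrow> h \<in> carrier G \<Longrightarrow> x \<in> space N \<Longrightarrow> S (g \<otimes> h) x = S g (S h x)"
  "g \<in> carrier G \<Longrightarrow> distr N N (S g) = N"
  using sysN by (simp_all add: G_system_def)

lemmas procD = metric_processD[OF proc countable]

lemma \<phi>: "\<phi> k \<in> measurable N (M k)" "distr N (M k) (\<phi> k) = M k"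
  "g \<in> carrier G \<Longrightarrow> AE x in N. \<phi> k (S g x) = T k g (\<phi> k x)"
  using factor_\<phi>[of k] by (simp_all add: factor_map_def)

lemma \<alpha>: "\<alpha> k \<in> measurable (M k) (\<nu> k)" "distr (M k) (\<nu> k) (\<alpha> k) = \<nu> k"
  "g \<in> carrier G \<Longrightarrow> AE x in M k. \<alpha> k (T k g x) = shift G g (\<alpha> k x)"
  using factor_\<alpha>[of k] by (simp_all add: factor_map_def)

lemma AE_through_\<phi>: "AE x in M k. P x \<Longrightarrow> AE x in N. P (\<phi> k x)"
  using AE_distrD[OF \<phi>(1)[of k], where P = P] by (simp only: \<phi>(2))

text \<open>The name of \<open>x\<close> at level \<open>k\<close>.\<close>

definition "\<theta> k x = \<alpha> k (\<phi> k x)"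

lemma \<theta>_measurable: "\<theta> k \<in> measurable N (\<nu> k)"
  unfolding \<theta>_def[abs_def] using measurable_compose[OF \<phi>(1) \<alpha>(1)] .

lemma \<theta>_distr: "distr N (\<nu> k) (\<theta> k) = \<nu> k"
  using distr_distr[OF \<alpha>(1) \<phi>(1), of k] \<phi>(2) \<alpha>(2) by (simp add: \<theta>_def[abs_def] o_def)

lemma \<theta>_in: "x \<in> space N \<Longrightarrow> \<theta> k x \<in> carrier G \<rightarrow>\<^sub>E mspace (d k)"
  using measurable_space[OF \<theta>_measurable] procD(7) by blast

lemma \<theta>_equivariant: "AE x in N. \<forall>g\<in>carrier G. \<theta> k (S g x) = shift G g (\<theta> k x)"
proof (rule AE_ball_countable')
  fix g assume g: "g \<in> carrier G"
  show "AE x in N. \<theta> k (S g x) = shift G g (\<theta> k x)"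
    using \<phi>(3)[OF g, of k] AE_through_\<phi>[OF \<alpha>(3)[OF g]] by eventually_elim (simp add: \<theta>_def)
qed (rule countable)

lemma \<beta>\<theta>: "AE x in N. \<beta> k (\<theta> k x) = \<phi> k x"
  using AE_through_\<phi>[OF \<beta>(2)] by (simp add: \<theta>_def)

definition coding :: "'b \<Rightarrow> nat \<Rightarrow> real" where
  "coding x c = (case prod_decode c of (k, m) \<Rightarrow> \<iota> k (\<theta> k x \<one>) m)"

text \<open>Names are formed from the orbit of \<open>x\<close> rather than from the names \<open>\<theta> k x\<close>, since the latter are
  equivariant only almost everywhere.\<close>

definition code_name :: "'b \<Rightarrow> 'g \<Rightarrow> nat \<Rightarrow> real" where
  "code_name x = (\<lambda>g\<in>carrier G. coding (S g x))"

definition block :: "nat \<Rightarrow> (nat \<Rightarrow> real) \<Rightarrow> nat \<Rightarrow> real" where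
  "block k w m = w (prod_encode (k, m))"

definition limit_law :: "('g \<Rightarrow> nat \<Rightarrow> real) measure" where
  "limit_law = distr N cube_names code_name"

lemma \<iota>_in_cube: "a \<in> mspace (d k) \<Longrightarrow> \<iota> k a \<in> hilbert_cube"
  using continuous_map_funspace[OF \<iota>(1)] by fastforce

lemma \<iota>_coordinate_measurable: "(\<lambda>a. \<iota> k a m) \<in> borel_measurable (K k)"
  using \<iota>(1)[of k] continuous_map_borel_measurable procD(2) unfolding continuous_map_cube_iff by blast

lemma first_symbol_measurable: "(\<lambda>z. z \<one>) \<in> measurable (\<nu> k) (K k)"
  using measurable_component_singleton[OF one_closed, of "\<lambda>_. K k"] measurable_cong_sets[OF procD(5) refl] by blast

lemma coding_in_cube:
  assumes x: "x \<in> space N"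
  shows "coding x \<in> hilbert_cube"
proof -
  have "\<iota> k (\<theta> k x \<one>) \<in> hilbert_cube" for k
    using \<theta>_in[OF x] one_closed by (intro \<iota>_in_cube) (rule PiE_mem)
  then show ?thesis unfolding hilbert_cube_def coding_def by (simp split: prod.split)
qed

lemma coding_coordinate_measurable: "(\<lambda>x. coding x c) \<in> borel_measurable N"
proof -
  obtain k m where c: "prod_decode c = (k, m)" by fastforce
  show ?thesis
    unfolding coding_def c prod.case
    using measurable_compose[OF measurable_compose[OF \<theta>_measurable first_symbol_measurable] \<iota>_coordinate_measurable] .
qed

lemma coding_measurable: "coding \<in> measurable N cube_algebra"
  by (rule measurable_cube_algebraI) (fact coding_in_cube coding_coordinate_measurable)+

lemma code_name_measurable: "code_name \<in> measurable N cube_names"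
  unfolding code_name_def[abs_def]
  by (intro measurable_restrict measurable_compose[OF S(1) coding_measurable])

lemma code_name_one: "x \<in> space N \<Longrightarrow> code_name x \<one> = coding x"
  by (simp add: code_name_def S(2))

lemma code_name_equivariant:
  assumes "h \<in> carrier G" "x \<in> space N"
  shows "code_name (S h x) = shift G h (code_name x)"
  using assms by (auto simp: code_name_def shift_def S(3))

lemma continuous_map_block: "continuous_map cube_topology cube_topology (block k)"
proof -
  have "continuous_map cube_topology cube_topology (\<lambda>w. w)" by (rule continuous_map_id[unfolded id_def])
  then show ?thesis unfolding continuous_map_cube_iff by (auto simp: block_def hilbert_cube_def)
qed

lemma block_measurable: "block k \<in> measurable cube_algebra cube_algebra"
  unfolding cube_algebra_def by (rule continuous_map_measurable_borel_on[OF continuous_map_block])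

lemma block_coding: "block k (coding x) = \<iota> k (\<theta> k x \<one>)"
  by (auto simp: block_def coding_def)

lemma block_code_name: "AE x in N. pointwise G (block k) (code_name x) = pointwise G (\<iota> k) (\<theta> k x)"
  using \<theta>_equivariant[of k]
proof eventually_elim
  case (elim x)
  show ?case
  proof
    fix g
    show "pointwise G (block k) (code_name x) g = pointwise G (\<iota> k) (\<theta> k x) g"
      using elim by (cases "g \<in> carrier G") (auto simp: pointwise_def code_name_def block_coding shift_def)
  qed
qed

definition recover :: "nat \<Rightarrow> ('g \<Rightarrow> nat \<Rightarrow> real) \<Rightarrow> 'a" where
  "recover k y = \<beta> k (pointwise G (r k) y)"

lemma recover_measurable: "recover k \<in> measurable cube_names (M k)"
proof -
  have "pointwise G (r k) \<in> measurable cube_names (\<nu> k)"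
    using measurable_pointwise[OF r(1)] measurable_cong_sets[OF refl procD(5)] by blast
  from measurable_compose[OF this \<beta>(1)] show ?thesis by (simp add: recover_def[abs_def])
qed

text \<open>By equivariance of \<open>\<theta> k\<close> the level \<open>k\<close> coordinates of a code name form the embedded name at
  level \<open>k\<close>, from which \<open>r k\<close> and \<open>\<beta> k\<close> retrieve the point of level \<open>k\<close>.\<close>

lemma recover_code_name: "AE x in N. recover k (pointwise G (block k) (code_name x)) = \<phi> k x"
  using block_code_name[of k] \<beta>\<theta>[of k] AE_space
proof eventually_elim
  case (elim x)
  have "pointwise G (r k) (pointwise G (\<iota> k) (\<theta> k x)) = \<theta> k x"
  proof
    fix g
    show "pointwise G (r k) (pointwise G (\<iota> k) (\<theta> k x)) g = \<theta> k x g"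
      using \<theta>_in[OF elim(3), of k] r(2)
      by (cases "g \<in> carrier G") (auto simp: pointwise_def PiE_iff extensional_def)
  qed
  then show ?case using elim by (simp add: recover_def)
qed

lemma limit_process: "metric_process G cube_algebra cube_metric limit_law"
  unfolding metric_process_def
proof (intro conjI ballI)
  show "prob_space limit_law" unfolding limit_law_def by (intro N.prob_space_distr code_name_measurable)
  fix h assume h: "h \<in> carrier G"
  have sh: "shift G h \<in> measurable cube_names cube_names"
    unfolding shift_def[abs_def] using h by (intro measurable_restrict measurable_component_singleton) simp
  have "distr limit_law limit_law (shift G h) = distr limit_law cube_names (shift G h)"
    by (rule distr_cong) (auto simp: limit_law_def)
  also have "\<dots> = distr N cube_names (shift G h \<circ> code_name)"
    unfolding limit_law_def by (rule distr_distr[OF sh code_name_measurable])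
  also have "\<dots> = distr N cube_names (code_name \<circ> S h)"
    by (rule distr_cong) (auto simp: code_name_equivariant h)
  also have "\<dots> = distr (distr N N (S h)) cube_names code_name"
    using h by (intro distr_distr[symmetric] code_name_measurable S(1))
  also have "\<dots> = limit_law" using S(4)[OF h] by (simp add: limit_law_def)
  finally show "distr limit_law limit_law (shift G h) = limit_law" .
next
  show "sets cube_algebra = sets (borel_on cube_topology)" by (simp add: cube_algebra_def)
qed (simp_all add: standard_borel_cube_algebra compact_space_cube limit_law_def)

lemmas limitD = metric_processD[OF limit_process countable]

lemma continuous_cube_names_measurable:
  "continuous_map (cube_space G) euclideanreal f \<Longrightarrow> f \<in> borel_measurable cube_names"
  using continuous_map_borel_measurable limitD(6) limitD(5) measurable_cong_sets by metis

lemma integral_block_law: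
  assumes f: "continuous_map (cube_space G) euclideanreal f"
  shows "(\<integral>z. f (pointwise G (block k) z) \<partial>limit_law) = (\<integral>z. f (pointwise G (\<iota> k) z) \<partial>\<nu> k)"
proof -
  have f1: "(\<lambda>z. f (pointwise G (block k) z)) \<in> borel_measurable cube_names"
    by (intro measurable_compose[OF measurable_pointwise[OF block_measurable]] continuous_cube_names_measurable f)
  have "continuous_map (process_topology G (d k)) euclideanreal (\<lambda>z. f (pointwise G (\<iota> k) z))"
    using continuous_map_compose[OF continuous_map_pointwise[OF \<iota>(1)] f] by (simp add: o_def)
  then have f2: "(\<lambda>z. f (pointwise G (\<iota> k) z)) \<in> borel_measurable (\<nu> k)"
    using continuous_map_borel_measurable procD(6) by blast
  have "(\<integral>z. f (pointwise G (block k) z) \<partial>limit_law) = (\<integral>x. f (pointwise G (block k) (code_name x)) \<partial>N)"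
    unfolding limit_law_def by (rule integral_distr[OF code_name_measurable f1])
  also have "\<dots> = (\<integral>x. f (pointwise G (\<iota> k) (\<theta> k x)) \<partial>N)"
  proof (rule integral_cong_AE)
    show "AE x in N. f (pointwise G (block k) (code_name x)) = f (pointwise G (\<iota> k) (\<theta> k x))"
      using block_code_name[of k] by eventually_elim simp
  qed (use measurable_compose[OF code_name_measurable f1] measurable_compose[OF \<theta>_measurable f2] in auto)
  also have "\<dots> = (\<integral>z. f (pointwise G (\<iota> k) z) \<partial>distr N (\<nu> k) (\<theta> k))"
    by (rule integral_distr[OF \<theta>_measurable f2, symmetric])
  finally show ?thesis by (simp add: \<theta>_distr)
qed

lemma lower_factor:
  assumes "j \<le> k"
  shows "\<exists>P\<in>measurable (M k) (M j). AE x in N. P (\<phi> k x) = \<phi> j x"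
  using assms
proof (induction k rule: dec_induct)
  case base
  show ?case by (intro bexI[of _ "\<lambda>x. x"]) auto
next
  case (step k)
  then obtain P where P: "P \<in> measurable (M k) (M j)" "AE x in N. P (\<phi> k x) = \<phi> j x" by blast
  have "AE x in N. P (\<pi> k (\<phi> (Suc k) x)) = \<phi> j x"
    using P(2) \<pi>\<phi>[of k] by eventually_elim simp
  then show ?case
    by (intro bexI[of _ "\<lambda>x. P (\<pi> k x)"] measurable_compose[OF \<pi> P(1)])
qed

text \<open>A coordinate that stems from level \<open>j \<le> k\<close> is a function of the point of level \<open>j\<close>, which the
  bonding maps compute from that of level \<open>k\<close>.\<close>

lemma coordinate_from_block:
  assumes "fst (prod_decode c) \<le> k"
  obtains h where "h \<in> borel_measurable cube_names" "\<And>y. y \<in> space cube_names \<Longrightarrow> 0 \<le> h y \<and> h y \<le> 1"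
    "AE x in N. h (pointwise G (block k) (code_name x)) = coding x c"
proof -
  obtain j m where c: "prod_decode c = (j, m)" by fastforce
  then have "j \<le> k" using assms by simp
  from lower_factor[OF this] obtain P where P: "P \<in> measurable (M k) (M j)" "AE x in N. P (\<phi> k x) = \<phi> j x"
    by blast
  define h where "h y = \<iota> j (\<alpha> j (P (recover k y)) \<one>) m" for y
  have m1: "(\<lambda>y. \<alpha> j (P (recover k y)) \<one>) \<in> measurable cube_names (K j)"
    using measurable_compose[OF measurable_compose[OF measurable_compose[OF recover_measurable P(1)] \<alpha>(1)] first_symbol_measurable] .
  show thesis
  proof
    show "h \<in> borel_measurable cube_names"
      unfolding h_def[abs_def] using measurable_compose[OF m1 \<iota>_coordinate_measurable] .
    show "0 \<le> h y \<and> h y \<le> 1" if "y \<in> space cube_names" for y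
      using \<iota>_in_cube[of _ j] measurable_space[OF m1 that] procD(3) by (auto simp: h_def hilbert_cube_def)
    show "AE x in N. h (pointwise G (block k) (code_name x)) = coding x c"
      using P(2) recover_code_name[of k] by eventually_elim (simp add: h_def coding_def c \<theta>_def)
  qed
qed

lemma approximate_coordinate:
  assumes "fst (prod_decode c) \<le> k" and "0 < \<epsilon>"
  shows "\<exists>w. continuous_map (cube_space G) euclideanreal w \<and> (\<forall>z. 0 \<le> w z \<and> w z \<le> 1) \<and>
    (\<integral>x. \<bar>coding x c - w (pointwise G (block k) (code_name x))\<bar> \<partial>N) < \<epsilon>"
proof -
  obtain h where h: "h \<in> borel_measurable cube_names" "\<And>y. y \<in> space cube_names \<Longrightarrow> 0 \<le> h y \<and> h y \<le> 1"
    "AE x in N. h (pointwise G (block k) (code_name x)) = coding x c"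
    using coordinate_from_block[OF assms(1)] by blast
  define b where "b x = pointwise G (block k) (code_name x)" for x
  have b: "b \<in> measurable N cube_names"
    unfolding b_def[abs_def] using measurable_compose[OF code_name_measurable measurable_pointwise[OF block_measurable]] .
  define \<rho> where "\<rho> = distr N cube_names b"
  have sets\<rho>: "sets \<rho> = sets (borel_on (cube_space G))"
    using limitD(5,6) by (simp add: \<rho>_def)
  have prob: "prob_space \<rho>" unfolding \<rho>_def by (rule N.prob_space_distr[OF b])
  have h\<rho>: "h \<in> borel_measurable \<rho>" "\<And>y. y \<in> space \<rho> \<Longrightarrow> 0 \<le> h y \<and> h y \<le> 1"
    using h(1,2) by (simp_all add: \<rho>_def)
  obtain w where w: "continuous_map (cube_space G) euclideanreal w"
    "\<And>z. 0 \<le> w z \<and> w z \<le> 1" "(\<integral>z. \<bar>h z - w z\<bar> \<partial>\<rho>) < \<epsilon>"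
    using continuous_dense_L1[OF metrizable_process_topology[OF countable] prob sets\<rho> h\<rho> assms(2)] by blast
  have wm: "w \<in> borel_measurable cube_names" using w(1) by (rule continuous_cube_names_measurable)
  have "(\<integral>z. \<bar>h z - w z\<bar> \<partial>\<rho>) = (\<integral>x. \<bar>h (b x) - w (b x)\<bar> \<partial>N)"
    unfolding \<rho>_def using h(1) wm by (intro integral_distr[OF b]) auto
  also have "\<dots> = (\<integral>x. \<bar>coding x c - w (b x)\<bar> \<partial>N)"
  proof (rule integral_cong_AE)
    show "AE x in N. \<bar>h (b x) - w (b x)\<bar> = \<bar>coding x c - w (b x)\<bar>"
      using h(3) by eventually_elim (simp add: b_def)
  qed (use measurable_compose[OF b h(1)] measurable_compose[OF b wm] coding_coordinate_measurable in auto)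
  finally show ?thesis using w unfolding b_def by auto
qed

text \<open>Only the finitely many coordinates in \<open>J\<close> matter; \<open>k\<close> bounds all their levels, and each is
  approximated separately. The remaining coordinates of \<open>F\<close> are set to zero.\<close>

lemma approximate_reconstruction:
  assumes "0 < \<epsilon>"
  obtains k F where "continuous_map (cube_space G) cube_topology F"
    "(\<integral>z. dist (z \<one>) (F (pointwise G (block k) z)) \<partial>limit_law) < \<epsilon>"
proof -
  obtain J where J: "finite J" "\<And>x y :: nat \<Rightarrow> real. dist x y \<le> 2 * (\<Sum>c\<in>J. \<bar>x c - y c\<bar>) + \<epsilon> / 2"
    using cube_dist_le[of "\<epsilon> / 2"] assms by auto
  define k where "k = Max (insert 0 ((\<lambda>c. fst (prod_decode c)) ` J))"
  have k: "fst (prod_decode c) \<le> k" if "c \<in> J" for c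
    unfolding k_def using that J(1) by (intro Max_ge) auto
  \<comment> \<open>The errors over \<open>J\<close> enter with factor \<open>2\<close> and may use up \<open>\<epsilon> / 2\<close>; the summand \<open>1\<close> covers
    an empty \<open>J\<close>.\<close>
  define \<eta> where "\<eta> = \<epsilon> / (4 * (real (card J) + 1))"
  have \<eta>: "0 < \<eta>" using assms by (simp add: \<eta>_def)
  define approximant where "approximant c u \<longleftrightarrow>
    continuous_map (cube_space G) euclideanreal u \<and> (\<forall>z. 0 \<le> u z \<and> u z \<le> 1) \<and>
    (\<integral>x. \<bar>coding x c - u (pointwise G (block k) (code_name x))\<bar> \<partial>N) < \<eta>" for c u
  have "\<exists>u. approximant c u" if "c \<in> J" for c
    unfolding approximant_def by (rule approximate_coordinate[OF k[OF that] \<eta>])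
  then obtain w where "\<And>c. c \<in> J \<Longrightarrow> approximant c (w c)" by metis
  then have w: "\<And>c. c \<in> J \<Longrightarrow> continuous_map (cube_space G) euclideanreal (w c)"
    "\<And>c z. c \<in> J \<Longrightarrow> 0 \<le> w c z \<and> w c z \<le> 1"
    "\<And>c. c \<in> J \<Longrightarrow> (\<integral>x. \<bar>coding x c - w c (pointwise G (block k) (code_name x))\<bar> \<partial>N) < \<eta>"
    unfolding approximant_def by blast+
  define F where "F z c = (if c \<in> J then w c z else 0)" for z c
  have F: "continuous_map (cube_space G) cube_topology F"
    unfolding continuous_map_cube_iff
  proof (intro conjI allI)
    show "F \<in> topspace (cube_space G) \<rightarrow> hilbert_cube"
      using w(2) by (auto simp: F_def hilbert_cube_def)
    show "continuous_map (cube_space G) euclideanreal (\<lambda>z. F z c)" for c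
      using w(1) by (cases "c \<in> J") (simp_all add: F_def)
  qed
  define b where "b x = pointwise G (block k) (code_name x)" for x
  have b: "b \<in> measurable N cube_names"
    unfolding b_def[abs_def] using measurable_compose[OF code_name_measurable measurable_pointwise[OF block_measurable]] .
  have cont: "continuous_map (cube_space G) euclideanreal (\<lambda>z. dist (z \<one>) (F (pointwise G (block k) z)))"
  proof -
    have "continuous_map (cube_space G) cube_topology (\<lambda>z. z \<one>)"
      unfolding process_topology_def using one_closed by (intro continuous_map_product_projection)
    moreover have "continuous_map (cube_space G) cube_topology (F \<circ> pointwise G (block k))"
      using continuous_map_compose[OF continuous_map_pointwise[OF continuous_map_block] F] .
    ultimately have "continuous_map (cube_space G) euclideanreal
        (\<lambda>z. mdist cube_metric (z \<one>) ((F \<circ> pointwise G (block k)) z))"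
      by (intro continuous_map_mdist)
    then show ?thesis by simp
  qed
  have int: "integrable N (\<lambda>x. \<bar>coding x c - w c (b x)\<bar>)" if c: "c \<in> J" for c
  proof (rule N.integrable_unit_interval)
    show "(\<lambda>x. \<bar>coding x c - w c (b x)\<bar>) \<in> borel_measurable N"
      using coding_coordinate_measurable measurable_compose[OF b continuous_cube_names_measurable[OF w(1)[OF c]]] by auto
    show "0 \<le> \<bar>coding x c - w c (b x)\<bar> \<and> \<bar>coding x c - w c (b x)\<bar> \<le> 1" if "x \<in> space N" for x
      using coding_in_cube[OF that] w(2)[OF c, of "b x"] by (auto simp: hilbert_cube_def abs_le_iff) (smt (verit))+
  qed
  have "(\<integral>z. dist (z \<one>) (F (pointwise G (block k) z)) \<partial>limit_law) = (\<integral>x. dist (code_name x \<one>) (F (b x)) \<partial>N)"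
    unfolding limit_law_def b_def
    by (rule integral_distr[OF code_name_measurable continuous_cube_names_measurable[OF cont]])
  also have "\<dots> \<le> (\<integral>x. 2 * (\<Sum>c\<in>J. \<bar>coding x c - w c (b x)\<bar>) + \<epsilon> / 2 \<partial>N)"
  proof (rule integral_mono)
    have "integrable limit_law (\<lambda>z. dist (z \<one>) (F (pointwise G (block k) z)))"
      using integrable_continuous_map[OF compact_process_topology[OF compact_space_cube] cont limitD(4,6)] .
    then show "integrable N (\<lambda>x. dist (code_name x \<one>) (F (b x)))"
      unfolding limit_law_def b_def
      using integrable_distr_eq[OF code_name_measurable continuous_cube_names_measurable[OF cont]] by simp
    show "integrable N (\<lambda>x. 2 * (\<Sum>c\<in>J. \<bar>coding x c - w c (b x)\<bar>) + \<epsilon> / 2)"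
      using int by (intro Bochner_Integration.integrable_add integrable_mult_right
          Bochner_Integration.integrable_sum N.integrable_const) auto
    fix x assume "x \<in> space N"
    then show "dist (code_name x \<one>) (F (b x)) \<le> 2 * (\<Sum>c\<in>J. \<bar>coding x c - w c (b x)\<bar>) + \<epsilon> / 2"
      using J(2)[of "coding x" "F (b x)"] by (simp add: code_name_one F_def)
  qed
  also have "\<dots> = 2 * (\<Sum>c\<in>J. \<integral>x. \<bar>coding x c - w c (b x)\<bar> \<partial>N) + \<epsilon> / 2"
    using int by (simp add: N.prob_space)
  also have "\<dots> \<le> 2 * (\<Sum>c\<in>J. \<eta>) + \<epsilon> / 2"
    using w(3) by (intro add_right_mono mult_left_mono sum_mono) (auto simp: b_def less_imp_le)
  also have "2 * (\<Sum>c\<in>J. \<eta>) < \<epsilon> / 2"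
    using assms by (simp add: \<eta>_def field_simps)
  finally have "(\<integral>z. dist (z \<one>) (F (pointwise G (block k) z)) \<partial>limit_law) < \<epsilon>" by simp
  then show thesis using that F by blast
qed

lemma limit_process_connected: "process_connected_model_spaces G V \<sigma> cube_algebra cube_metric limit_law"
proof (rule cube_process_connected[OF limit_process, where 'k = 'k])
  fix \<epsilon> :: real assume "0 < \<epsilon>"
  then obtain k F where F: "continuous_map (cube_space G) cube_topology F"
    "(\<integral>z. dist (z \<one>) (F (pointwise G (block k) z)) \<partial>limit_law) < \<epsilon>" by (rule approximate_reconstruction)
  show "\<exists>(K' :: 'k measure) d' \<mu>' \<iota> q F. metric_process G K' d' \<mu>' \<and>
      process_connected_model_spaces G V \<sigma> K' d' \<mu>' \<and>
      continuous_map (mtopology_of d') cube_topology \<iota> \<and> inj_on \<iota> (mspace d') \<and>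
      continuous_map cube_topology cube_topology q \<and>
      (\<forall>f. continuous_map (cube_space G) euclideanreal f \<longrightarrow>
         (\<integral>z. f (pointwise G q z) \<partial>limit_law) = (\<integral>z. f (pointwise G \<iota> z) \<partial>\<mu>')) \<and>
      continuous_map (cube_space G) cube_topology F \<and>
      (\<integral>z. dist (z \<one>) (F (pointwise G q z)) \<partial>limit_law) < \<epsilon>"
    by (rule exI[of _ "K k"], rule exI[of _ "d k"], rule exI[of _ "\<nu> k"], rule exI[of _ "\<iota> k"],
        rule exI[of _ "block k"], rule exI[of _ F])
      (use proc conn \<iota> continuous_map_block integral_block_law F in blast)
qed

text \<open>The sets that agree with a preimage under \<open>code_name\<close> outside a null set form a \<open>\<sigma>\<close>-algebra
  containing the generators that come from the levels.\<close>

lemma sets_from_code: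
  assumes "A \<in> sets N"
  shows "\<exists>B\<in>sets cube_names. AE x in N. x \<in> A \<longleftrightarrow> code_name x \<in> B"
proof -
  obtain A' where A': "A' \<in> sigma_sets (space N) (\<Union>i. {\<phi> i -` C \<inter> space N |C. C \<in> sets (M i)})"
    "(A - A') \<union> (A' - A) \<in> null_sets N" using generating[OF assms] by blast
  have "\<exists>B\<in>sets cube_names. AE x in N. x \<in> A' \<longleftrightarrow> code_name x \<in> B"
    using A'(1)
  proof induction
    case (Basic a)
    then obtain i C where C: "C \<in> sets (M i)" "a = \<phi> i -` C \<inter> space N" by blast
    define R where "R y = recover i (pointwise G (block i) y)" for y
    have R: "R \<in> measurable cube_names (M i)"
      unfolding R_def[abs_def] using measurable_compose[OF measurable_pointwise[OF block_measurable] recover_measurable] .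
    have "AE x in N. x \<in> a \<longleftrightarrow> code_name x \<in> R -` C \<inter> space cube_names"
      using recover_code_name[of i] AE_space
    proof eventually_elim
      case (elim x)
      then show ?case using C(2) measurable_space[OF code_name_measurable elim(2)] by (simp add: R_def)
    qed
    then show ?case using measurable_sets[OF R C(1)] by blast
  next
    case Empty
    show ?case by (intro bexI[of _ "{}"]) auto
  next
    case (Compl a)
    then obtain B where B: "B \<in> sets cube_names" "AE x in N. x \<in> a \<longleftrightarrow> code_name x \<in> B" by blast
    have "AE x in N. x \<in> space N - a \<longleftrightarrow> code_name x \<in> space cube_names - B"
      using B(2) AE_space
    proof eventually_elim
      case (elim x)
      then show ?case using measurable_space[OF code_name_measurable elim(2)] by simp
    qed
    then show ?case using B(1) by blast
  next
    case (Union a)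
    define codes where "codes i B \<longleftrightarrow> B \<in> sets cube_names \<and> (AE x in N. x \<in> a i \<longleftrightarrow> code_name x \<in> B)" for i B
    have "\<exists>B. codes i B" for i using Union.IH[of i] unfolding codes_def by blast
    then obtain B where "\<And>i. codes i (B i)" by metis
    then have B: "\<And>i. B i \<in> sets cube_names" "\<And>i. AE x in N. x \<in> a i \<longleftrightarrow> code_name x \<in> B i"
      unfolding codes_def by blast+
    have "AE x in N. \<forall>i. x \<in> a i \<longleftrightarrow> code_name x \<in> B i" using B(2) by (simp add: AE_all_countable)
    then have "AE x in N. x \<in> (\<Union>i. a i) \<longleftrightarrow> code_name x \<in> (\<Union>i. B i)" by eventually_elim auto
    then show ?case using B(1) by blast
  qed
  moreover have "AE x in N. x \<in> A \<longleftrightarrow> x \<in> A'"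
    using AE_not_in[OF A'(2)] by eventually_elim auto
  ultimately show ?thesis by (auto elim: eventually_elim2)
qed

lemma limit_process_isomorphic: "isomorphic_systems G N S limit_law (shift G)"
proof -
  have std: "standard_borel N" using sysN by (simp add: G_system_def)
  obtain \<Psi> where \<Psi>: "\<Psi> \<in> measurable cube_names N" "AE x in N. \<Psi> (code_name x) = x"
    using ae_left_inverse[OF std N.not_empty code_name_measurable sets_from_code] by blast
  have sl: "sets limit_law = sets cube_names" by (simp add: limit_law_def)
  have cl: "code_name \<in> measurable N limit_law"
    using code_name_measurable measurable_cong_sets[OF refl sl] by blast
  have "factor_map G N S limit_law (shift G) code_name"
    unfolding factor_map_def
  proof (intro conjI ballI)
    show "AE x in N. code_name (S g x) = shift G g (code_name x)" if "g \<in> carrier G" for g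
      using AE_space by eventually_elim (simp add: code_name_equivariant that)
    show "distr N limit_law code_name = limit_law"
      unfolding limit_law_def by (rule distr_cong) auto
  qed (rule cl)
  moreover have "\<Psi> \<in> measurable limit_law N" using \<Psi>(1) measurable_cong_sets[OF sl refl] by blast
  moreover have "AE y in limit_law. code_name (\<Psi> y) = y"
  proof -
    have cm: "(\<lambda>y. code_name (\<Psi> y)) \<in> measurable cube_names cube_names"
      using measurable_compose[OF \<Psi>(1) code_name_measurable] .
    have "{y \<in> space cube_names. code_name (\<Psi> y) = y} =
        (\<Inter>g\<in>carrier G. \<Inter>c. {y \<in> space cube_names. code_name (\<Psi> y) g c = y g c})"
    proof (intro equalityI subsetI)
      fix y assume y: "y \<in> (\<Inter>g\<in>carrier G. \<Inter>c. {y \<in> space cube_names. code_name (\<Psi> y) g c = y g c})"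
      then have sp: "y \<in> space cube_names" using one_closed by blast
      have "code_name (\<Psi> y) g = y g" for g
        using y sp by (cases "g \<in> carrier G") (auto simp: code_name_def space_PiM PiE_iff extensional_def)
      then show "y \<in> {y \<in> space cube_names. code_name (\<Psi> y) = y}" using sp by auto
    qed auto
    also have "\<dots> \<in> sets cube_names"
    proof (rule sets.countable_INT')
      show "countable (carrier G)" by (rule countable)
      show "carrier G \<noteq> {}" using one_closed by blast
      show "(\<lambda>g. \<Inter>c. {y \<in> space cube_names. code_name (\<Psi> y) g c = y g c}) ` carrier G \<subseteq> sets cube_names"
      proof safe
        fix g assume g: "g \<in> carrier G"
        have coord: "(\<lambda>y. y g c) \<in> borel_measurable cube_names" for c
          by (rule measurable_compose[OF measurable_component_singleton[OF g] measurable_coordinate_cube_algebra])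
        have "{y \<in> space cube_names. code_name (\<Psi> y) g c = y g c} \<in> sets cube_names" for c
          using measurable_compose[OF cm coord] coord by (rule borel_measurable_eq)
        then show "(\<Inter>c. {y \<in> space cube_names. code_name (\<Psi> y) g c = y g c}) \<in> sets cube_names" by auto
      qed
    qed
    finally have fixed: "{y \<in> space cube_names. code_name (\<Psi> y) = y} \<in> sets cube_names" .
    have "AE x in N. code_name (\<Psi> (code_name x)) = code_name x"
      using \<Psi>(2) by eventually_elim simp
    then show ?thesis unfolding limit_law_def by (subst AE_distr_iff[OF code_name_measurable fixed])
  qed
  ultimately show ?thesis unfolding isomorphic_systems_def using \<Psi>(2) by blast
qed

end

theorem theoremB:
  fixes G :: "('g, 'z) monoid_scheme"
    and V :: "nat \<Rightarrow> 'v set"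
    and \<sigma> :: "nat \<Rightarrow> 'g \<Rightarrow> 'v \<Rightarrow> 'v"
    and M :: "nat \<Rightarrow> 'a measure"
    and T :: "nat \<Rightarrow> 'g \<Rightarrow> 'a \<Rightarrow> 'a"
    and \<pi> :: "nat \<Rightarrow> 'a \<Rightarrow> 'a"
    and N :: "'b measure"
    and S :: "'g \<Rightarrow> 'b \<Rightarrow> 'b"
  assumes "group G" and "countable (carrier G)"
    and "sofic_approximation G V \<sigma>"
    and "\<And>i. G_system G (M i) (T i)"
    and "\<And>i. factor_map G (M (Suc i)) (T (Suc i)) (M i) (T i) (\<pi> i)"
    and "inverse_limit G M T \<pi> N S"
    and "\<And>i. connected_model_spaces G V \<sigma> (M i) (T i)"
  shows "connected_model_spaces G V \<sigma> N S"
proof -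
  obtain \<phi> where sysN: "G_system G N S" and \<phi>: "\<And>i. factor_map G N S (M i) (T i) (\<phi> i)"
    "\<And>i. AE x in N. \<pi> i (\<phi> (Suc i) x) = \<phi> i x"
    "\<And>A. A \<in> sets N \<Longrightarrow> \<exists>B\<in>sigma_sets (space N) (\<Union>i. {\<phi> i -` C \<inter> space N |C. C \<in> sets (M i)}).
       (A - B) \<union> (B - A) \<in> null_sets N"
    using assms(6) unfolding inverse_limit_def by blast
  obtain K :: "nat \<Rightarrow> (nat \<Rightarrow> real) measure" and d \<nu> where proc: "\<And>i. metric_process G (K i) (d i) (\<nu> i)"
    and iso: "\<And>i. isomorphic_systems G (M i) (T i) (\<nu> i) (shift G)"
    and conn: "\<And>i. process_connected_model_spaces G V \<sigma> (K i) (d i) (\<nu> i)"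
    using assms(7) unfolding connected_model_spaces_def by metis
  define inverse_pair where "inverse_pair i a b \<longleftrightarrow> factor_map G (M i) (T i) (\<nu> i) (shift G) a \<and>
    b \<in> measurable (\<nu> i) (M i) \<and> (AE x in M i. b (a x) = x)" for i a b
  have "\<exists>a b. inverse_pair i a b" for i
    using iso[of i] unfolding isomorphic_systems_def inverse_pair_def by blast
  then obtain \<alpha> \<beta> where "\<And>i. inverse_pair i (\<alpha> i) (\<beta> i)" by metis
  then have \<alpha>: "\<And>i. factor_map G (M i) (T i) (\<nu> i) (shift G) (\<alpha> i)"
    and \<beta>: "\<And>i. \<beta> i \<in> measurable (\<nu> i) (M i)" "\<And>i. AE x in M i. \<beta> i (\<alpha> i x) = x"
    unfolding inverse_pair_def by blast+
  note procD = metric_processD[OF proc assms(2)]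
  have "\<exists>\<iota> r. continuous_map (mtopology_of (d i)) cube_topology \<iota> \<and> inj_on \<iota> (mspace (d i)) \<and>
      r \<in> measurable cube_algebra (K i) \<and> (\<forall>a\<in>mspace (d i). r (\<iota> a) = a)" for i
  proof -
    have "\<one>\<^bsub>G\<^esub> \<in> carrier G" using assms(1) by (intro monoid.one_closed group.is_monoid)
    then have ne: "mspace (d i) \<noteq> {}"
      using prob_space.not_empty[OF procD(4)] procD(7) by (metis PiE_eq_empty_iff)
    obtain \<iota> where \<iota>: "continuous_map (mtopology_of (d i)) cube_topology \<iota>" "inj_on \<iota> (mspace (d i))"
      using compact_metric_embeds_in_cube[OF procD(1) ne] by blast
    obtain r where "r \<in> measurable cube_algebra (K i)" "\<And>a. a \<in> mspace (d i) \<Longrightarrow> r (\<iota> a) = a"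
      using measurable_left_inverse_of_embedding[OF procD(1) ne procD(2) \<iota>] by blast
    then show ?thesis using \<iota> by blast
  qed
  then obtain \<iota> r where \<iota>: "\<And>i. continuous_map (mtopology_of (d i)) cube_topology (\<iota> i)"
    "\<And>i. inj_on (\<iota> i) (mspace (d i))"
    and r: "\<And>i. r i \<in> measurable cube_algebra (K i)" "\<And>i a. a \<in> mspace (d i) \<Longrightarrow> r i (\<iota> i a) = a"
    by metis
  have \<pi>: "\<pi> i \<in> measurable (M (Suc i)) (M i)" for i using assms(5)[of i] by (simp add: factor_map_def)
  interpret process_tower G V \<sigma> N S M T \<pi> \<phi> K d \<nu> \<alpha> \<beta> \<iota> r
    by (intro process_tower.intro sofic_models.intro process_tower_axioms.intro assms(1-3) sysN \<phi> \<pi>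
        proc conn \<alpha> \<beta> \<iota> r)
  show ?thesis
    unfolding connected_model_spaces_def
    using limit_process limit_process_isomorphic limit_process_connected by blast
qed

end
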